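(* Let $K$ be an oriented virtual knot that is totally flat-trivial. Then: (1) for all integers $n\ge 1$, $L^n_K(t,\ell)=P_K(t)$ and $F^n_K(t,\ell)=P_K(t)$; (2) $P_K(t)$ is palindromic. Here $P_K(t)$ is the affine index polynomial of $K$, and $L^n_K(t,\ell)$, $F^n_K(t,\ell)$ are the $L$-polynomials and $F$-polynomials of $K$.
   Context: **Virtual knots.** A virtual knot diagram is a generic closed curve immersed in the plane, each of whose double points is marked either as a classical crossing (with over/under information) or as a virtual crossing. Two diagrams represent the same virtual knot if they are related by planar isotopy and a finite sequence of classical Reidemeister moves (RI, RII, RIII; classical crossings only), virtual Reidemeister moves (VRI, VRII, VRIII; virtual crossings only) and the semi-virtual move SV (a strand with two consecutive virtual crossings is moved past a classical crossing). The moves in which a strand with two consecutive classical crossings passes over or under a virtual crossing are not allowed. For an oriented diagram $D$, $C(D)$ denotes the set of classical crossings of $D$. The sign $\operatorname{sgn}(c)=\pm1$ of $c\in C(D)$ is the usual one: when both strands at $c$ are drawn pointing upward, $\operatorname{sgn}(c)=+1$ if the overstrand goes from bottom-left to top-right, and $\operatorname{sgn}(c)=-1$ if it goes from bottom-right to top-left. **Index.** An arc of $D$ is a segment of the diagram between consecutive classical crossings (virtual crossings are ignored). To each arc $\alpha$ assign the integer $\lambda(\alpha)=\sum_{c\in O(\alpha)}\operatorname{sgn}(c)$, where $O(\alpha)$ is the set of classical crossings that are first met as overcrossings when travelling along the knot from $\alpha$ in the direction of its orientation. This is a Cheng coloring: at each classical crossing (of either sign), drawn with both strands pointing upward, if the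 incoming left arc has label $a$ and the incoming right arc has label $b$, then the outgoing left arc has label $b+1$ and the outgoing right arc has label $a-1$. With these $a,b$, the index of $c$ is $\operatorname{Ind}(c)=\operatorname{sgn}(c)(a-b-1)$. **Affine index polynomial and dwrithe.** The affine index polynomial is $P_K(t)=P_D(t)=\sum_{c\in C(D)}\operatorname{sgn}(c)\,(t^{\operatorname{Ind}(c)}-1)$. For $n\in\mathbb{Z}\setminus\{0\}$, the $n$-writhe $J_n(D)$ is the number of positive crossings of index $n$ minus the number of negative crossings of index $n$, and the $n$-dwrithe is $\nabla J_n(D)=J_n(D)-J_{-n}(D)$. A Laurent polynomial in $t$ is palindromic if its coefficients of $t^n$ and $t^{-n}$ coincide for all $n$. **Smoothing against orientation.** For a classical crossing $c$ of an oriented virtual knot diagram $D$, the diagram $D_c$ is obtained by removing $c$ and joining the two incoming ends at $c$ to each other and the two outgoing ends at $c$ to each other. The result is again a one-component virtual diagram. Its orientation agrees with that of $D$ on the part of the knot that runs from the outgoing end of the overstrand at $c$ to the incoming end of the understrand at $c$, and is reversed on the other part. **$L$- and $F$-polynomials.** For a diagram $D$ of an oriented virtual knot $K$ and an integer $n\ge1$, $$L_K^n(t,\ell)=\sum_{c\in C(D)}\operatorname{sgn}(c)\left(t^{\operatorname{Ind}(c)}\ell^{|\nabla J_n(D_c)|}-\ell^{|\nabla J_n(D)|}\right),$$ $$F_K^n(t,\ell)=\sum_{c\in C(D)}\operatorname{sgn}(c)\,t^{\operatorname{Ind}(c)}\ell^{\nabla J_n(D_c)}-\sum_{c\in T_n(D)}\operatorname{sgn}(c)\,\ell^{\nabla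 J_n(D_c)}-\sum_{c\in C(D)\setminus T_n(D)}\operatorname{sgn}(c)\,\ell^{\nabla J_n(D)},$$ where $T_n(D)=\{c\in C(D): |\nabla J_n(D_c)|=|\nabla J_n(D)|\}$. It is known (and may be assumed) that $P_K$, $L^n_K$, $F^n_K$, $J_n$ and $\nabla J_n$ are invariants of oriented virtual knots, i.e. do not depend on the choice of $D$, and that $\nabla J_n(D)$ is for each $n\ge1$ an invariant of the underlying oriented flat knot. **Flat diagrams and total flat-triviality.** The flat diagram underlying a virtual knot diagram is obtained by forgetting the over/under information at every classical crossing; classical crossings become flat crossings and virtual crossings remain virtual. Two flat diagrams are flat equivalent if they are related by planar isotopy and flat Reidemeister moves, which are the moves RI, RII, RIII, VRI, VRII, VRIII, SV with flat crossings in place of classical ones. A diagram $D$ of an oriented virtual knot is totally flat-trivial if the flat diagrams underlying $D$ and $D_c$, for all $c\in C(D)$, are flat equivalent to the unknot. A virtual knot is totally flat-trivial if it admits a totally flat-trivial diagram. *)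

theory Defs
  imports "HOL-Combinatorics.Orbits" "HOL-Library.Poly_Mapping"
begin

section \<open>Codes of generic closed curves\<close>

text \<open>
  A diagram is recorded up to isotopy by walking once along the oriented curve, starting at a
  base point off the double points, and listing the passages through double points (classical,
  flat \<^emph>\<open>and\<close> virtual ones). Draw a double point with both strands pointing upward: the passage
  of the strand coming from the bottom left has side \<open>FromLeft\<close>, the passage of the strand coming
  from the bottom right has side \<open>FromRight\<close>. The parameter \<open>'k\<close> holds the decoration of the
  passage (over, under, virtual, \<dots>).
\<close>

datatype side = FromLeft | FromRight

fun opp :: "side \<Rightarrow> side" where
  "opp FromLeft = FromRight"
| "opp FromRight = FromLeft"

datatype 'k passage = Passage (crossing: nat) (side: side) (kind: 'k)

type_synonym 'k code = "'k passage list"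

text \<open>
  \<open>X\<close> is the (symmetric) set of admissible pairs of decorations of the two passages through a
  double point.
\<close>

definition valid_code :: "('k \<times> 'k) set \<Rightarrow> 'k code \<Rightarrow> bool" where
  "valid_code X w \<longleftrightarrow>
    (\<forall>c \<in> crossing ` set w. \<exists>i j. i \<noteq> j \<and> {k. k < length w \<and> crossing (w ! k) = c} = {i, j} \<and>
       side (w ! i) = FromLeft \<and> side (w ! j) = FromRight \<and> (kind (w ! i), kind (w ! j)) \<in> X)"

definition partner :: "'k code \<Rightarrow> nat \<Rightarrow> nat" where
  "partner w i = (THE j. j < length w \<and> j \<noteq> i \<and> crossing (w ! j) = crossing (w ! i))"

text \<open>
  Planarity. A code determines a 4-valent graph with a rotation system. The dart \<open>(i, True)\<close> runs
  along the edge from passage \<open>i\<close> to passage \<open>i + 1\<close> (cyclically), \<open>(i, False)\<close> runs along the same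
  edge backwards. \<open>next_dart\<close> follows the boundary of the region to the left of a dart: it turns
  left at the double point reached. For example, a strand arriving from the bottom left leaves
  through the top left end, that is, along the other strand in forward direction. The code comes
  from a curve on the sphere iff the Euler characteristic \<open>m - 2 * m + faces\<close> is 2, where
  \<open>length w = 2 * m\<close>; the circle without double points is the code \<open>[]\<close>.

  Diagrams are taken up to isotopy on the sphere rather than in the plane. This gives the same
  virtual knots and flat knots: moving an arc without double points across the point at infinity
  is an instance of the detour move, which is generated by VRI, VRII, VRIII and SV.
\<close>

definition next_dart :: "'k code \<Rightarrow> nat \<times> bool \<Rightarrow> nat \<times> bool" where
  "next_dart w = (\<lambda>(i, forward).
     let n = length w;
         j = (if forward then (i + 1) mod n else i);
         p = partner w j
     in if (side (w ! j) = FromLeft) = forward then (p, True) else ((p + n - 1) mod n, False))"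

definition faces :: "'k code \<Rightarrow> (nat \<times> bool) set set" where
  "faces w = orbit (next_dart w) ` ({..<length w} \<times> UNIV)"

definition spherical :: "'k code \<Rightarrow> bool" where
  "spherical w \<longleftrightarrow> w = [] \<or> 2 * card (faces w) = length w + 4"

definition diagram :: "('k \<times> 'k) set \<Rightarrow> 'k code \<Rightarrow> bool" where
  "diagram X w \<longleftrightarrow> valid_code X w \<and> spherical w"


section \<open>Moves\<close>

text \<open>
  Corner of a triangle of strands: a strand that enters the corner double point from side \<open>s\<close> has
  the triangle on its left iff \<open>corner_left s b\<close>, where \<open>b\<close> says that the other strand meets this
  corner before its other corner of the triangle.
\<close>

definition corner_left :: "side \<Rightarrow> bool \<Rightarrow> bool" where
  "corner_left s other_first \<longleftrightarrow> ((s = FromLeft) = other_first)"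

definition ordered :: "bool \<Rightarrow> 'a \<Rightarrow> 'a \<Rightarrow> 'a list" where
  "ordered d a b = (if d then [a, b] else [b, a])"

text \<open>
  \<open>triangle T p q r\<close>: the pieces \<open>p\<close>, \<open>q\<close>, \<open>r\<close> of three strands form a triangular region with corners
  \<open>x\<close> (of \<open>p\<close> and \<open>q\<close>), \<open>y\<close> (of \<open>p\<close> and \<open>r\<close>) and \<open>z\<close> (of \<open>q\<close> and \<open>r\<close>). The region lies on the same side
  of each strand at both of its corners. \<open>T\<close> contains the admissible triples of decorations of
  \<open>x\<close>, \<open>y\<close>, \<open>z\<close>, each given as a pair in the order of strands just mentioned.
\<close>

inductive triangle ::
  "(('k \<times> 'k) \<times> ('k \<times> 'k) \<times> ('k \<times> 'k)) set \<Rightarrow> 'k code \<Rightarrow> 'k code \<Rightarrow> 'k code \<Rightarrow> bool" for T where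
  "((kxp, kxq), (kyp, kyr), (kzq, kzr)) \<in> T \<Longrightarrow>
   corner_left sx dq = corner_left sy dr \<Longrightarrow>
   corner_left (opp sx) dp = corner_left sz (\<not> dr) \<Longrightarrow>
   corner_left (opp sy) (\<not> dp) = corner_left (opp sz) (\<not> dq) \<Longrightarrow>
   triangle T
     (ordered dp (Passage x sx kxp) (Passage y sy kyp))
     (ordered dq (Passage x (opp sx) kxq) (Passage z sz kzq))
     (ordered dr (Passage y (opp sy) kyr) (Passage z (opp sz) kzr))"

definition relabel :: "(nat \<Rightarrow> nat) \<Rightarrow> 'k code \<Rightarrow> 'k code" where
  "relabel f = map (\<lambda>p. Passage (f (crossing p)) (side p) (kind p))"

text \<open>
  The moves in one direction: change of base point and of names (no change of the diagram), first
  moves (classical, virtual or flat according to \<open>X\<close>), second moves for parallel and antiparallel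
  strands, and third moves for both cyclic orders of the three strands. By change of base point,
  one of the strands may be assumed to start the code. The pieces entering a third move are
  traversed in the same direction afterwards, but meet their two double points in reverse order.
\<close>

inductive move ::
  "('k \<times> 'k) set \<Rightarrow> (('k \<times> 'k) \<times> ('k \<times> 'k) \<times> ('k \<times> 'k)) set \<Rightarrow> 'k code \<Rightarrow> 'k code \<Rightarrow> bool"
  for X T where
  basepoint: "move X T w (rotate1 w)"
| names: "inj_on f (crossing ` set w) \<Longrightarrow> move X T w (relabel f w)"
| first: "(k, k') \<in> X \<Longrightarrow>
    move X T w (Passage a s k # Passage a (opp s) k' # w)"
| second_parallel: "(k, k') \<in> X \<Longrightarrow>
    move X T (u @ v)
      ([Passage a s k, Passage b (opp s) k] @ u @ [Passage a (opp s) k', Passage b s k'] @ v)"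
| second_antiparallel: "(k, k') \<in> X \<Longrightarrow>
    move X T (u @ v)
      ([Passage a s k, Passage b (opp s) k] @ u @ [Passage b s k', Passage a (opp s) k'] @ v)"
| third: "triangle T p q r \<Longrightarrow>
    move X T (p @ u @ q @ v @ r @ w) (rev p @ u @ rev q @ v @ rev r @ w)"
| third': "triangle T p q r \<Longrightarrow>
    move X T (p @ u @ r @ v @ q @ w) (rev p @ u @ rev r @ v @ rev q @ w)"

text \<open>
  Each step relates two diagrams. A bigon or triangle described above is a region of the diagram
  containing it, so such a step between spherical codes is an actual local move of diagrams.
\<close>

definition diagram_equiv ::
  "('k \<times> 'k) set \<Rightarrow> (('k \<times> 'k) \<times> ('k \<times> 'k) \<times> ('k \<times> 'k)) set \<Rightarrow> 'k code \<Rightarrow> 'k code \<Rightarrow> bool" where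
  "diagram_equiv X T = equivclp (\<lambda>D D'. diagram X D \<and> diagram X D' \<and> move X T D D')"


section \<open>Virtual knots and flat knots\<close>

datatype vkind = Over | Under | Virtual

definition virtual_pairs :: "(vkind \<times> vkind) set" where
  "virtual_pairs = {(Over, Under), (Under, Over), (Virtual, Virtual)}"

text \<open>
  RIII (\<open>p\<close> is the top strand, \<open>q\<close> the middle one, \<open>r\<close> the bottom one), VRIII, and SV (\<open>p\<close> is the
  strand with two consecutive virtual crossings).
\<close>

definition virtual_triples :: "((vkind \<times> vkind) \<times> (vkind \<times> vkind) \<times> (vkind \<times> vkind)) set" where
  "virtual_triples =
    {((Over, Under), (Over, Under), (Over, Under)),
     ((Virtual, Virtual), (Virtual, Virtual), (Virtual, Virtual)),
     ((Virtual, Virtual), (Virtual, Virtual), (Over, Under)),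
     ((Virtual, Virtual), (Virtual, Virtual), (Under, Over))}"

abbreviation virtual_diagram :: "vkind code \<Rightarrow> bool" where
  "virtual_diagram \<equiv> diagram virtual_pairs"

abbreviation virtual_equiv :: "vkind code \<Rightarrow> vkind code \<Rightarrow> bool" where
  "virtual_equiv \<equiv> diagram_equiv virtual_pairs virtual_triples"

definition virtual_knots :: "vkind code set set" where
  "virtual_knots = {D. virtual_diagram D} // {(D, D'). virtual_equiv D D'}"

datatype fkind = Flat | FlatVirtual

definition flat_pairs :: "(fkind \<times> fkind) set" where
  "flat_pairs = {(Flat, Flat), (FlatVirtual, FlatVirtual)}"

definition flat_triples :: "((fkind \<times> fkind) \<times> (fkind \<times> fkind) \<times> (fkind \<times> fkind)) set" where
  "flat_triples =
    {((Flat, Flat), (Flat, Flat), (Flat, Flat)),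
     ((FlatVirtual, FlatVirtual), (FlatVirtual, FlatVirtual), (FlatVirtual, FlatVirtual)),
     ((FlatVirtual, FlatVirtual), (FlatVirtual, FlatVirtual), (Flat, Flat))}"

abbreviation flat_equiv :: "fkind code \<Rightarrow> fkind code \<Rightarrow> bool" where
  "flat_equiv \<equiv> diagram_equiv flat_pairs flat_triples"

fun flat_kind :: "vkind \<Rightarrow> fkind" where
  "flat_kind Over = Flat"
| "flat_kind Under = Flat"
| "flat_kind Virtual = FlatVirtual"

definition flat :: "vkind code \<Rightarrow> fkind code" where
  "flat = map (map_passage flat_kind)"


section \<open>Signs, index and writhes\<close>

definition classical :: "vkind code \<Rightarrow> nat set" where
  "classical D = crossing ` {p \<in> set D. kind p \<noteq> Virtual}"

definition sgn_crossing :: "vkind code \<Rightarrow> nat \<Rightarrow> int" where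
  "sgn_crossing D c = (if Passage c FromLeft Over \<in> set D then 1 else - 1)"

text \<open>\<open>lam D\<close> is the label of the arc containing the base point of \<open>D\<close>.\<close>

definition first_over :: "vkind code \<Rightarrow> nat set" where
  "first_over D =
    {c. \<exists>i < length D. crossing (D ! i) = c \<and> kind (D ! i) = Over \<and>
          (\<forall>j < i. crossing (D ! j) \<noteq> c)}"

definition lam :: "vkind code \<Rightarrow> int" where
  "lam D = (\<Sum>c \<in> first_over D. sgn_crossing D c)"

definition passage_pos :: "vkind code \<Rightarrow> nat \<Rightarrow> side \<Rightarrow> nat" where
  "passage_pos D c s = (THE i. i < length D \<and> crossing (D ! i) = c \<and> side (D ! i) = s)"

text \<open>The label of the arc that arrives at \<open>c\<close> from side \<open>s\<close>.\<close>

definition incoming_label :: "vkind code \<Rightarrow> nat \<Rightarrow> side \<Rightarrow> int" where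
  "incoming_label D c s = lam (rotate (passage_pos D c s) D)"

definition Ind :: "vkind code \<Rightarrow> nat \<Rightarrow> int" where
  "Ind D c = sgn_crossing D c * (incoming_label D c FromLeft - incoming_label D c FromRight - 1)"

definition writhe :: "int \<Rightarrow> vkind code \<Rightarrow> int" where
  "writhe n D =
     int (card {c \<in> classical D. sgn_crossing D c = 1 \<and> Ind D c = n}) -
     int (card {c \<in> classical D. sgn_crossing D c = - 1 \<and> Ind D c = n})"

definition dwrithe :: "int \<Rightarrow> vkind code \<Rightarrow> int" where
  "dwrithe n D = writhe n D - writhe (- n) D"


section \<open>Smoothing against orientation\<close>

text \<open>
  Starting at the overpassage of \<open>c\<close>, the code reads \<open>over # A @ under # B\<close>. The smoothed curve
  runs through \<open>A\<close>, then backwards through \<open>B\<close>. At a double point where exactly one of the two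
  strands gets reversed, the roles of the left and the right incoming strand are exchanged; if
  both strands are reversed, they are kept.
\<close>

definition over_pos :: "vkind code \<Rightarrow> nat \<Rightarrow> nat" where
  "over_pos D c = (THE i. i < length D \<and> crossing (D ! i) = c \<and> kind (D ! i) = Over)"

definition smooth :: "vkind code \<Rightarrow> nat \<Rightarrow> vkind code" where
  "smooth D c =
    (let w = tl (rotate (over_pos D c) D);
         A = takeWhile (\<lambda>p. crossing p \<noteq> c) w;
         B = tl (dropWhile (\<lambda>p. crossing p \<noteq> c) w);
         mixed = crossing ` set A \<inter> crossing ` set B
     in map (\<lambda>p. if crossing p \<in> mixed then Passage (crossing p) (opp (side p)) (kind p) else p)
          (A @ rev B))"

definition totally_flat_trivial_diagram :: "vkind code \<Rightarrow> bool" where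
  "totally_flat_trivial_diagram D \<longleftrightarrow>
     flat_equiv (flat D) [] \<and> (\<forall>c \<in> classical D. flat_equiv (flat (smooth D c)) [])"

definition totally_flat_trivial :: "vkind code set \<Rightarrow> bool" where
  "totally_flat_trivial K \<longleftrightarrow> (\<exists>D \<in> K. totally_flat_trivial_diagram D)"


section \<open>Polynomials\<close>

text \<open>
  Laurent polynomials with integer coefficients are finitely supported functions on the exponents:
  \<open>Poly_Mapping.single i a\<close> is \<open>a t\<^sup>i\<close>, and \<open>Poly_Mapping.single (i, j) a\<close> is \<open>a t\<^sup>i \<ell>\<^sup>j\<close>.
\<close>

type_synonym laurent1 = "int \<Rightarrow>\<^sub>0 int"
type_synonym laurent2 = "int \<times> int \<Rightarrow>\<^sub>0 int"

text \<open>The inclusion of the Laurent polynomials in \<open>t\<close> into those in \<open>t\<close> and \<open>\<ell>\<close>.\<close>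

definition embed :: "laurent1 \<Rightarrow> laurent2" where
  "embed p = (\<Sum>i \<in> Poly_Mapping.keys p. Poly_Mapping.single (i, 0) (Poly_Mapping.lookup p i))"

definition palindromic :: "laurent1 \<Rightarrow> bool" where
  "palindromic p \<longleftrightarrow> (\<forall>n. Poly_Mapping.lookup p n = Poly_Mapping.lookup p (- n))"

definition affine_index_poly :: "vkind code \<Rightarrow> laurent1" where
  "affine_index_poly D =
    (\<Sum>c \<in> classical D.
       Poly_Mapping.single (Ind D c) (sgn_crossing D c) - Poly_Mapping.single 0 (sgn_crossing D c))"

definition L_poly :: "int \<Rightarrow> vkind code \<Rightarrow> laurent2" where
  "L_poly n D =
    (\<Sum>c \<in> classical D.
       Poly_Mapping.single (Ind D c, \<bar>dwrithe n (smooth D c)\<bar>) (sgn_crossing D c)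
       - Poly_Mapping.single (0, \<bar>dwrithe n D\<bar>) (sgn_crossing D c))"

definition T_set :: "int \<Rightarrow> vkind code \<Rightarrow> nat set" where
  "T_set n D = {c \<in> classical D. \<bar>dwrithe n (smooth D c)\<bar> = \<bar>dwrithe n D\<bar>}"

definition F_poly :: "int \<Rightarrow> vkind code \<Rightarrow> laurent2" where
  "F_poly n D =
    (\<Sum>c \<in> classical D.
       Poly_Mapping.single (Ind D c, dwrithe n (smooth D c)) (sgn_crossing D c))
    - (\<Sum>c \<in> T_set n D. Poly_Mapping.single (0, dwrithe n (smooth D c)) (sgn_crossing D c))
    - (\<Sum>c \<in> classical D - T_set n D. Poly_Mapping.single (0, dwrithe n D) (sgn_crossing D c))"

end

theory Submission
  imports Defs
begin

text \<open>
  Forgetting the virtual crossings, a diagram is a cyclic word in the two ends of each crossing, and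
  an end has weight \<open>- 1\<close> or \<open>1\<close> according to its side. The labels of the arcs are partial sums of the
  weights, so \<open>2 * Ind c\<close> is, up to the sign of \<open>c\<close>, the difference of the symmetrised partial sums
  (\<open>height\<close>) at the two ends of \<open>c\<close>. Consequently \<open>2 * \<nabla>J\<^sub>n\<close> is the sum over the ends of the weight times
  an odd function of this difference. It depends on the weights and on the kernel \<open>sgn (pos x - pos y)\<close>
  only, and this kernel matters only up to terms \<open>\<alpha> y - \<alpha> x\<close>, because the weights add up to zero: this
  makes the choice of a base point irrelevant. Smoothing against the orientation multiplies kernel and
  weights by signs, so the effect of a move on \<open>\<nabla>J\<^sub>n (D\<^sub>c)\<close> is computed in the same way as its
  effect on \<open>\<nabla>J\<^sub>n (D)\<close>.

  All \<open>\<nabla>J\<^sub>n\<close> vanish for a totally flat-trivial diagram and its smoothings. Hence \<open>\<nabla>J\<^sub>n\<close> vanishes on the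
  whole virtual knot, which gives palindromicity. If \<open>g i 0 = 0\<close> for all \<open>i\<close>, then the sum of
  \<open>sgn c * g (Ind c) (\<nabla>J\<^sub>n (D\<^sub>c))\<close> is invariant under the moves of diagrams with \<open>\<nabla>J\<^sub>n = 0\<close>, so it
  vanishes. The coefficients of \<open>L\<^sup>n - P\<close> and \<open>F\<^sup>n - P\<close> are sums of this form.
\<close>


section \<open>Signed chord diagrams\<close>

text \<open>The obstacle is the smoothing. When \<open>c\<close> is a corner of a bigon or triangle,
  the effect of the move on \<open>D_c\<close> depends on how the strands are distributed over the
  two arcs between the passages of \<open>c\<close>. Kernels reduce this to two cases. Strands on
  different arcs leave a kink or a bigon in the smoothed words, which can be deleted from each of
  them. Strands on one arc leave the same cyclic word with other names. Symmetrised kernels take the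
  values \<open>1\<close> and \<open>- 1\<close>, so that a change of base point and a reversal act
  by multiplication with signs. The price is the factor 2, and a shift by 2 whenever a letter
  crosses the base point; all constants \<open>- 2\<close> and \<open>2\<close> below are such
  shifts. The condition \<open>g i 0 = 0\<close> answers the first move. A new kink has index zero,
  and smoothing there gives back the old curve, possibly reversed, whose n-dwrithe is still zero;
  the new term is therefore a multiple of \<open>g 0 0\<close>. Subtracting the coefficient of
  \<open>P\<close> from that of \<open>L\<close> or \<open>F\<close> produces such a
  \<open>g\<close>.\<close>

type_synonym strand_end = "nat \<times> side"

definition mate :: "strand_end \<Rightarrow> strand_end" where
  "mate x = (fst x, opp (snd x))"

lemma opp_opp [simp]: "opp (opp s) = s"
  by (cases s) auto

lemma opp_neq [simp]: "opp s \<noteq> s" "s \<noteq> opp s"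
  by (cases s; simp)+

lemma side_neq_iff: "s \<noteq> t \<longleftrightarrow> s = opp t"
  by (cases s; cases t) auto

lemma mate_mate [simp]: "mate (mate x) = x"
  by (simp add: mate_def)

lemma mate_neq [simp]: "mate x \<noteq> x" "x \<noteq> mate x"
  by (auto simp: mate_def prod_eq_iff)

lemma mate_eq_iff [simp]: "mate x = mate y \<longleftrightarrow> x = y"
  by (metis mate_mate)

lemma mate_eq_commute: "mate x = y \<longleftrightarrow> x = mate y"
  by auto

lemma mate_Pair [simp]: "mate (c, s) = (c, opp s)"
  by (simp add: mate_def)

lemma fst_mate [simp]: "fst (mate x) = fst x"
  by (simp add: mate_def)

lemma fst_eq_iff_mate: "fst x = fst y \<longleftrightarrow> x = y \<or> x = mate y"
  by (cases x; cases y) (auto simp: side_neq_iff)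

text \<open>
  In a cyclic word cut open at a base point, \<open>\<kappa> y x\<close> is \<open>1\<close> if \<open>y\<close> precedes \<open>x\<close> and \<open>- 1\<close> if \<open>x\<close> precedes \<open>y\<close>.
  As the weights \<open>e\<close> add up to zero, \<open>height\<close> is then twice the sum of the weights before \<open>x\<close>, plus \<open>e x\<close>.
\<close>

definition height :: "strand_end set \<Rightarrow> (strand_end \<Rightarrow> strand_end \<Rightarrow> int) \<Rightarrow> (strand_end \<Rightarrow> int)
    \<Rightarrow> strand_end \<Rightarrow> int" where
  "height P \<kappa> e x = (\<Sum>y\<in>P. \<kappa> y x * e y)"

definition gap :: "strand_end set \<Rightarrow> (strand_end \<Rightarrow> strand_end \<Rightarrow> int) \<Rightarrow> (strand_end \<Rightarrow> int)
    \<Rightarrow> strand_end \<Rightarrow> int" where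
  "gap P \<kappa> e x = height P \<kappa> e (mate x) - height P \<kappa> e x"

text \<open>For odd \<open>f\<close> an end and its mate contribute equally, so this is twice a sum
  over crossings; \<open>f = count_diff n\<close> will give twice the n-dwrithe.\<close>

definition gap_sum :: "(int \<Rightarrow> int) \<Rightarrow> strand_end set \<Rightarrow> (strand_end \<Rightarrow> strand_end \<Rightarrow> int)
    \<Rightarrow> (strand_end \<Rightarrow> int) \<Rightarrow> int" where
  "gap_sum f P \<kappa> e = (\<Sum>x\<in>P. e x * f (gap P \<kappa> e x))"

definition paired :: "strand_end set \<Rightarrow> bool" where
  "paired P \<longleftrightarrow> finite P \<and> (\<forall>x\<in>P. mate x \<in> P)"

definition alternating :: "(strand_end \<Rightarrow> int) \<Rightarrow> bool" where
  "alternating e \<longleftrightarrow> (\<forall>x. e (mate x) = - e x)"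

definition skew :: "(strand_end \<Rightarrow> strand_end \<Rightarrow> int) \<Rightarrow> bool" where
  "skew \<kappa> \<longleftrightarrow> (\<forall>x y. \<kappa> y x = - \<kappa> x y)"

lemma skewD: "skew \<kappa> \<Longrightarrow> \<kappa> y x = - \<kappa> x y"
  unfolding skew_def by blast

lemma skew_diag [simp]: "skew \<kappa> \<Longrightarrow> \<kappa> x x = 0"
  using skewD[of \<kappa> x x] by simp

lemma alternatingD: "alternating e \<Longrightarrow> e (mate x) = - e x"
  unfolding alternating_def by blast

lemma paired_finite: "paired P \<Longrightarrow> finite P"
  by (simp add: paired_def)

lemma paired_mate: "paired P \<Longrightarrow> mate x \<in> P \<longleftrightarrow> x \<in> P"
  by (metis mate_mate paired_def)

lemma bij_betw_mate: "paired P \<Longrightarrow> bij_betw mate P P"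
  by (rule bij_betwI[where g = mate]) (auto simp: paired_mate)

lemma sum_alternating:
  assumes "paired P" "alternating e"
  shows "(\<Sum>x\<in>P. e x) = 0"
proof -
  have "(\<Sum>x\<in>P. e x) = (\<Sum>x\<in>P. e (mate x))"
    using sum.reindex_bij_betw[OF bij_betw_mate[OF assms(1)], of e] by simp
  also have "\<dots> = - (\<Sum>x\<in>P. e x)"
    by (simp add: alternatingD[OF assms(2)] sum_negf)
  finally show ?thesis by simp
qed

section \<open>Gaps under renaming, kinks, bigons and flips\<close>

lemma gap_mate: "gap P \<kappa> e (mate x) = - gap P \<kappa> e x"
  by (simp add: gap_def)

lemma gap_cong:
  assumes "paired P" "x \<in> P" "\<And>y z. y \<in> P \<Longrightarrow> z \<in> P \<Longrightarrow> \<kappa>' y z = \<kappa> y z"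
    "\<And>y. y \<in> P \<Longrightarrow> e' y = e y"
  shows "gap P \<kappa>' e' x = gap P \<kappa> e x"
  using assms by (simp add: gap_def height_def paired_mate)

lemma gap_sum_cong:
  assumes "paired P" "\<And>y z. y \<in> P \<Longrightarrow> z \<in> P \<Longrightarrow> \<kappa>' y z = \<kappa> y z"
    "\<And>y. y \<in> P \<Longrightarrow> e' y = e y"
  shows "gap_sum f P \<kappa>' e' = gap_sum f P \<kappa> e"
  unfolding gap_sum_def using assms by (intro sum.cong) (auto simp: gap_cong[OF assms(1) _ assms(2,3)])

text \<open>The term \<open>\<alpha> y\<close> adds one constant to all heights, and
  \<open>\<alpha> x\<close> is multiplied by the total weight, which is zero. The constant drops out
  of the difference of two heights.\<close>

lemma gap_rename:
  assumes P: "paired P" and e: "alternating e" and inj: "inj_on \<pi> P"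
    and mate: "\<And>x. x \<in> P \<Longrightarrow> \<pi> (mate x) = mate (\<pi> x)"
    and e': "\<And>x. x \<in> P \<Longrightarrow> e' (\<pi> x) = e x"
    and \<kappa>': "\<And>x y. x \<in> P \<Longrightarrow> y \<in> P \<Longrightarrow> \<kappa>' (\<pi> y) (\<pi> x) = \<kappa> y x + \<alpha> y - \<alpha> x"
    and x: "x \<in> P"
  shows "gap (\<pi> ` P) \<kappa>' e' (\<pi> x) = gap P \<kappa> e x"
proof -
  have h: "height (\<pi> ` P) \<kappa>' e' (\<pi> z) = height P \<kappa> e z + (\<Sum>y\<in>P. \<alpha> y * e y)" if "z \<in> P" for z
  proof -
    have "height (\<pi> ` P) \<kappa>' e' (\<pi> z) = (\<Sum>y\<in>P. \<kappa>' (\<pi> y) (\<pi> z) * e' (\<pi> y))"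
      unfolding height_def using inj by (simp add: sum.reindex)
    also have "\<dots> = (\<Sum>y\<in>P. \<kappa> y z * e y + \<alpha> y * e y - \<alpha> z * e y)"
      using that by (intro sum.cong) (auto simp: e' \<kappa>' algebra_simps)
    also have "\<dots> = height P \<kappa> e z + (\<Sum>y\<in>P. \<alpha> y * e y) - \<alpha> z * (\<Sum>y\<in>P. e y)"
      by (simp add: height_def sum.distrib sum_subtractf sum_distrib_left)
    finally show ?thesis using sum_alternating[OF P e] by simp
  qed
  have "mate x \<in> P" using x P by (simp add: paired_mate)
  then show ?thesis using h[OF x] h[of "mate x"] mate[OF x] by (simp add: gap_def)
qed

lemma gap_sum_rename:
  assumes P: "paired P" and e: "alternating e" and inj: "inj_on \<pi> P" and P': "P' = \<pi> ` P"
    and mate: "\<And>x. x \<in> P \<Longrightarrow> \<pi> (mate x) = mate (\<pi> x)"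
    and e': "\<And>x. x \<in> P \<Longrightarrow> e' (\<pi> x) = e x"
    and \<kappa>': "\<And>x y. x \<in> P \<Longrightarrow> y \<in> P \<Longrightarrow> \<kappa>' (\<pi> y) (\<pi> x) = \<kappa> y x + \<alpha> y - \<alpha> x"
  shows "gap_sum f P' \<kappa>' e' = gap_sum f P \<kappa> e"
proof -
  have "gap (\<pi> ` P) \<kappa>' e' (\<pi> x) = gap P \<kappa> e x" if "x \<in> P" for x
    by (rule gap_rename[where \<alpha> = \<alpha>]) (use that assms in auto)
  then show ?thesis unfolding P' gap_sum_def using inj by (simp add: sum.reindex e')
qed

text \<open>A negated kernel is the word read backwards. Smoothing at a kink may return the rest of
  the word in this form.\<close>

lemma gap_sum_uminus:
  assumes odd: "\<And>m. f (- m) = - f m"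
  shows "gap_sum f P (\<lambda>y x. - \<kappa> y x) e = - gap_sum f P \<kappa> e"
proof -
  have "gap P (\<lambda>y x. - \<kappa> y x) e x = - gap P \<kappa> e x" for x
    by (simp add: gap_def height_def sum_negf)
  then show ?thesis by (simp add: gap_sum_def odd sum_negf)
qed

lemma paired_Diff: "paired P \<Longrightarrow> paired (P - {o', mate o'})"
  by (auto simp: paired_def mate_eq_commute)

text \<open>The pair adds the same constant \<open>- k * e a\<close> to the height of every other
  end, so the other gaps stay. Its own two heights coincide, and \<open>f 0 = 0\<close>. The shift
  \<open>k\<close> is \<open>0\<close> if the two ends are consecutive, and \<open>- 2\<close> if
  \<open>a\<close> opens the word and \<open>mate a\<close> closes it, so that they are neighbours
  only cyclically.\<close>

lemma gap_sum_kink: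
  assumes P: "paired P" and e: "alternating e" and \<kappa>: "skew \<kappa>" and odd: "\<And>m. f (- m) = - f m"
    and a: "a \<in> P"
    and twin: "\<And>y. y \<in> P \<Longrightarrow> y \<noteq> a \<Longrightarrow> y \<noteq> mate a \<Longrightarrow> \<kappa> y a = \<kappa> y (mate a) + k"
  shows "gap_sum f P \<kappa> e = gap_sum f (P - {a, mate a}) \<kappa> e"
    and "x \<in> P - {a, mate a} \<Longrightarrow> gap P \<kappa> e x = gap (P - {a, mate a}) \<kappa> e x"
proof -
  define P0 where "P0 = P - {a, mate a}"
  have P0: "paired P0" unfolding P0_def by (rule paired_Diff[OF P])
  have a': "mate a \<in> P" using a P by (simp add: paired_mate)
  have P_eq: "P = insert a (insert (mate a) P0)" using a a' by (auto simp: P0_def)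
  have fin: "finite P0" and nin: "a \<notin> P0" "mate a \<notin> P0"
    using P0 by (auto simp: P0_def paired_def)
  have hP: "height P \<kappa> e x = height P0 \<kappa> e x + (\<kappa> a x - \<kappa> (mate a) x) * e a" for x
    unfolding height_def P_eq using fin nin alternatingD[OF e, of a]
    by (simp add: algebra_simps)
  have h: "height P \<kappa> e x = height P0 \<kappa> e x - k * e a" if "x \<in> P0" for x
  proof -
    have "\<kappa> a x - \<kappa> (mate a) x = - k"
      using twin[of x] that skewD[OF \<kappa>, of a x] skewD[OF \<kappa>, of "mate a" x] by (auto simp: P0_def)
    then show ?thesis by (simp add: hP)
  qed
  show g: "gap P \<kappa> e x = gap (P - {a, mate a}) \<kappa> e x" if "x \<in> P - {a, mate a}" for x
    using that h[of x] h[of "mate x"] P0 unfolding P0_def[symmetric]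
    by (simp add: gap_def paired_mate)
  have "height P0 \<kappa> e a = (\<Sum>y\<in>P0. \<kappa> y (mate a) * e y + k * e y)"
    unfolding height_def by (intro sum.cong) (auto simp: P0_def twin algebra_simps)
  then have "height P0 \<kappa> e a = height P0 \<kappa> e (mate a)"
    using sum_alternating[OF P0 e]
    by (simp add: height_def sum.distrib sum_distrib_left[symmetric])
  then have "gap P \<kappa> e a = 0"
    using skewD[OF \<kappa>, of a "mate a"] \<kappa> by (simp add: gap_def hP)
  moreover have "f 0 = 0" using odd[of 0] by simp
  ultimately show "gap_sum f P \<kappa> e = gap_sum f (P - {a, mate a}) \<kappa> e"
    using fin nin g gap_mate[of P \<kappa> e a] unfolding gap_sum_def P0_def[symmetric]
    by (subst P_eq) (auto intro!: sum.cong simp: P0_def)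
qed

text \<open>Since twins have opposite weights, each twin pair adds a constant to all other heights.
  The twins \<open>a\<close> and \<open>b\<close> have equal gaps, and their opposite weights make
  the two crossings cancel.\<close>

lemma gap_sum_bigon:
  assumes P: "paired P" and e: "alternating e" and \<kappa>: "skew \<kappa>" and odd: "\<And>m. f (- m) = - f m"
    and a: "a \<in> P" and b: "b \<in> P" "b \<noteq> a" "b \<noteq> mate a" and ab: "e b = - e a"
    and twin: "\<And>y. y \<in> P \<Longrightarrow> y \<noteq> a \<Longrightarrow> y \<noteq> b \<Longrightarrow> \<kappa> y a = \<kappa> y b + k"
    and twin': "\<And>y. y \<in> P \<Longrightarrow> y \<noteq> mate a \<Longrightarrow> y \<noteq> mate b \<Longrightarrow> \<kappa> y (mate a) = \<kappa> y (mate b) + k'"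
  shows "gap_sum f P \<kappa> e = gap_sum f (P - {a, mate a} - {b, mate b}) \<kappa> e"
    and "x \<in> P - {a, mate a} - {b, mate b} \<Longrightarrow>
      gap P \<kappa> e x = gap (P - {a, mate a} - {b, mate b}) \<kappa> e x"
    and "gap P \<kappa> e a = gap P \<kappa> e b"
proof -
  define P0 where "P0 = P - {a, mate a} - {b, mate b}"
  have P0: "paired P0" unfolding P0_def by (intro paired_Diff P)
  have a': "mate a \<in> P" and b': "mate b \<in> P" using a b P by (simp_all add: paired_mate)
  have P_eq: "P = insert a (insert (mate a) (insert b (insert (mate b) P0)))"
    using a a' b b' by (auto simp: P0_def)
  have fin: "finite P0" and nin: "a \<notin> P0" "mate a \<notin> P0" "b \<notin> P0" "mate b \<notin> P0"
    using P0 by (auto simp: P0_def paired_def)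
  have ne: "a \<noteq> b" "mate a \<noteq> b" "a \<noteq> mate b" "mate a \<noteq> mate b"
    using b by (auto simp: mate_eq_commute)
  have ea: "e (mate a) = - e a" "e (mate b) = e a" using alternatingD[OF e] ab by simp_all
  have hP: "height P \<kappa> e x = height P0 \<kappa> e x + (\<kappa> a x - \<kappa> b x) * e a
      - (\<kappa> (mate a) x - \<kappa> (mate b) x) * e a" for x
    unfolding height_def P_eq using fin nin ne ea ab by (simp add: algebra_simps)
  have h: "height P \<kappa> e x = height P0 \<kappa> e x - k * e a + k' * e a" if "x \<in> P0" for x
  proof -
    have "\<kappa> a x - \<kappa> b x = - k"
      using twin[of x] that skewD[OF \<kappa>, of a x] skewD[OF \<kappa>, of b x] by (auto simp: P0_def)
    moreover have "\<kappa> (mate a) x - \<kappa> (mate b) x = - k'"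
      using twin'[of x] that skewD[OF \<kappa>, of "mate a" x] skewD[OF \<kappa>, of "mate b" x]
      by (auto simp: P0_def)
    ultimately show ?thesis by (simp add: hP)
  qed
  show g: "gap P \<kappa> e x = gap (P - {a, mate a} - {b, mate b}) \<kappa> e x"
    if "x \<in> P - {a, mate a} - {b, mate b}" for x
    using that h[of x] h[of "mate x"] P0 unfolding P0_def[symmetric]
    by (simp add: gap_def paired_mate)
  have s0: "(\<Sum>y\<in>P0. e y) = 0" by (rule sum_alternating[OF P0 e])
  have "height P0 \<kappa> e a = (\<Sum>y\<in>P0. \<kappa> y b * e y + k * e y)"
    unfolding height_def by (intro sum.cong) (auto simp: P0_def twin algebra_simps)
  then have 1: "height P0 \<kappa> e a = height P0 \<kappa> e b"
    using s0 by (simp add: height_def sum.distrib sum_distrib_left[symmetric])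
  have "height P0 \<kappa> e (mate a) = (\<Sum>y\<in>P0. \<kappa> y (mate b) * e y + k' * e y)"
    unfolding height_def by (intro sum.cong) (auto simp: P0_def twin' algebra_simps)
  then have 2: "height P0 \<kappa> e (mate a) = height P0 \<kappa> e (mate b)"
    using s0 by (simp add: height_def sum.distrib sum_distrib_left[symmetric])
  have t: "\<kappa> (mate a) a = \<kappa> (mate a) b + k" "\<kappa> (mate b) a = \<kappa> (mate b) b + k"
      "\<kappa> a (mate a) = \<kappa> a (mate b) + k'" "\<kappa> b (mate a) = \<kappa> b (mate b) + k'"
    using twin[of "mate a"] twin[of "mate b"] twin'[of a] twin'[of b] a a' b b' ne
    by auto
  have z: "\<kappa> a a = 0" "\<kappa> b b = 0" "\<kappa> (mate a) (mate a) = 0" "\<kappa> (mate b) (mate b) = 0"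
    using \<kappa> by simp_all
  \<comment> \<open>The mutual terms of \<open>a\<close> and \<open>b\<close> agree by skewness; in
    the difference between \<open>mate a\<close> and \<open>mate b\<close> the shift
    \<open>k\<close> cancels.\<close>
  have "(\<kappa> a a - \<kappa> b a) * e a - (\<kappa> (mate a) a - \<kappa> (mate b) a) * e a =
      (\<kappa> a b - \<kappa> b b) * e a - (\<kappa> (mate a) b - \<kappa> (mate b) b) * e a"
    using t z skewD[OF \<kappa>, of a b] by (simp add: algebra_simps)
  then have 3: "height P \<kappa> e a = height P \<kappa> e b" using 1 by (simp add: hP)
  have "(\<kappa> a (mate a) - \<kappa> b (mate a)) * e a - (\<kappa> (mate a) (mate a) - \<kappa> (mate b) (mate a)) * e a =
      (\<kappa> a (mate b) - \<kappa> b (mate b)) * e a - (\<kappa> (mate a) (mate b) - \<kappa> (mate b) (mate b)) * e a"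
    using t z skewD[OF \<kappa>, of "mate a" "mate b"] by (simp add: algebra_simps)
  then have 4: "height P \<kappa> e (mate a) = height P \<kappa> e (mate b)" using 2 by (simp add: hP)
  show gab: "gap P \<kappa> e a = gap P \<kappa> e b" using 3 4 by (simp add: gap_def)
  have "gap_sum f P \<kappa> e = e a * f (gap P \<kappa> e a) + e (mate a) * f (gap P \<kappa> e (mate a))
      + e b * f (gap P \<kappa> e b) + e (mate b) * f (gap P \<kappa> e (mate b)) + (\<Sum>x\<in>P0. e x * f (gap P \<kappa> e x))"
  proof -
    have "(\<Sum>x\<in>P. F x) = F a + F (mate a) + F b + F (mate b) + (\<Sum>x\<in>P0. F x)" for F :: "_ \<Rightarrow> int"
      unfolding P_eq using fin nin ne by simp
    then show ?thesis unfolding gap_sum_def by blast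
  qed
  also have "\<dots> = (\<Sum>x\<in>P0. e x * f (gap P \<kappa> e x))"
    by (simp add: gap_mate odd gab ea ab)
  also have "\<dots> = gap_sum f P0 \<kappa> e"
    unfolding gap_sum_def using g by (intro sum.cong) (auto simp: P0_def)
  finally show "gap_sum f P \<kappa> e = gap_sum f (P - {a, mate a} - {b, mate b}) \<kappa> e"
    by (simp add: P0_def)
qed

text \<open>Reversing the order of \<open>x\<close> and \<open>\<mu> x\<close> alters the height at
  \<open>x\<close> by minus twice the term of \<open>\<mu> x\<close>. By \<open>balance\<close> the
  height at \<open>mate x\<close> is altered by the same amount.\<close>

lemma gap_flip:
  assumes P: "paired P" and \<kappa>: "skew \<kappa>"
    and \<mu>: "\<And>x. x \<in> T \<Longrightarrow> \<mu> x \<in> P" "\<And>x. x \<in> T \<Longrightarrow> mate x \<in> T"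
    and balance: "\<And>x. x \<in> T \<Longrightarrow>
      \<kappa> (\<mu> x) x * e (\<mu> x) = \<kappa> (\<mu> (mate x)) (mate x) * e (\<mu> (mate x))"
    and \<kappa>': "\<And>x y. x \<in> P \<Longrightarrow> y \<in> P \<Longrightarrow> \<kappa>' y x = (if x \<in> T \<and> y = \<mu> x then - \<kappa> y x else \<kappa> y x)"
    and x: "x \<in> P"
  shows "gap P \<kappa>' e x = gap P \<kappa> e x"
proof -
  have h: "height P \<kappa>' e z = height P \<kappa> e z - (if z \<in> T then 2 * \<kappa> (\<mu> z) z * e (\<mu> z) else 0)"
    if "z \<in> P" for z
  proof (cases "z \<in> T")
    case True
    have "height P \<kappa>' e z = (\<Sum>y\<in>P. \<kappa> y z * e y - (if y = \<mu> z then 2 * \<kappa> y z * e y else 0))"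
      unfolding height_def using that True by (intro sum.cong) (auto simp: \<kappa>')
    also have "\<dots> = height P \<kappa> e z - 2 * \<kappa> (\<mu> z) z * e (\<mu> z)"
      using \<mu>(1)[OF True] P by (simp add: height_def sum_subtractf paired_finite)
    finally show ?thesis using True by simp
  next
    case False
    then show ?thesis unfolding height_def using that by (auto intro!: sum.cong simp: \<kappa>')
  qed
  have "mate x \<in> T \<longleftrightarrow> x \<in> T" using \<mu>(2) mate_mate by metis
  then show ?thesis
    using h[OF x] h[of "mate x"] balance[of x] x P by (auto simp: gap_def paired_mate)
qed


section \<open>The kernel of a smoothing\<close>

text \<open>The values off the diagonal are signs, as for a linear order, so that the factors
  multiplied in by a smoothing square to 1.\<close>

definition order_kernel :: "strand_end set \<Rightarrow> (strand_end \<Rightarrow> strand_end \<Rightarrow> int) \<Rightarrow> bool" where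
  "order_kernel P \<kappa> \<longleftrightarrow> skew \<kappa> \<and> (\<forall>x\<in>P. \<forall>y\<in>P. x \<noteq> y \<longrightarrow> \<kappa> y x = 1 \<or> \<kappa> y x = - 1)"

lemma order_kernel_skew: "order_kernel P \<kappa> \<Longrightarrow> skew \<kappa>"
  by (simp add: order_kernel_def)

lemma order_kernel_cases:
  "order_kernel P \<kappa> \<Longrightarrow> x \<in> P \<Longrightarrow> y \<in> P \<Longrightarrow> x \<noteq> y \<Longrightarrow> \<kappa> y x = 1 \<or> \<kappa> y x = - 1"
  by (simp add: order_kernel_def)

text \<open>
  Smoothing at the crossing whose over end is \<open>b\<close>: if the word, read from \<open>b\<close> on, is
  \<open>b # A @ mate b # B\<close>, then \<open>from_base\<close> moves the base point to \<open>b\<close>, \<open>arc_sign\<close> is \<open>1\<close> on \<open>A\<close> and \<open>- 1\<close> on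
  \<open>B\<close>, and \<open>smooth_kernel\<close> is the kernel of \<open>A @ rev B\<close>. The ends keep their names: the exchange of sides at
  crossings between \<open>A\<close> and \<open>B\<close> is moved into \<open>smooth_weight\<close>.
\<close>

definition from_base :: "(strand_end \<Rightarrow> strand_end \<Rightarrow> int) \<Rightarrow> strand_end \<Rightarrow> strand_end \<Rightarrow> int" where
  "from_base \<kappa> b y = (if y = b then 1 else \<kappa> b y)"

definition arc_sign :: "(strand_end \<Rightarrow> strand_end \<Rightarrow> int) \<Rightarrow> strand_end \<Rightarrow> strand_end \<Rightarrow> int" where
  "arc_sign \<kappa> b y = \<kappa> y (mate b) * from_base \<kappa> b y * from_base \<kappa> b (mate b)"

definition smooth_kernel :: "(strand_end \<Rightarrow> strand_end \<Rightarrow> int) \<Rightarrow> strand_end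
    \<Rightarrow> strand_end \<Rightarrow> strand_end \<Rightarrow> int" where
  "smooth_kernel \<kappa> b y x = \<kappa> y x * from_base \<kappa> b y * from_base \<kappa> b x *
     (if arc_sign \<kappa> b y = - 1 \<and> arc_sign \<kappa> b x = - 1 then - 1 else 1)"

definition smooth_weight :: "(strand_end \<Rightarrow> strand_end \<Rightarrow> int) \<Rightarrow> strand_end \<Rightarrow> (strand_end \<Rightarrow> int)
    \<Rightarrow> strand_end \<Rightarrow> int" where
  "smooth_weight \<kappa> b e y = e y * arc_sign \<kappa> b y * arc_sign \<kappa> b (mate y)"

definition smooth_sum :: "(int \<Rightarrow> int) \<Rightarrow> strand_end set \<Rightarrow> (strand_end \<Rightarrow> strand_end \<Rightarrow> int)
    \<Rightarrow> (strand_end \<Rightarrow> int) \<Rightarrow> strand_end \<Rightarrow> int" where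
  "smooth_sum f P \<kappa> e b = gap_sum f (P - {b, mate b}) (smooth_kernel \<kappa> b) (smooth_weight \<kappa> b e)"

lemma skew_smooth_kernel: "skew \<kappa> \<Longrightarrow> skew (smooth_kernel \<kappa> b)"
proof -
  assume "skew \<kappa>"
  then have "smooth_kernel \<kappa> b y x = - smooth_kernel \<kappa> b x y" for x y
    using skewD[of \<kappa> y x] by (simp add: smooth_kernel_def)
  then show ?thesis unfolding skew_def by blast
qed

lemma alternating_smooth_weight: "alternating e \<Longrightarrow> alternating (smooth_weight \<kappa> b e)"
proof -
  assume "alternating e"
  then have "smooth_weight \<kappa> b e (mate x) = - smooth_weight \<kappa> b e x" for x
    using alternatingD[of e x] by (simp add: smooth_weight_def)
  then show ?thesis unfolding alternating_def by blast
qed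

lemma smooth_sum_cong:
  assumes P: "paired P" and b: "b \<in> P"
    and \<kappa>: "\<And>y z. y \<in> P \<Longrightarrow> z \<in> P \<Longrightarrow> \<kappa>' y z = \<kappa> y z" and e: "\<And>y. y \<in> P \<Longrightarrow> e' y = e y"
  shows "smooth_sum f P \<kappa>' e' b = smooth_sum f P \<kappa> e b"
proof -
  have b': "mate b \<in> P" using P b by (simp add: paired_mate)
  have t: "from_base \<kappa>' b y = from_base \<kappa> b y" if "y \<in> P" for y
    using that b \<kappa> by (simp add: from_base_def)
  have a: "arc_sign \<kappa>' b y = arc_sign \<kappa> b y" if "y \<in> P" for y
    using that b' \<kappa> t by (simp add: arc_sign_def)
  show ?thesis unfolding smooth_sum_def
    by (rule gap_sum_cong[OF paired_Diff[OF P]])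
      (auto simp: smooth_kernel_def smooth_weight_def t a \<kappa> e paired_mate[OF P])
qed

lemma smooth_sum_rename:
  assumes P: "paired P" and e: "alternating e" and inj: "inj_on \<pi> P" and P': "P' = \<pi> ` P"
    and mate: "\<And>x. x \<in> P \<Longrightarrow> \<pi> (mate x) = mate (\<pi> x)"
    and e': "\<And>x. x \<in> P \<Longrightarrow> e' (\<pi> x) = e x"
    and \<kappa>': "\<And>x y. x \<in> P \<Longrightarrow> y \<in> P \<Longrightarrow> \<kappa>' (\<pi> y) (\<pi> x) = \<kappa> y x"
    and b: "b \<in> P"
  shows "smooth_sum f P' \<kappa>' e' (\<pi> b) = smooth_sum f P \<kappa> e b"
proof -
  have b': "mate b \<in> P" using P b by (simp add: paired_mate)
  have t: "from_base \<kappa>' (\<pi> b) (\<pi> y) = from_base \<kappa> b y" if "y \<in> P" for y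
    using that b \<kappa>' inj by (auto simp: from_base_def inj_on_eq_iff)
  have a: "arc_sign \<kappa>' (\<pi> b) (\<pi> y) = arc_sign \<kappa> b y" if "y \<in> P" for y
    using that b b' \<kappa>' t mate[OF b, symmetric] by (simp add: arc_sign_def)
  have m: "arc_sign \<kappa>' (\<pi> b) (mate (\<pi> y)) = arc_sign \<kappa> b (mate y)" if "y \<in> P" for y
    using a[of "mate y"] mate[OF that] that P by (simp add: paired_mate)
  have P'': "P' - {\<pi> b, mate (\<pi> b)} = \<pi> ` (P - {b, mate b})"
    using inj_on_image_set_diff[OF inj, of P "{b, mate b}"] b b' mate[OF b] P' by simp
  show ?thesis unfolding smooth_sum_def
  proof (rule gap_sum_rename[OF paired_Diff[OF P] alternating_smooth_weight[OF e] _ P'',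
        where \<alpha> = "\<lambda>_. 0"])
    show "inj_on \<pi> (P - {b, mate b})" using inj by (rule inj_on_subset) simp
  qed (simp_all add: smooth_kernel_def smooth_weight_def t a m \<kappa>' e' mate)
qed

text \<open>Consecutive letters: no third end separates them. The value \<open>\<kappa> x y\<close>
  itself does not enter, so the relation survives an exchange of the two letters.\<close>

definition adjacent :: "strand_end set \<Rightarrow> (strand_end \<Rightarrow> strand_end \<Rightarrow> int) \<Rightarrow> strand_end \<Rightarrow> strand_end \<Rightarrow> bool"
  where "adjacent P \<kappa> x y \<longleftrightarrow> (\<forall>z\<in>P. z \<noteq> x \<longrightarrow> z \<noteq> y \<longrightarrow> \<kappa> z x = \<kappa> z y)"

lemma adjacentD: "adjacent P \<kappa> x y \<Longrightarrow> z \<in> P \<Longrightarrow> z \<noteq> x \<Longrightarrow> z \<noteq> y \<Longrightarrow> \<kappa> z x = \<kappa> z y"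
  by (auto simp: adjacent_def)

lemma adjacent_commute: "adjacent P \<kappa> x y \<longleftrightarrow> adjacent P \<kappa> y x"
  by (auto simp: adjacent_def)

locale smoothing =
  fixes P \<kappa> b
  assumes P: "paired P" and \<kappa>: "order_kernel P \<kappa>" and b: "b \<in> P"
begin

lemma mate_b: "mate b \<in> P"
  using P b by (simp add: paired_mate)

lemma skew: "skew \<kappa>"
  using \<kappa> by (rule order_kernel_skew)

lemma from_base_cases: "y \<in> P \<Longrightarrow> from_base \<kappa> b y = 1 \<or> from_base \<kappa> b y = - 1"
  using order_kernel_cases[OF \<kappa>, of y b] b by (auto simp: from_base_def)

lemma arc_sign_cases: "y \<in> P \<Longrightarrow> y \<noteq> mate b \<Longrightarrow> arc_sign \<kappa> b y = 1 \<or> arc_sign \<kappa> b y = - 1"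
  using order_kernel_cases[OF \<kappa>, of "mate b" y] from_base_cases[of y] from_base_cases[OF mate_b] mate_b
  by (auto simp: arc_sign_def)

lemma adjacent_from_base:
  "adjacent P \<kappa> x y \<Longrightarrow> b \<noteq> x \<Longrightarrow> b \<noteq> y \<Longrightarrow> from_base \<kappa> b x = from_base \<kappa> b y"
  using adjacentD[of P \<kappa> x y b] b by (simp add: from_base_def)

lemma adjacent_arc_sign:
  assumes "adjacent P \<kappa> x y" "b \<noteq> x" "b \<noteq> y" "mate b \<noteq> x" "mate b \<noteq> y"
  shows "arc_sign \<kappa> b x = arc_sign \<kappa> b y"
  using adjacent_from_base[OF assms(1-3)] adjacentD[OF assms(1) mate_b]
    skewD[OF skew, of x "mate b"] skewD[OF skew, of y "mate b"] assms
  by (simp add: arc_sign_def)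

text \<open>Neighbours away from the smoothed crossing lie on the same arc, and each arc is kept or
  reversed as a whole.\<close>

lemma adjacent_smooth_kernel:
  assumes "adjacent P \<kappa> x y" "b \<noteq> x" "b \<noteq> y" "mate b \<noteq> x" "mate b \<noteq> y"
  shows "adjacent P (smooth_kernel \<kappa> b) x y"
  using adjacent_from_base[OF assms(1-3)] adjacent_arc_sign[OF assms] adjacentD[OF assms(1)]
  by (auto simp: adjacent_def smooth_kernel_def)

text \<open>In \<open>A @ rev B\<close> the letter that followed \<open>b\<close> comes first. The
  letter that preceded \<open>b\<close> is, read cyclically, the last one of \<open>B\<close>; it
  comes first in \<open>rev B\<close>, after all of \<open>A\<close> and before the rest of
  \<open>B\<close>.\<close>

lemma
  assumes y: "y \<in> P" "y \<noteq> b" "y \<noteq> mate b" and adj: "adjacent P \<kappa> y b"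
  shows arc_sign_next_base: "arc_sign \<kappa> b y = \<kappa> b y"
    and smooth_kernel_next_base: "\<And>z. z \<in> P \<Longrightarrow> z \<noteq> b \<Longrightarrow> z \<noteq> mate b \<Longrightarrow> z \<noteq> y \<Longrightarrow>
      smooth_kernel \<kappa> b z y = (if arc_sign \<kappa> b y = 1 then - 1 else arc_sign \<kappa> b z)"
proof -
  have m: "from_base \<kappa> b (mate b) = 1 \<or> from_base \<kappa> b (mate b) = - 1"
    by (rule from_base_cases[OF mate_b])
  have "\<kappa> y (mate b) = from_base \<kappa> b (mate b)"
    using adjacentD[OF adj mate_b] y skewD[OF skew, of y "mate b"] skewD[OF skew, of b "mate b"]
    by (auto simp: from_base_def)
  then show a: "arc_sign \<kappa> b y = \<kappa> b y"
    using m y by (auto simp: arc_sign_def from_base_def)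
  fix z assume z: "z \<in> P" "z \<noteq> b" "z \<noteq> mate b" "z \<noteq> y"
  have 1: "\<kappa> z y = - from_base \<kappa> b z"
    using adjacentD[OF adj z(1)] z skewD[OF skew, of z b] by (simp add: from_base_def)
  have 2: "from_base \<kappa> b y = arc_sign \<kappa> b y" using a y by (simp add: from_base_def)
  show "smooth_kernel \<kappa> b z y = (if arc_sign \<kappa> b y = 1 then - 1 else arc_sign \<kappa> b z)"
    using from_base_cases[OF z(1)] arc_sign_cases[OF y(1,3)] arc_sign_cases[OF z(1,3)]
    unfolding smooth_kernel_def 1 2 by auto
qed

text \<open>The letter before \<open>mate b\<close> is the last one of \<open>A\<close>. The letter
  after \<open>mate b\<close> is the first one of \<open>B\<close>, hence the last one of
  \<open>A @ rev B\<close>.\<close>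

lemma
  assumes y: "y \<in> P" "y \<noteq> b" "y \<noteq> mate b" and adj: "adjacent P \<kappa> y (mate b)"
  shows arc_sign_next_mate: "arc_sign \<kappa> b y = \<kappa> y (mate b)"
    and smooth_kernel_next_mate: "\<And>z. z \<in> P \<Longrightarrow> z \<noteq> b \<Longrightarrow> z \<noteq> mate b \<Longrightarrow> z \<noteq> y \<Longrightarrow>
      smooth_kernel \<kappa> b z y = (if arc_sign \<kappa> b y = 1 then arc_sign \<kappa> b z else 1)"
proof -
  have m: "from_base \<kappa> b (mate b) = 1 \<or> from_base \<kappa> b (mate b) = - 1"
    by (rule from_base_cases[OF mate_b])
  have t: "from_base \<kappa> b y = from_base \<kappa> b (mate b)"
    using adjacentD[OF adj b] y by (auto simp: from_base_def)
  then show a: "arc_sign \<kappa> b y = \<kappa> y (mate b)"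
    using m y by (auto simp: arc_sign_def)
  fix z assume z: "z \<in> P" "z \<noteq> b" "z \<noteq> mate b" "z \<noteq> y"
  have 1: "\<kappa> z y = \<kappa> z (mate b)"
    using adjacentD[OF adj z(1)] z by simp
  have 2: "\<kappa> z (mate b) * from_base \<kappa> b z * from_base \<kappa> b (mate b) = arc_sign \<kappa> b z"
    by (simp add: arc_sign_def)
  show "smooth_kernel \<kappa> b z y = (if arc_sign \<kappa> b y = 1 then arc_sign \<kappa> b z else 1)"
    using arc_sign_cases[OF y(1,3)] arc_sign_cases[OF z(1,3)]
    unfolding smooth_kernel_def 1 2 t by auto
qed

end

section \<open>Smoothings under first and second moves\<close>

text \<open>Smoothing at another crossing keeps the two ends of the kink adjacent, so it is still a
  kink of the smoothed word.\<close>

lemma smooth_sum_kink: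
  assumes P: "paired P" and e: "alternating e" and \<kappa>: "order_kernel P \<kappa>"
    and odd: "\<And>m. f (- m) = - f m"
    and a: "a \<in> P" and adj: "adjacent P \<kappa> a (mate a)"
    and base: "b \<in> P" "b \<noteq> a" "b \<noteq> mate a"
  shows "smooth_sum f P \<kappa> e b = smooth_sum f (P - {a, mate a}) \<kappa> e b"
proof -
  interpret smoothing P \<kappa> b using assms by unfold_locales
  have b': "mate b \<noteq> a" "mate b \<noteq> mate a" using base by (auto simp: mate_eq_commute)
  have "adjacent P (smooth_kernel \<kappa> b) a (mate a)"
    by (rule adjacent_smooth_kernel[OF adj base(2,3) b'])
  from adjacentD[OF this]
  have "smooth_sum f P \<kappa> e b = gap_sum f (P - {b, mate b} - {a, mate a}) (smooth_kernel \<kappa> b) (smooth_weight \<kappa> b e)"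
    unfolding smooth_sum_def
    by (intro gap_sum_kink[where k = 0] paired_Diff P alternating_smooth_weight e
        skew_smooth_kernel skew odd) (use a base b' in auto)
  moreover have "P - {b, mate b} - {a, mate a} = P - {a, mate a} - {b, mate b}"
    by blast
  ultimately show ?thesis by (simp add: smooth_sum_def)
qed

text \<open>One of the two arcs is empty, so the smoothed word is the rest of the word or its
  reversal. Its sum is plus or minus that of the rest, which is zero by assumption.\<close>

lemma smooth_sum_at_kink:
  assumes P: "paired P" and \<kappa>: "order_kernel P \<kappa>"
    and odd: "\<And>m. f (- m) = - f m"
    and b: "b \<in> P" and adj: "adjacent P \<kappa> b (mate b)"
    and first: "\<And>z. z \<in> P \<Longrightarrow> z \<noteq> b \<Longrightarrow> z \<noteq> mate b \<Longrightarrow> \<kappa> b z = 1"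
    and zero: "gap_sum f (P - {b, mate b}) \<kappa> e = 0"
  shows "smooth_sum f P \<kappa> e b = 0"
proof -
  interpret smoothing P \<kappa> b using assms by unfold_locales
  let ?P = "P - {b, mate b}"
  \<comment> \<open>The common arc sign of all remaining ends: \<open>- 1\<close> if
    \<open>b\<close> precedes \<open>mate b\<close>, for then \<open>A\<close> is empty and
    everything is reversed.\<close>
  define s where "s = - from_base \<kappa> b (mate b)"
  have s: "s = 1 \<or> s = - 1" using from_base_cases[OF mate_b] by (auto simp: s_def)
  have t: "from_base \<kappa> b z = 1" if "z \<in> ?P" for z using first that by (simp add: from_base_def)
  have a: "arc_sign \<kappa> b z = s" if "z \<in> ?P" for z
  proof -
    have "\<kappa> z (mate b) = - 1"
      using adjacentD[OF adj, of z] that skewD[OF skew, of z b] first[of z] by simp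
    then show ?thesis using that by (simp add: arc_sign_def t s_def)
  qed
  have k: "smooth_kernel \<kappa> b z y = s * \<kappa> z y" if "z \<in> ?P" "y \<in> ?P" for z y
    using that s by (auto simp: smooth_kernel_def a t)
  have w: "smooth_weight \<kappa> b e z = e z" if "z \<in> ?P" for z
    using that s a[OF that] a[of "mate z"] P
    by (auto simp: smooth_weight_def paired_mate mate_eq_commute)
  have "smooth_sum f P \<kappa> e b = gap_sum f ?P (\<lambda>z y. s * \<kappa> z y) e"
    unfolding smooth_sum_def by (rule gap_sum_cong[OF paired_Diff[OF P]]) (simp_all only: k w)
  moreover have "gap_sum f ?P (\<lambda>z y. - 1 * \<kappa> z y) e = 0"
    using gap_sum_uminus[of f ?P \<kappa> e, OF odd] zero by simp
  ultimately show ?thesis using s zero by auto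
qed

text \<open>Neighbours lie on the same arc, so the weights at \<open>a\<close> and \<open>c\<close>
  receive the same sign factors and stay opposite: the bigon remains a bigon.\<close>

lemma smooth_sum_bigon:
  assumes P: "paired P" and e: "alternating e" and \<kappa>: "order_kernel P \<kappa>"
    and odd: "\<And>m. f (- m) = - f m"
    and a: "a \<in> P" and c: "c \<in> P" "c \<noteq> a" "c \<noteq> mate a" and ac: "e c = - e a"
    and adj: "adjacent P \<kappa> a c" and adj': "adjacent P \<kappa> (mate a) (mate c)"
    and base: "b \<in> P" "b \<noteq> a" "b \<noteq> mate a" "b \<noteq> c" "b \<noteq> mate c"
  shows "smooth_sum f P \<kappa> e b = smooth_sum f (P - {a, mate a} - {c, mate c}) \<kappa> e b"
proof -
  interpret smoothing P \<kappa> b using assms by unfold_locales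
  have b': "mate b \<noteq> a" "mate b \<noteq> mate a" "mate b \<noteq> c" "mate b \<noteq> mate c"
    using base by (auto simp: mate_eq_commute)
  have 1: "adjacent P (smooth_kernel \<kappa> b) a c"
    by (rule adjacent_smooth_kernel[OF adj base(2,4) b'(1,3)])
  have 2: "adjacent P (smooth_kernel \<kappa> b) (mate a) (mate c)"
    by (rule adjacent_smooth_kernel[OF adj' base(3,5) b'(2,4)])
  have "arc_sign \<kappa> b a = arc_sign \<kappa> b c" "arc_sign \<kappa> b (mate a) = arc_sign \<kappa> b (mate c)"
    using adjacent_arc_sign[OF adj base(2,4) b'(1,3)] adjacent_arc_sign[OF adj' base(3,5) b'(2,4)] by simp_all
  then have "smooth_weight \<kappa> b e c = - smooth_weight \<kappa> b e a"
    by (simp add: smooth_weight_def ac)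
  then have "smooth_sum f P \<kappa> e b = gap_sum f (P - {b, mate b} - {a, mate a} - {c, mate c})
      (smooth_kernel \<kappa> b) (smooth_weight \<kappa> b e)"
    unfolding smooth_sum_def
    by (intro gap_sum_bigon[where k = 0 and k' = 0] paired_Diff P alternating_smooth_weight e
        skew_smooth_kernel skew odd) (use a base b' c adjacentD[OF 1] adjacentD[OF 2] in auto)
  moreover have "P - {b, mate b} - {a, mate a} - {c, mate c} = P - {a, mate a} - {c, mate c} - {b, mate b}"
    by blast
  ultimately show ?thesis by (simp add: smooth_sum_def)
qed


text \<open>Smoothing one corner of the bigon leaves the other corner. If its ends lie on different
  arcs, it has become a kink in both smoothings, and both reduce to the remaining ends
  \<open>R\<close>. If they lie on one arc, the two smoothed words coincide cyclically up to
  names.\<close>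

lemma smooth_sum_at_bigon:
  assumes P: "paired P" and e: "alternating e" and \<kappa>: "order_kernel P \<kappa>"
    and odd: "\<And>m. f (- m) = - f m"
    and ab: "a \<in> P" "b \<in> P" "a \<noteq> b" "a \<noteq> mate b" and e_ab: "e a = - e b"
    and adj: "adjacent P \<kappa> a b" and adj': "adjacent P \<kappa> (mate a) (mate b)"
  shows "smooth_sum f P \<kappa> e a = smooth_sum f P \<kappa> e b"
proof -
  interpret A: smoothing P \<kappa> a using assms by unfold_locales
  interpret B: smoothing P \<kappa> b using assms by unfold_locales
  define R where "R = P - {a, mate a} - {b, mate b}"
  have R: "P - {b, mate b} - {a, mate a} = R" "P - {a, mate a} - {b, mate b} = R"
    by (auto simp: R_def)
  have ne: "a \<noteq> b" "b \<noteq> a" "a \<noteq> mate b" "b \<noteq> mate a" "mate a \<noteq> b" "mate b \<noteq> a"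
    using ab by (auto simp: mate_eq_commute)
  have adj2: "adjacent P \<kappa> b a" "adjacent P \<kappa> (mate b) (mate a)"
    using adj adj' adjacent_commute by blast+
  note k = skewD[OF A.skew]
  have sa: "arc_sign \<kappa> b a = \<kappa> b a" "arc_sign \<kappa> b (mate a) = \<kappa> (mate a) (mate b)"
    using B.arc_sign_next_base[OF _ _ _ adj] B.arc_sign_next_mate[OF _ _ _ adj'] ne ab A.mate_b by auto
  have sb: "arc_sign \<kappa> a b = - arc_sign \<kappa> b a" "arc_sign \<kappa> a (mate b) = - arc_sign \<kappa> b (mate a)"
    using A.arc_sign_next_base[OF _ _ _ adj2(1)] A.arc_sign_next_mate[OF _ _ _ adj2(2)] ne ab B.mate_b
      k[of a b] k[of "mate a" "mate b"] sa by auto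
  have ka: "smooth_kernel \<kappa> b z a = (if arc_sign \<kappa> b a = 1 then - 1 else arc_sign \<kappa> b z)"
    if "z \<in> insert (mate a) R" for z
    using B.smooth_kernel_next_base[OF _ _ _ adj, of z] that ne ab A.mate_b by (auto simp: R_def)
  have ka': "smooth_kernel \<kappa> b z (mate a) = (if arc_sign \<kappa> b (mate a) = 1 then arc_sign \<kappa> b z else 1)"
    if "z \<in> insert a R" for z
    using B.smooth_kernel_next_mate[OF _ _ _ adj', of z] that ne ab A.mate_b by (auto simp: R_def)
  have kb: "smooth_kernel \<kappa> a z b = (if arc_sign \<kappa> b a = - 1 then - 1 else arc_sign \<kappa> a z)"
    if "z \<in> insert (mate b) R" for z
    using A.smooth_kernel_next_base[OF _ _ _ adj2(1), of z] that ne ab B.mate_b sb by (auto simp: R_def)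
  have kb': "smooth_kernel \<kappa> a z (mate b) = (if arc_sign \<kappa> b (mate a) = - 1 then arc_sign \<kappa> a z else 1)"
    if "z \<in> insert b R" for z
    using A.smooth_kernel_next_mate[OF _ _ _ adj2(2), of z] that ne ab B.mate_b sb by (auto simp: R_def)
  have t: "from_base \<kappa> a z = from_base \<kappa> b z" if "z \<in> R" for z
    using adjacentD[OF adj, of z] k[of z a] k[of z b] that by (auto simp: from_base_def R_def)
  have "\<kappa> a (mate a) = \<kappa> b (mate b)"
    using adjacentD[OF adj', of a] adjacentD[OF adj, of "mate b"] ab ne B.mate_b
      k[of a "mate b"] k[of b "mate b"] by simp
  then have s: "arc_sign \<kappa> a z = arc_sign \<kappa> b z" if "z \<in> R" for z
    using t[OF that] adjacentD[OF adj', of z] that by (auto simp: arc_sign_def from_base_def R_def)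
  have kR: "smooth_kernel \<kappa> a z w = smooth_kernel \<kappa> b z w" if "z \<in> R" "w \<in> R" for z w
    using that by (simp add: smooth_kernel_def s t)
  have R_pair: "paired R" unfolding R_def by (intro paired_Diff P)
  have wR: "smooth_weight \<kappa> a e z = smooth_weight \<kappa> b e z" if "z \<in> R" for z
    using that R_pair by (simp add: smooth_weight_def s paired_mate)
  have sa_cases: "arc_sign \<kappa> b a = 1 \<or> arc_sign \<kappa> b a = - 1"
      "arc_sign \<kappa> b (mate a) = 1 \<or> arc_sign \<kappa> b (mate a) = - 1"
    using B.arc_sign_cases[of a] B.arc_sign_cases[of "mate a"] ab ne A.mate_b by auto
  have skew: "skew (smooth_kernel \<kappa> a)" "skew (smooth_kernel \<kappa> b)"
    by (simp_all add: skew_smooth_kernel A.skew)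
  show ?thesis
  proof (cases "arc_sign \<kappa> b a = arc_sign \<kappa> b (mate a)")
    case False
    \<comment> \<open>In the smoothing at \<open>b\<close>, arc sign \<open>1\<close> of
      \<open>a\<close> puts \<open>a\<close> first and \<open>mate a\<close> last, a kink across the
      base point. In the smoothing at \<open>a\<close> all arc signs at the other corner are
      opposite, hence the condition in \<open>k'\<close>.\<close>
    define k where "k = (if arc_sign \<kappa> b a = 1 then - 2 else 0 :: int)"
    define k' where "k' = (if arc_sign \<kappa> b a = - 1 then - 2 else 0 :: int)"
    have "smooth_sum f P \<kappa> e b = gap_sum f R (smooth_kernel \<kappa> b) (smooth_weight \<kappa> b e)"
      unfolding smooth_sum_def R[symmetric] using False sa_cases ab ne
      by (intro gap_sum_kink[where k = k] paired_Diff P alternating_smooth_weight e skew odd)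
        (auto simp: ka ka' R_def k_def)
    moreover have "smooth_sum f P \<kappa> e a = gap_sum f R (smooth_kernel \<kappa> a) (smooth_weight \<kappa> a e)"
      unfolding smooth_sum_def R(2)[symmetric] using False sa_cases ab ne
      by (intro gap_sum_kink[where k = k'] paired_Diff P alternating_smooth_weight e skew odd)
        (auto simp: kb kb' R_def k'_def)
    moreover have "gap_sum f R (smooth_kernel \<kappa> a) (smooth_weight \<kappa> a e) =
        gap_sum f R (smooth_kernel \<kappa> b) (smooth_weight \<kappa> b e)"
      by (rule gap_sum_cong[OF R_pair]) (simp_all add: kR wR)
    ultimately show ?thesis by simp
  next
    case True
    \<comment> \<open>For arc sign \<open>1\<close> the cyclic word reads
      \<open>b a R1 (mate a) (mate b) R2\<close>. Smoothing at \<open>b\<close> gives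
      \<open>a R1 (mate a) (rev R2)\<close>, smoothing at \<open>a\<close> gives
      \<open>R1 b (rev R2) (mate b)\<close>. After moving \<open>mate b\<close> to the front,
      \<open>a\<close> corresponds to \<open>mate b\<close> and \<open>mate a\<close> to
      \<open>b\<close>; \<open>\<alpha>\<close> accounts for the letter moved. For arc sign
      \<open>- 1\<close> the letter moved corresponds to \<open>mate a\<close>.\<close>
    define \<pi> where "\<pi> = (\<lambda>x. if x = a then mate b else if x = mate a then b else x)"
    define \<alpha> where "\<alpha> = (\<lambda>x. if x = a \<and> arc_sign \<kappa> b a = 1 then - 2
        else if x = mate a \<and> arc_sign \<kappa> b a = - 1 then 2 else 0 :: int)"
    let ?Pb = "P - {b, mate b}"
    have Pb: "?Pb = insert a (insert (mate a) R)"
      using ab ne A.mate_b by (auto simp: R_def)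
    have \<pi>: "\<pi> a = mate b" "\<pi> (mate a) = b" "\<And>z. z \<in> R \<Longrightarrow> \<pi> z = z"
      by (auto simp: \<pi>_def R_def)
    have \<alpha>: "\<And>z. z \<in> R \<Longrightarrow> \<alpha> z = 0" by (auto simp: \<alpha>_def R_def)
    have "gap_sum f (P - {a, mate a}) (smooth_kernel \<kappa> a) (smooth_weight \<kappa> a e) =
        gap_sum f ?Pb (smooth_kernel \<kappa> b) (smooth_weight \<kappa> b e)"
    proof (rule gap_sum_rename[where \<alpha> = \<alpha> and \<pi> = \<pi>])
      show "inj_on \<pi> ?Pb" unfolding Pb using ne
        by (auto simp: inj_on_def \<pi>) (auto simp: R_def)
      show "P - {a, mate a} = \<pi> ` ?Pb" unfolding Pb using ab ne B.mate_b
        by (auto simp: \<pi>) (auto simp: R_def)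
      show "\<pi> (mate x) = mate (\<pi> x)" if "x \<in> ?Pb" for x
        using that R_pair by (auto simp: Pb \<pi> paired_mate)
      have "smooth_weight \<kappa> a e b = smooth_weight \<kappa> b e (mate a)"
          "smooth_weight \<kappa> a e (mate b) = smooth_weight \<kappa> b e a"
        using True sb e_ab alternatingD[OF e, of a] alternatingD[OF e, of b]
        by (simp_all add: smooth_weight_def)
      then show "smooth_weight \<kappa> a e (\<pi> x) = smooth_weight \<kappa> b e x" if "x \<in> ?Pb" for x
        using that wR \<pi> unfolding Pb by (elim insertE) simp_all
      have main: "smooth_kernel \<kappa> a (\<pi> y) (\<pi> x) = smooth_kernel \<kappa> b y x + \<alpha> y - \<alpha> x"
        if h: "(x = a \<and> y = mate a) \<or> (x = a \<and> y \<in> R) \<or> (x = mate a \<and> y \<in> R)" for x y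
      proof -
        consider "x = a" "y = mate a" | "x = a" "y \<in> R" | "x = mate a" "y \<in> R" using h by blast
        then show ?thesis
        proof cases
          case 1
          have "smooth_kernel \<kappa> a b (mate b) = (if arc_sign \<kappa> b a = - 1 then - arc_sign \<kappa> b a else 1)"
            "smooth_kernel \<kappa> b (mate a) a = (if arc_sign \<kappa> b a = 1 then - 1 else arc_sign \<kappa> b a)"
            using ka[of "mate a"] kb'[of b] True sb(1) by simp_all
          then show ?thesis using sa_cases(1) unfolding 1 \<pi>(1,2) \<alpha>_def by auto
        next
          case 2
          have "smooth_kernel \<kappa> a y (mate b) = (if arc_sign \<kappa> b a = - 1 then arc_sign \<kappa> b y else 1)"
            "smooth_kernel \<kappa> b y a = (if arc_sign \<kappa> b a = 1 then - 1 else arc_sign \<kappa> b y)"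
            using ka[of y] kb'[of y] True s[OF 2(2)] 2(2) by simp_all
          then show ?thesis using sa_cases(1) unfolding 2(1) \<pi>(1) \<pi>(3)[OF 2(2)] \<alpha>[OF 2(2)]
            by (auto simp: \<alpha>_def)
        next
          case 3
          have "smooth_kernel \<kappa> a y b = (if arc_sign \<kappa> b a = - 1 then - 1 else arc_sign \<kappa> b y)"
            "smooth_kernel \<kappa> b y (mate a) = (if arc_sign \<kappa> b a = 1 then arc_sign \<kappa> b y else 1)"
            using ka'[of y] kb[of y] True s[OF 3(2)] 3(2) by simp_all
          then show ?thesis using sa_cases(1) unfolding 3(1) \<pi>(2) \<pi>(3)[OF 3(2)] \<alpha>[OF 3(2)]
            by (auto simp: \<alpha>_def)
        qed
      qed
      fix x y assume "x \<in> ?Pb" "y \<in> ?Pb"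
      then consider "(x = a \<and> y = mate a) \<or> (x = a \<and> y \<in> R) \<or> (x = mate a \<and> y \<in> R)"
        | "(y = a \<and> x = mate a) \<or> (y = a \<and> x \<in> R) \<or> (y = mate a \<and> x \<in> R)"
        | "x = y" | "x \<in> R" "y \<in> R" unfolding Pb by blast
      then show "smooth_kernel \<kappa> a (\<pi> y) (\<pi> x) = smooth_kernel \<kappa> b y x + \<alpha> y - \<alpha> x"
      proof cases
        case 1
        then show ?thesis by (rule main)
      next
        case 2
        then show ?thesis
          using main[of y x] skewD[OF skew(1), of "\<pi> y" "\<pi> x"] skewD[OF skew(2), of y x] by simp
      next
        case 3
        then show ?thesis using skew by simp
      next
        case 4
        then show ?thesis by (simp add: \<pi> \<alpha> kR)
      qed
    qed (intro paired_Diff P alternating_smooth_weight e)+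
    then show ?thesis by (simp add: smooth_sum_def)
  qed
qed

section \<open>Smoothings under third moves\<close>

text \<open>
  A third move. The set \<open>T\<close> consists of the six ends at the triangle, \<open>\<mu>\<close> exchanges the two ends on the
  same strand, and \<open>balance\<close> expresses that the triangle lies on the same side of each strand at both of
  its corners.
\<close>

locale triangle_flip =
  fixes P \<kappa> \<kappa>' e T \<mu>
  assumes P: "paired P" and e: "alternating e" and \<kappa>: "order_kernel P \<kappa>" and skew': "skew \<kappa>'"
    and T: "\<And>x. x \<in> T \<Longrightarrow> x \<in> P" "\<And>x. x \<in> T \<Longrightarrow> mate x \<in> T" "\<And>x. x \<in> T \<Longrightarrow> \<mu> x \<in> T"
      "\<And>x. x \<in> T \<Longrightarrow> \<mu> (\<mu> x) = x" "\<And>x. x \<in> T \<Longrightarrow> \<mu> x \<noteq> x" "\<And>x. x \<in> T \<Longrightarrow> \<mu> x \<noteq> mate x"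
    and braid: "\<And>x. x \<in> T \<Longrightarrow> \<mu> (mate (\<mu> x)) = mate (\<mu> (mate x))"
    and T_eq: "\<And>x. x \<in> T \<Longrightarrow> T = {x, mate x, \<mu> x, mate (\<mu> x), \<mu> (mate x), mate (\<mu> (mate x))}"
    and adj: "\<And>x. x \<in> T \<Longrightarrow> adjacent P \<kappa> (\<mu> x) x"
    and balance: "\<And>x. x \<in> T \<Longrightarrow>
      \<kappa> (\<mu> x) x * e (\<mu> x) = \<kappa> (\<mu> (mate x)) (mate x) * e (\<mu> (mate x))"
    and \<kappa>': "\<And>x y. x \<in> P \<Longrightarrow> y \<in> P \<Longrightarrow> \<kappa>' y x = (if x \<in> T \<and> y = \<mu> x then - \<kappa> y x else \<kappa> y x)"
begin

lemma gap_eq: "x \<in> P \<Longrightarrow> gap P \<kappa>' e x = gap P \<kappa> e x"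
  using T by (intro gap_flip[OF P order_kernel_skew[OF \<kappa>] _ _ balance \<kappa>']) auto

lemma gap_sum_eq: "gap_sum f P \<kappa>' e = gap_sum f P \<kappa> e"
  unfolding gap_sum_def by (rule sum.cong) (simp_all add: gap_eq)

lemma order_kernel': "order_kernel P \<kappa>'"
  using \<kappa> skew' unfolding order_kernel_def by (auto simp: \<kappa>')

lemma adj': "adjacent P \<kappa>' (\<mu> x) x" if x: "x \<in> T"
  unfolding adjacent_def
proof (intro ballI impI)
  fix z assume z: "z \<in> P" "z \<noteq> \<mu> x" "z \<noteq> x"
  have "\<kappa>' z (\<mu> x) = \<kappa> z (\<mu> x)" "\<kappa>' z x = \<kappa> z x"
    using z T(4)[OF x] T(1)[OF x] T(1)[OF T(3)[OF x]] by (simp_all add: \<kappa>')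
  then show "\<kappa>' z (\<mu> x) = \<kappa>' z x" using adjacentD[OF adj[OF x] z] by simp
qed

text \<open>Each strand of the triangle lies within one arc, so the smoothed kernels again differ by
  a flip of neighbours. It remains to see that \<open>balance\<close> survives the change of
  signs.\<close>

lemma smooth_sum_outside:
  assumes b: "b \<in> P" "b \<notin> T"
  shows "smooth_sum f P \<kappa>' e b = smooth_sum f P \<kappa> e b"
proof -
  interpret S: smoothing P \<kappa> b using P \<kappa> b by unfold_locales
  have b': "mate b \<in> P" "mate b \<notin> T" using S.mate_b T(2)[of "mate b"] b by auto
  have ne: "b \<noteq> x \<and> mate b \<noteq> x" if "x \<in> T" for x using that b b' by auto
  have t: "from_base \<kappa>' b y = from_base \<kappa> b y" if "y \<in> P" for y
    using that b T(3)[of y] by (auto simp: from_base_def \<kappa>')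
  have s: "arc_sign \<kappa>' b y = arc_sign \<kappa> b y" if "y \<in> P" for y
    using that b' t by (auto simp: arc_sign_def \<kappa>')
  have w: "smooth_weight \<kappa>' b e y = smooth_weight \<kappa> b e y" if "y \<in> P" for y
    using that P by (simp add: smooth_weight_def s paired_mate)
  let ?P = "P - {b, mate b}"
  have c: "arc_sign \<kappa> b x = 1 \<or> arc_sign \<kappa> b x = - 1" if "x \<in> T" for x
    using S.arc_sign_cases[of x] ne[OF that] T(1)[OF that] by auto
  have eqs: "from_base \<kappa> b (\<mu> x) = from_base \<kappa> b x" "arc_sign \<kappa> b (\<mu> x) = arc_sign \<kappa> b x" if "x \<in> T" for x
    using S.adjacent_from_base[OF adj[OF that]] S.adjacent_arc_sign[OF adj[OF that]]
      ne[OF that] ne[OF T(3)[OF that]] by auto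
  \<comment> \<open>\<open>x\<close> and \<open>\<mu> x\<close> have the same
    \<open>from_base\<close> and arc sign, and these squares cancel; only the arc sign of the
    crossing strand at \<open>\<mu> x\<close> is left.\<close>
  have prod: "smooth_kernel \<kappa> b (\<mu> x) x * smooth_weight \<kappa> b e (\<mu> x) =
      \<kappa> (\<mu> x) x * e (\<mu> x) * arc_sign \<kappa> b (mate (\<mu> x))" if "x \<in> T" for x
    using S.from_base_cases[OF T(1)[OF that]] c[OF that] eqs[OF that]
    by (auto simp: smooth_kernel_def smooth_weight_def)
  have "gap ?P (smooth_kernel \<kappa>' b) (smooth_weight \<kappa> b e) x =
      gap ?P (smooth_kernel \<kappa> b) (smooth_weight \<kappa> b e) x" if "x \<in> ?P" for x
  proof (rule gap_flip[where T = T and \<mu> = \<mu>])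
    show "smooth_kernel \<kappa> b (\<mu> x) x * smooth_weight \<kappa> b e (\<mu> x) =
        smooth_kernel \<kappa> b (\<mu> (mate x)) (mate x) * smooth_weight \<kappa> b e (\<mu> (mate x))" if x: "x \<in> T" for x
    proof -
      \<comment> \<open>Both \<open>mate (\<mu> x)\<close> and \<open>mate (\<mu> (mate x))\<close>
        lie on the third strand, the one not passing through the corner of \<open>x\<close>; so both
        sides of \<open>balance\<close> are multiplied by the same arc sign.\<close>
      have "mate (\<mu> (mate x)) = \<mu> (mate (\<mu> x))" using braid[OF x] by simp
      then have "arc_sign \<kappa> b (mate (\<mu> (mate x))) = arc_sign \<kappa> b (mate (\<mu> x))"
        using eqs(2)[of "mate (\<mu> x)"] T x by simp
      then show ?thesis using prod[OF x] prod[OF T(2)[OF x]] balance[OF x] by simp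
    qed
    show "\<mu> x \<in> ?P" if "x \<in> T" for x using that T ne[of "\<mu> x"] by auto
    show "skew (smooth_kernel \<kappa> b)" by (rule skew_smooth_kernel[OF S.skew])
    show "smooth_kernel \<kappa>' b y x = (if x \<in> T \<and> y = \<mu> x then - smooth_kernel \<kappa> b y x else smooth_kernel \<kappa> b y x)"
      if "x \<in> ?P" "y \<in> ?P" for x y
      using that by (auto simp: smooth_kernel_def t s \<kappa>')
  qed (use T that paired_Diff[OF P] in auto)
  then have "gap_sum f ?P (smooth_kernel \<kappa>' b) (smooth_weight \<kappa> b e) =
      gap_sum f ?P (smooth_kernel \<kappa> b) (smooth_weight \<kappa> b e)"
    unfolding gap_sum_def by (intro sum.cong) auto
  moreover have "gap_sum f ?P (smooth_kernel \<kappa>' b) (smooth_weight \<kappa>' b e) =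
      gap_sum f ?P (smooth_kernel \<kappa>' b) (smooth_weight \<kappa> b e)"
    by (rule gap_sum_cong[OF paired_Diff[OF P]]) (auto simp: w)
  ultimately show ?thesis by (simp add: smooth_sum_def)
qed

text \<open>The flip carries \<open>y\<close> past \<open>b\<close> and \<open>z\<close> past
  \<open>mate b\<close>, so both change arcs. If \<open>y\<close> and \<open>z\<close> lie on
  different arcs, they are cyclic neighbours in both smoothed words and form a bigon with the third
  strand, which is deleted on both sides. If they lie on one arc, the two smoothed words agree
  cyclically after exchanging the two crossings.\<close>

lemma smooth_sum_inside:
  assumes odd: "\<And>m. f (- m) = - f m" and b: "b \<in> T"
  shows "smooth_sum f P \<kappa>' e b = smooth_sum f P \<kappa> e b"
proof -
  define y where "y = \<mu> b"
  define z where "z = \<mu> (mate b)"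
  define R where "R = P - {b, mate b} - {y, mate y} - {z, mate z}"
  have bT: "b \<in> T" "mate b \<in> T" "y \<in> T" "mate y \<in> T" "z \<in> T" "mate z \<in> T"
    using b T(2,3) by (simp_all add: y_def z_def)
  note inP = bT[THEN T(1)]
  have mu: "\<mu> b = y" "\<mu> y = b" "\<mu> (mate b) = z" "\<mu> z = mate b" "\<mu> (mate y) = mate z" "\<mu> (mate z) = mate y"
    using braid[OF bT(1)] T(4)[OF bT(1)] T(4)[OF bT(2)] T(4)[OF bT(4)] by (simp_all add: y_def z_def)
  have ne: "y \<noteq> b" "y \<noteq> mate b" "z \<noteq> b" "z \<noteq> mate b" "y \<noteq> z" "y \<noteq> mate z"
    using T(5,6)[OF bT(1)] T(5,6)[OF bT(2)] mu by auto
  then have ne': "b \<noteq> y" "b \<noteq> mate y" "mate b \<noteq> y" "b \<noteq> z" "b \<noteq> mate z" "mate b \<noteq> z"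
      "mate y \<noteq> b" "mate z \<noteq> b" "z \<noteq> y" "mate y \<noteq> z" "mate z \<noteq> y" "z \<noteq> mate y"
    by (auto simp: mate_eq_commute)
  have TR: "x \<notin> T" if "x \<in> R" for x
    using that T_eq[OF bT(1)] mu by (auto simp: R_def y_def[symmetric] z_def[symmetric])
  interpret S: smoothing P \<kappa> b using P \<kappa> inP by unfold_locales
  interpret S': smoothing P \<kappa>' b using P order_kernel' inP by unfold_locales
  have a: "adjacent P \<kappa> y b" "adjacent P \<kappa> z (mate b)" "adjacent P \<kappa> (mate y) (mate z)"
    using adj[OF bT(1)] adj[OF bT(2)] adj[OF bT(6)] mu by simp_all
  have a': "adjacent P \<kappa>' y b" "adjacent P \<kappa>' z (mate b)" "adjacent P \<kappa>' (mate y) (mate z)"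
    using adj'[OF bT(1)] adj'[OF bT(2)] adj'[OF bT(6)] mu by simp_all
  have flip: "\<kappa>' b y = - \<kappa> b y" "\<kappa>' z (mate b) = - \<kappa> z (mate b)"
    using \<kappa>' inP bT mu by simp_all
  have sy: "arc_sign \<kappa> b y = \<kappa> b y" "arc_sign \<kappa>' b y = - arc_sign \<kappa> b y"
    using S.arc_sign_next_base[OF _ _ _ a(1)] S'.arc_sign_next_base[OF _ _ _ a'(1)] flip inP ne by simp_all
  have sz: "arc_sign \<kappa> b z = \<kappa> z (mate b)" "arc_sign \<kappa>' b z = - arc_sign \<kappa> b z"
    using S.arc_sign_next_mate[OF _ _ _ a(2)] S'.arc_sign_next_mate[OF _ _ _ a'(2)] flip inP ne by simp_all
  have cases: "arc_sign \<kappa> b y = 1 \<or> arc_sign \<kappa> b y = - 1" "arc_sign \<kappa> b z = 1 \<or> arc_sign \<kappa> b z = - 1"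
    using S.arc_sign_cases inP ne by blast+
  let ?Q = "insert (mate y) (insert (mate z) R)"
  have Q: "x \<in> P \<and> x \<noteq> b \<and> x \<noteq> mate b \<and> x \<noteq> y \<and> x \<noteq> z" if "x \<in> ?Q" for x
    using that inP ne ne' by (auto simp: R_def)
  have t: "from_base \<kappa>' b x = from_base \<kappa> b x" if "x \<in> insert (mate b) ?Q" for x
    using Q[of x] that inP ne' mu bT \<kappa>'[of x b] T(4)[of x] by (auto simp: from_base_def)
  have s: "arc_sign \<kappa>' b x = arc_sign \<kappa> b x" if "x \<in> ?Q" for x
    using Q[OF that] t[of x] t[of "mate b"] that inP mu \<kappa>'[of "mate b" x] by (auto simp: arc_sign_def)
  have s_yz: "arc_sign \<kappa> b (mate y) = arc_sign \<kappa> b (mate z)"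
    using S.adjacent_arc_sign[OF a(3)] ne ne' by auto
  have kR: "smooth_kernel \<kappa>' b x w = smooth_kernel \<kappa> b x w"
    if "x \<in> ?Q" "w \<in> R" for x w
    using that Q[of x] Q[of w] TR[of w] \<kappa>'[of w x] by (simp add: smooth_kernel_def t s)
  have kyz: "smooth_kernel \<kappa>' b (mate y) (mate z) = - smooth_kernel \<kappa> b (mate y) (mate z)"
    using \<kappa>'[of "mate z" "mate y"] inP bT mu by (simp add: smooth_kernel_def t s)
  have wQ: "smooth_weight \<kappa>' b e x = smooth_weight \<kappa> b e x" if "x \<in> R" for x
  proof -
    have "mate x \<in> R" using that P by (auto simp: R_def paired_mate mate_eq_commute)
    then show ?thesis using that by (simp add: smooth_weight_def s)
  qed
  \<comment> \<open>\<open>balance\<close> at the corner \<open>b\<close> compares the weights of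
    the two other corners. It makes the smoothed weights of \<open>y\<close> and \<open>z\<close>
    opposite, as both a bigon and an exchange of names require.\<close>
  have bal: "arc_sign \<kappa> b z * e z = - (arc_sign \<kappa> b y * e y)"
    using balance[OF bT(1)] mu skewD[OF S.skew, of y b] by (simp add: sy sz)
  have wz: "smooth_weight \<kappa> b e z = - smooth_weight \<kappa> b e y"
    using bal unfolding smooth_weight_def s_yz by (simp add: algebra_simps)
  have w': "smooth_weight \<kappa>' b e y = - smooth_weight \<kappa> b e y"
      "smooth_weight \<kappa>' b e z = - smooth_weight \<kappa> b e z"
    by (simp_all add: smooth_weight_def sy sz s)
  have ky: "smooth_kernel \<kappa> b x y = (if arc_sign \<kappa> b y = 1 then - 1 else arc_sign \<kappa> b x)"
      "smooth_kernel \<kappa>' b x y = (if arc_sign \<kappa> b y = - 1 then - 1 else arc_sign \<kappa>' b x)"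
    if "x \<in> insert z ?Q" for x
    using S.smooth_kernel_next_base[OF _ _ _ a(1), of x] S'.smooth_kernel_next_base[OF _ _ _ a'(1), of x]
      Q[of x] that ne ne' inP sy by auto
  have kz: "smooth_kernel \<kappa> b x z = (if arc_sign \<kappa> b z = 1 then arc_sign \<kappa> b x else 1)"
      "smooth_kernel \<kappa>' b x z = (if arc_sign \<kappa> b z = - 1 then arc_sign \<kappa>' b x else 1)"
    if "x \<in> insert y ?Q" for x
    using S.smooth_kernel_next_mate[OF _ _ _ a(2), of x] S'.smooth_kernel_next_mate[OF _ _ _ a'(2), of x]
      Q[of x] that ne ne' inP sz by auto
  have skew2: "skew (smooth_kernel \<kappa>' b)" "skew (smooth_kernel \<kappa> b)"
    by (simp_all add: skew_smooth_kernel S.skew S'.skew)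
  let ?P = "P - {b, mate b}"
  have P_eq: "?P = insert y (insert z ?Q)"
    using inP ne ne' by (auto simp: R_def)
  have memb: "y \<in> ?P" "z \<in> ?P" using P_eq by blast+
  have adj2: "adjacent P (smooth_kernel \<kappa> b) (mate y) (mate z)"
      "adjacent P (smooth_kernel \<kappa>' b) (mate y) (mate z)"
    using S.adjacent_smooth_kernel[OF a(3)] S'.adjacent_smooth_kernel[OF a'(3)] ne ne' by auto
  show ?thesis
  proof (cases "arc_sign \<kappa> b y = arc_sign \<kappa> b z")
    case False
    \<comment> \<open>Arc sign \<open>1\<close> puts \<open>y\<close> first, and arc sign
      \<open>- 1\<close> puts \<open>z\<close> last, so the twins are separated by the base point.
      After the flip both arc signs are reversed, which gives \<open>k'\<close>.\<close>
    define k where "k = (if arc_sign \<kappa> b y = 1 then - 2 else 0 :: int)"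
    define k' where "k' = (if arc_sign \<kappa> b y = - 1 then - 2 else 0 :: int)"
    have R_eq: "R = ?P - {y, mate y} - {z, mate z}" by (simp add: R_def)
    have R_pair: "paired R" unfolding R_def by (intro paired_Diff P)
    have "gap_sum f ?P (smooth_kernel \<kappa> b) (smooth_weight \<kappa> b e) =
        gap_sum f R (smooth_kernel \<kappa> b) (smooth_weight \<kappa> b e)"
      unfolding R_eq
    proof (rule gap_sum_bigon[where k = k and k' = 0])
      fix x assume "x \<in> ?P" "x \<noteq> y" "x \<noteq> z"
      then have "x \<in> ?Q" unfolding P_eq by blast
      then show "smooth_kernel \<kappa> b x y = smooth_kernel \<kappa> b x z + k"
        using ky(1)[of x] kz(1)[of x] False cases by (auto simp: k_def)
    next
      fix x assume "x \<in> ?P" "x \<noteq> mate y" "x \<noteq> mate z"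
      then show "smooth_kernel \<kappa> b x (mate y) = smooth_kernel \<kappa> b x (mate z) + 0"
        using adjacentD[OF adj2(1), of x] by simp
    qed (use memb ne ne' wz in \<open>auto intro: paired_Diff P alternating_smooth_weight e skew2 odd\<close>)
    moreover have "gap_sum f ?P (smooth_kernel \<kappa>' b) (smooth_weight \<kappa>' b e) =
        gap_sum f R (smooth_kernel \<kappa>' b) (smooth_weight \<kappa>' b e)"
      unfolding R_eq
    proof (rule gap_sum_bigon[where k = k' and k' = 0])
      fix x assume "x \<in> ?P" "x \<noteq> y" "x \<noteq> z"
      then have "x \<in> ?Q" unfolding P_eq by blast
      then show "smooth_kernel \<kappa>' b x y = smooth_kernel \<kappa>' b x z + k'"
        using ky(2)[of x] kz(2)[of x] False cases by (auto simp: k'_def)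
    next
      fix x assume "x \<in> ?P" "x \<noteq> mate y" "x \<noteq> mate z"
      then show "smooth_kernel \<kappa>' b x (mate y) = smooth_kernel \<kappa>' b x (mate z) + 0"
        using adjacentD[OF adj2(2), of x] by simp
    qed (use memb ne ne' wz w' in \<open>auto intro: paired_Diff P alternating_smooth_weight e skew2 odd\<close>)
    moreover have "gap_sum f R (smooth_kernel \<kappa>' b) (smooth_weight \<kappa>' b e) =
        gap_sum f R (smooth_kernel \<kappa> b) (smooth_weight \<kappa> b e)"
      by (rule gap_sum_cong[OF R_pair]) (simp_all add: kR wQ)
    ultimately show ?thesis by (simp add: smooth_sum_def)
  next
    case True
    \<comment> \<open>For arc sign \<open>1\<close> the ends other than the third strand read
      \<open>y A z (rev B)\<close> before and \<open>A y (rev B) z\<close> after the flip.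
      Exchanging \<open>y\<close> with \<open>z\<close> and moving one letter across the base point
      (this is \<open>\<alpha>\<close>) matches them; the flip of the third strand exchanges
      \<open>mate y\<close> with \<open>mate z\<close> accordingly.\<close>
    define \<pi> where "\<pi> = (\<lambda>x. if x = y then z else if x = z then y
        else if x = mate y then mate z else if x = mate z then mate y else x)"
    define \<alpha> where "\<alpha> = (\<lambda>x. if x = y \<and> arc_sign \<kappa> b y = 1 then - 2
        else if x = z \<and> arc_sign \<kappa> b y = - 1 then 2 else 0 :: int)"
    have \<pi>: "\<pi> y = z" "\<pi> z = y" "\<pi> (mate y) = mate z" "\<pi> (mate z) = mate y"
      using ne ne' by (auto simp: \<pi>_def)
    have \<pi>R: "\<pi> x = x" if "x \<in> R" for x
      using that by (auto simp: \<pi>_def R_def)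
    have \<alpha>Q: "\<alpha> x = 0" if "x \<in> ?Q" for x using Q[OF that] by (auto simp: \<alpha>_def)
    have \<pi>Q: "\<pi> x \<in> ?Q" "arc_sign \<kappa> b (\<pi> x) = arc_sign \<kappa> b x" if "x \<in> ?Q" for x
      using that \<pi> \<pi>R[of x] s_yz by auto
    have \<pi>\<pi>: "\<pi> (\<pi> x) = x" for x using ne ne' by (auto simp: \<pi>_def)
    have "gap_sum f ?P (smooth_kernel \<kappa>' b) (smooth_weight \<kappa>' b e) =
        gap_sum f ?P (smooth_kernel \<kappa> b) (smooth_weight \<kappa> b e)"
    proof (rule gap_sum_rename[where \<alpha> = \<alpha> and \<pi> = \<pi>])
      show "inj_on \<pi> ?P" by (rule inj_on_inverseI[where g = \<pi>]) (rule \<pi>\<pi>)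
      have "\<pi> x \<in> ?P" if "x \<in> ?P" for x
        using that \<pi>Q(1)[of x] \<pi> unfolding P_eq by auto
      then show "?P = \<pi> ` ?P" using \<pi>\<pi> by (metis (no_types, lifting) image_eqI image_subsetI subsetI subset_antisym)
      show "\<pi> (mate x) = mate (\<pi> x)" if "x \<in> ?P" for x
        using ne ne' by (auto simp: \<pi>_def mate_eq_commute)
      show "smooth_weight \<kappa>' b e (\<pi> x) = smooth_weight \<kappa> b e x" if "x \<in> ?P" for x
        using that \<pi> \<pi>R wQ w' wz alternatingD[OF alternating_smooth_weight[OF e]]
        unfolding P_eq by (elim insertE) simp_all
      have main: "smooth_kernel \<kappa>' b (\<pi> v) (\<pi> x) = smooth_kernel \<kappa> b v x + \<alpha> v - \<alpha> x"
        if h: "(x = y \<and> v \<in> insert z ?Q) \<or> (x = z \<and> v \<in> ?Q) \<or> (x = mate y \<and> v = mate z) \<or>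
          (x \<in> R \<and> v \<in> ?Q)" for x v
      proof -
        consider "x = y" "v = z" | "x = y" "v \<in> ?Q" | "x = z" "v \<in> ?Q" | "x = mate y" "v = mate z"
          | "x \<in> R" "v \<in> R" | "x \<in> R" "v = mate y" | "x \<in> R" "v = mate z" using h by blast
        then show ?thesis
        proof cases
          case 1
          have "smooth_kernel \<kappa>' b y z = (if arc_sign \<kappa> b y = - 1 then - arc_sign \<kappa> b y else 1)"
            "smooth_kernel \<kappa> b z y = (if arc_sign \<kappa> b y = 1 then - 1 else arc_sign \<kappa> b y)"
            using kz(2)[of y] ky(1)[of z] True sy(2) by simp_all
          moreover have "smooth_kernel \<kappa>' b z y = - smooth_kernel \<kappa>' b y z"
            "smooth_kernel \<kappa> b y z = - smooth_kernel \<kappa> b z y"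
            by (rule skewD[OF skew2(1)] skewD[OF skew2(2)])+
          ultimately show ?thesis using cases(1) ne(5) unfolding 1 \<pi> \<alpha>_def by auto
        next
          case 2
          have "smooth_kernel \<kappa>' b (\<pi> v) z = (if arc_sign \<kappa> b y = - 1 then arc_sign \<kappa> b v else 1)"
            "smooth_kernel \<kappa> b v y = (if arc_sign \<kappa> b y = 1 then - 1 else arc_sign \<kappa> b v)"
            using kz(2)[of "\<pi> v"] ky(1)[of v] True s[of "\<pi> v"] \<pi>Q[OF 2(2)] 2(2) by simp_all
          then show ?thesis using cases(1) ne(5) unfolding 2(1) \<pi> \<alpha>Q[OF 2(2)]
            by (auto simp: \<alpha>_def)
        next
          case 3
          have "smooth_kernel \<kappa>' b (\<pi> v) y = (if arc_sign \<kappa> b y = - 1 then - 1 else arc_sign \<kappa> b v)"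
            "smooth_kernel \<kappa> b v z = (if arc_sign \<kappa> b y = 1 then arc_sign \<kappa> b v else 1)"
            using ky(2)[of "\<pi> v"] kz(1)[of v] True s[of "\<pi> v"] \<pi>Q[OF 3(2)] 3(2) by simp_all
          then show ?thesis using cases(1) ne'(9) unfolding 3(1) \<pi> \<alpha>Q[OF 3(2)]
            by (auto simp: \<alpha>_def)
        next
          case 4
          then show ?thesis using kyz \<pi> \<alpha>Q skewD[OF skew2(2), of "mate z" "mate y"] by simp
        next
          case 5
          then show ?thesis using \<pi>R \<alpha>Q kR by simp
        next
          case 6
          then have "smooth_kernel \<kappa> b x (mate y) = smooth_kernel \<kappa> b x (mate z)"
            using adjacentD[OF adj2(1), of x] by (auto simp: R_def)
          then show ?thesis using 6 \<pi> \<pi>R \<alpha>Q kR skewD[OF skew2(2), of _ x] by simp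
        next
          case 7
          then have "smooth_kernel \<kappa> b x (mate y) = smooth_kernel \<kappa> b x (mate z)"
            using adjacentD[OF adj2(1), of x] by (auto simp: R_def)
          then show ?thesis using 7 \<pi> \<pi>R \<alpha>Q kR skewD[OF skew2(2), of _ x] by simp
        qed
      qed
      fix x v assume "x \<in> ?P" "v \<in> ?P"
      then consider "(x = y \<and> v \<in> insert z ?Q) \<or> (x = z \<and> v \<in> ?Q) \<or> (x = mate y \<and> v = mate z) \<or>
          (x \<in> R \<and> v \<in> ?Q)"
        | "(v = y \<and> x \<in> insert z ?Q) \<or> (v = z \<and> x \<in> ?Q) \<or> (v = mate y \<and> x = mate z) \<or>
          (v \<in> R \<and> x \<in> ?Q)"
        | "x = v" unfolding P_eq by blast
      then show "smooth_kernel \<kappa>' b (\<pi> v) (\<pi> x) = smooth_kernel \<kappa> b v x + \<alpha> v - \<alpha> x"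
      proof cases
        case 1
        then show ?thesis by (rule main)
      next
        case 2
        then show ?thesis
          using main[of v x] skewD[OF skew2(1), of "\<pi> v" "\<pi> x"] skewD[OF skew2(2), of v x] by simp
      next
        case 3
        then show ?thesis using skew2 by simp
      qed
    qed (intro paired_Diff P alternating_smooth_weight e)+
    then show ?thesis by (simp add: smooth_sum_def)
  qed
qed

end


section \<open>Gauss words\<close>

fun before :: "'a list \<Rightarrow> 'a \<Rightarrow> 'a \<Rightarrow> bool" where
  "before [] y x \<longleftrightarrow> False"
| "before (z # w) y x \<longleftrightarrow> y = z \<and> x \<in> set w \<or> before w y x"

lemma before_set: "before w y x \<Longrightarrow> y \<in> set w \<and> x \<in> set w"
  by (induction w) auto

lemma before_notin: "y \<notin> set w \<Longrightarrow> \<not> before w y x" "x \<notin> set w \<Longrightarrow> \<not> before w y x"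
  using before_set by fast+

lemma before_append:
  "before (u @ v) y x \<longleftrightarrow> before u y x \<or> before v y x \<or> y \<in> set u \<and> x \<in> set v"
  by (induction u) auto

lemma before_rev: "before (rev w) y x \<longleftrightarrow> before w x y"
  by (induction w) (auto simp: before_append)

lemma before_asym: "distinct w \<Longrightarrow> before w y x \<Longrightarrow> \<not> before w x y"
  by (induction w) (auto dest: before_set)

lemma before_total: "x \<in> set w \<Longrightarrow> y \<in> set w \<Longrightarrow> x \<noteq> y \<Longrightarrow> before w x y \<or> before w y x"
  by (induction w) auto

lemma before_map:
  "inj_on \<pi> (set w) \<Longrightarrow> x \<in> set w \<Longrightarrow> y \<in> set w \<Longrightarrow> before (map \<pi> w) (\<pi> y) (\<pi> x) \<longleftrightarrow> before w y x"
proof (induction w)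
  case (Cons z w)
  have "before (map \<pi> w) (\<pi> y) (\<pi> x) \<longleftrightarrow> before w y x"
  proof (cases "x \<in> set w \<and> y \<in> set w")
    case True
    then show ?thesis using Cons by auto
  next
    case False
    then have "\<pi> x \<notin> \<pi> ` set w \<or> \<pi> y \<notin> \<pi> ` set w"
      using Cons.prems by (auto simp: inj_on_def)
    then show ?thesis using False before_set[of w y x] before_set[of "map \<pi> w" "\<pi> y" "\<pi> x"] by auto
  qed
  moreover have "\<pi> y = \<pi> z \<longleftrightarrow> y = z" "\<pi> x \<in> \<pi> ` set w \<longleftrightarrow> x \<in> set w"
    using Cons.prems by (auto simp: inj_on_def)
  ultimately show ?case by simp
qed simp

definition order :: "strand_end list \<Rightarrow> strand_end \<Rightarrow> strand_end \<Rightarrow> int" where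
  "order w y x = of_bool (before w y x) - of_bool (before w x y)"

lemma skew_order: "skew (order w)"
  unfolding skew_def order_def by simp

lemma order_kernel_order:
  assumes "distinct w"
  shows "order_kernel (set w) (order w)"
proof -
  have "order w y x = 1 \<or> order w y x = - 1" if "x \<in> set w" "y \<in> set w" "x \<noteq> y" for x y
    using before_total[OF that] before_asym[OF assms, of x y] before_asym[OF assms, of y x]
    by (auto simp: order_def)
  then show ?thesis using skew_order unfolding order_kernel_def by blast
qed

lemma order_eq_1: "distinct w \<Longrightarrow> before w y x \<Longrightarrow> order w y x = 1"
  using before_asym[of w y x] by (simp add: order_def)

lemma order_map:
  "inj_on \<pi> (set w) \<Longrightarrow> x \<in> set w \<Longrightarrow> y \<in> set w \<Longrightarrow> order (map \<pi> w) (\<pi> y) (\<pi> x) = order w y x"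
  by (simp add: order_def before_map)

lemma order_remove:
  assumes "y \<notin> set v" "x \<notin> set v"
  shows "order (u @ v @ w) y x = order (u @ w) y x"
proof -
  have "\<not> before v y x" "\<not> before v x y"
    using assms before_set[of v y x] before_set[of v x y] by blast+
  then show ?thesis using assms by (auto simp: order_def before_append)
qed

lemma order_swap:
  assumes "distinct (u @ [x, y] @ v)"
  shows "order (u @ [y, x] @ v) z t =
    (if z = x \<and> t = y \<or> z = y \<and> t = x then - order (u @ [x, y] @ v) z t else order (u @ [x, y] @ v) z t)"
proof -
  have n: "x \<noteq> y" "x \<notin> set u" "y \<notin> set u" "x \<notin> set v" "y \<notin> set v" using assms by simp_all
  have o: "order (u @ [x, y] @ v) x y = 1" "order (u @ [y, x] @ v) x y = - 1"
    using n by (simp_all add: order_def before_append before_notin)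
  have swap: "before (u @ [y, x] @ v) z t = before (u @ [x, y] @ v) z t"
    if "\<not> (z = x \<and> t = y)" "\<not> (z = y \<and> t = x)" for z t
  proof -
    have "before [y, x] z t \<longleftrightarrow> False" "before [x, y] z t \<longleftrightarrow> False" using that n by simp_all
    moreover have "set [y, x] = set [x, y]" by auto
    ultimately show ?thesis by (simp only: before_append set_append)
  qed
  consider "z = x" "t = y" | "z = y" "t = x" | "\<not> (z = x \<and> t = y)" "\<not> (z = y \<and> t = x)" by blast
  then show ?thesis
  proof cases
    case 1
    then show ?thesis using o by simp
  next
    case 2
    then show ?thesis
      using o skewD[OF skew_order, of "u @ [x, y] @ v" y x] skewD[OF skew_order, of "u @ [y, x] @ v" y x] by simp
  next
    case 3
    have "\<not> (t = x \<and> z = y)" "\<not> (t = y \<and> z = x)" using 3 by blast+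
    with 3 swap show ?thesis unfolding order_def by (simp only: if_False de_Morgan_disj not_False_eq_True simp_thms)
  qed
qed

lemma adjacent_order:
  assumes "distinct (u @ [x, y] @ v)"
  shows "adjacent (set (u @ [x, y] @ v)) (order (u @ [x, y] @ v)) x y"
  unfolding adjacent_def
proof (intro ballI impI)
  fix z assume z: "z \<in> set (u @ [x, y] @ v)" "z \<noteq> x" "z \<noteq> y"
  have n: "x \<noteq> y" "x \<notin> set u" "y \<notin> set u" "x \<notin> set v" "y \<notin> set v" "z \<in> set u \<Longrightarrow> z \<notin> set v"
    using assms by auto
  show "order (u @ [x, y] @ v) z x = order (u @ [x, y] @ v) z y"
    using n z by (cases "z \<in> set u") (simp_all add: order_def before_append before_notin)
qed

text \<open>The change of the label along the strand at this passage in a Cheng coloring: the strand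
  from the left passes from \<open>a\<close> to \<open>a - 1\<close>, the one from the right from
  \<open>b\<close> to \<open>b + 1\<close>.\<close>

definition weight :: "strand_end \<Rightarrow> int" where
  "weight x = (if snd x = FromLeft then - 1 else 1)"

lemma weight_mate [simp]: "weight (mate x) = - weight x"
  by (cases "snd x") (auto simp: weight_def mate_def)

lemma weight_opp: "weight (c, opp s) = - weight (d, s)"
  by (cases s) (auto simp: weight_def)

lemma alternating_weight: "alternating weight"
  unfolding alternating_def by simp

definition gauss_word :: "strand_end list \<Rightarrow> bool" where
  "gauss_word w \<longleftrightarrow> distinct w \<and> mate ` set w \<subseteq> set w"

lemma gauss_wordI: "distinct w \<Longrightarrow> paired (set w) \<Longrightarrow> gauss_word w"
  unfolding gauss_word_def paired_def by blast

lemma gauss_word_distinct: "gauss_word w \<Longrightarrow> distinct w"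
  by (simp add: gauss_word_def)

lemma gauss_word_paired: "gauss_word w \<Longrightarrow> paired (set w)"
  by (auto simp: gauss_word_def paired_def)

definition word_gap :: "strand_end list \<Rightarrow> strand_end \<Rightarrow> int" where
  "word_gap w = gap (set w) (order w) weight"

definition word_sum :: "(int \<Rightarrow> int) \<Rightarrow> strand_end list \<Rightarrow> int" where
  "word_sum f w = gap_sum f (set w) (order w) weight"

definition word_smooth_sum :: "(int \<Rightarrow> int) \<Rightarrow> strand_end list \<Rightarrow> strand_end \<Rightarrow> int" where
  "word_smooth_sum f w b = smooth_sum f (set w) (order w) weight b"

lemma
  assumes w: "gauss_word (x # w)"
  shows word_sum_rotate: "word_sum f (w @ [x]) = word_sum f (x # w)"
    and word_gap_rotate: "y \<in> set (x # w) \<Longrightarrow> word_gap (w @ [x]) y = word_gap (x # w) y"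
proof -
  \<comment> \<open>Only comparisons with the moved letter \<open>x\<close> change, from
    \<open>- 1\<close> to \<open>1\<close> or back. This has the form
    \<open>\<alpha> y - \<alpha> x\<close> with \<open>\<alpha> x = - 2\<close> and
    \<open>\<alpha>\<close> zero elsewhere.\<close>
  have o: "order (w @ [x]) y z = order (x # w) y z + (if y = x then - 2 else 0) - (if z = x then - 2 else 0)"
    if "y \<in> set (x # w)" "z \<in> set (x # w)" for y z
    using that gauss_word_distinct[OF w]
    by (auto simp: order_def before_append dest: before_set)
  note P = gauss_word_paired[OF w]
  show "word_sum f (w @ [x]) = word_sum f (x # w)"
    unfolding word_sum_def
    by (rule gap_sum_rename[where \<pi> = id, OF P alternating_weight]) (use o in auto)
  show "word_gap (w @ [x]) y = word_gap (x # w) y" if "y \<in> set (x # w)"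
    using gap_rename[where \<pi> = id and \<kappa>' = "order (w @ [x])" and \<kappa> = "order (x # w)", OF P alternating_weight _ _ _ _ that] o
    by (auto simp: word_gap_def)
qed

lemma
  assumes w: "gauss_word w" and inj: "inj_on f (fst ` set w)"
  shows word_sum_rename: "word_sum g (map (map_prod f id) w) = word_sum g w"
    and word_gap_rename: "x \<in> set w \<Longrightarrow> word_gap (map (map_prod f id) w) (map_prod f id x) = word_gap w x"
    and word_smooth_sum_rename: "x \<in> set w \<Longrightarrow>
      word_smooth_sum g (map (map_prod f id) w) (map_prod f id x) = word_smooth_sum g w x"
proof -
  let ?\<pi> = "map_prod f id :: strand_end \<Rightarrow> strand_end"
  note P = gauss_word_paired[OF w]
  have i: "inj_on ?\<pi> (set w)" using inj by (force simp: inj_on_def map_prod_def)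
  have m: "?\<pi> (mate x) = mate (?\<pi> x)" for x by (cases x) simp
  have e: "weight (?\<pi> x) = weight x" for x by (cases x) (simp add: weight_def)
  have o: "order (map ?\<pi> w) (?\<pi> y) (?\<pi> x) = order w y x" if "x \<in> set w" "y \<in> set w" for x y
    by (rule order_map[OF i that])
  show "word_sum g (map ?\<pi> w) = word_sum g w"
    unfolding word_sum_def
    by (rule gap_sum_rename[where \<pi> = ?\<pi> and \<alpha> = "\<lambda>_. 0", OF P alternating_weight i]) (simp_all add: m e o)
  show "word_gap (map ?\<pi> w) (?\<pi> x) = word_gap w x" if "x \<in> set w"
    unfolding word_gap_def set_map
    by (rule gap_rename[where \<pi> = ?\<pi> and \<alpha> = "\<lambda>_. 0", OF P alternating_weight i]) (simp_all add: m e o that)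
  show "word_smooth_sum g (map ?\<pi> w) (?\<pi> x) = word_smooth_sum g w x" if "x \<in> set w"
    unfolding word_smooth_sum_def
    by (rule smooth_sum_rename[where \<pi> = ?\<pi>, OF P alternating_weight i]) (simp_all add: m e o that)
qed

section \<open>Kinks and bigons of Gauss words\<close>

context
  fixes f :: "int \<Rightarrow> int"
  assumes odd: "\<And>m. f (- m) = - f m"
begin

text \<open>The crossing information is not part of the word: either end of the kink may be the
  overpassage, so the last claim covers both.\<close>

lemma
  assumes w: "gauss_word (a # mate a # w)"
  shows gauss_word_kink: "gauss_word w"
    and word_sum_kink: "word_sum f (a # mate a # w) = word_sum f w"
    and word_gap_kink: "x \<in> set w \<Longrightarrow> word_gap (a # mate a # w) x = word_gap w x"
    and word_smooth_sum_kink: "x \<in> set w \<Longrightarrow> word_smooth_sum f (a # mate a # w) x = word_smooth_sum f w x"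
    and word_smooth_sum_at_kink:
      "word_sum f w = 0 \<Longrightarrow> x = a \<or> x = mate a \<Longrightarrow> word_smooth_sum f (a # mate a # w) x = 0"
proof -
  let ?w = "a # mate a # w"
  note P = gauss_word_paired[OF w]
  note d = gauss_word_distinct[OF w]
  note k = order_kernel_order[OF d]
  have adj: "adjacent (set ?w) (order ?w) a (mate a)"
    using adjacent_order[of "[]" a "mate a" w] d by simp
  have set: "set ?w - {a, mate a} = set w" using d by auto
  show W: "gauss_word w"
    using d paired_Diff[OF P, of a] unfolding set by (intro gauss_wordI) simp_all
  have o: "order ?w y z = order w y z" if "y \<in> set w" "z \<in> set w" for y z
    using order_remove[of y "[a, mate a]" z "[]" w] that d by auto
  note kink = gap_sum_kink[where f = f and k = 0 and \<kappa> = "order ?w" and a = a, OF P alternating_weight skew_order odd,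
      unfolded set]
  have "word_sum f ?w = gap_sum f (set w) (order ?w) weight"
    unfolding word_sum_def by (rule kink(1)) (use adjacentD[OF adj] in auto)
  also have "\<dots> = word_sum f w"
    unfolding word_sum_def by (rule gap_sum_cong[OF gauss_word_paired[OF W]]) (simp_all add: o)
  finally show "word_sum f ?w = word_sum f w" .
  show "word_gap ?w x = word_gap w x" if x: "x \<in> set w"
  proof -
    have "word_gap ?w x = gap (set w) (order ?w) weight x"
      unfolding word_gap_def by (rule kink(2)) (use adjacentD[OF adj] x in auto)
    also have "\<dots> = word_gap w x"
      unfolding word_gap_def by (rule gap_cong[OF gauss_word_paired[OF W] x]) (simp_all add: o)
    finally show ?thesis .
  qed
  show "word_smooth_sum f ?w x = word_smooth_sum f w x" if x: "x \<in> set w"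
  proof -
    have "word_smooth_sum f ?w x = smooth_sum f (set w) (order ?w) weight x"
      unfolding word_smooth_sum_def set[symmetric]
      by (rule smooth_sum_kink[where f = f, OF P alternating_weight k odd _ adj]) (use x d in auto)
    also have "\<dots> = word_smooth_sum f w x"
      unfolding word_smooth_sum_def
      by (rule smooth_sum_cong[OF gauss_word_paired[OF W] x]) (simp_all add: o)
    finally show ?thesis .
  qed
  show "word_smooth_sum f ?w x = 0" if z: "word_sum f w = 0" and x: "x = a \<or> x = mate a"
  proof -
    have "{x, mate x} = {a, mate a}" using x by (elim disjE) (simp_all add: insert_commute)
    then have s: "set ?w - {x, mate x} = set w" using set by (simp only:)
    have "gap_sum f (set w) (order ?w) weight = word_sum f w"
      unfolding word_sum_def by (rule gap_sum_cong[OF gauss_word_paired[OF W]]) (simp_all add: o)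
    then have zero: "gap_sum f (set ?w - {x, mate x}) (order ?w) weight = 0" unfolding s using z by (simp only:)
    have adjx: "adjacent (set ?w) (order ?w) x (mate x)"
      using x adj adj[THEN adjacent_commute[THEN iffD1]] by (elim disjE) (simp_all only: mate_mate)
    have xw: "x \<in> set ?w" using x by auto
    have first: "order ?w x z = 1" if "z \<in> set ?w" "z \<noteq> x" "z \<noteq> mate x" for z
    proof (rule order_eq_1[OF d])
      show "before ?w x z" using x that by (elim disjE) simp_all
    qed
    show ?thesis unfolding word_smooth_sum_def
      by (rule smooth_sum_at_kink[where f = f, OF P k odd xw adjx first zero])
  qed
qed

text \<open>The two forms of \<open>q\<close> are the parallel and the antiparallel second move. The
  smoothings at the two new crossings are compared both at \<open>a\<close>, \<open>b\<close> and at
  their mates, since either strand may be the upper one.\<close>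

lemma
  assumes w: "gauss_word ([a, b] @ u @ q @ v)"
    and q: "q = [mate a, mate b] \<or> q = [mate b, mate a]" and ab: "weight b = - weight a"
  shows gauss_word_bigon: "gauss_word (u @ v)"
    and word_sum_bigon: "word_sum f ([a, b] @ u @ q @ v) = word_sum f (u @ v)"
    and word_gap_bigon: "x \<in> set (u @ v) \<Longrightarrow> word_gap ([a, b] @ u @ q @ v) x = word_gap (u @ v) x"
    and word_smooth_sum_bigon: "x \<in> set (u @ v) \<Longrightarrow>
      word_smooth_sum f ([a, b] @ u @ q @ v) x = word_smooth_sum f (u @ v) x"
    and word_gap_at_bigon: "word_gap ([a, b] @ u @ q @ v) a = word_gap ([a, b] @ u @ q @ v) b"
    and word_smooth_sum_at_bigon:
      "word_smooth_sum f ([a, b] @ u @ q @ v) a = word_smooth_sum f ([a, b] @ u @ q @ v) b"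
      "word_smooth_sum f ([a, b] @ u @ q @ v) (mate a) = word_smooth_sum f ([a, b] @ u @ q @ v) (mate b)"
proof -
  let ?w = "[a, b] @ u @ q @ v"
  note P = gauss_word_paired[OF w]
  note d = gauss_word_distinct[OF w]
  note k = order_kernel_order[OF d]
  have ne: "b \<noteq> a" "b \<noteq> mate a" "a \<noteq> b" "mate a \<noteq> b" "a \<noteq> mate b" using d q by (auto simp: mate_eq_commute)
  have adj: "adjacent (set ?w) (order ?w) a b"
    using adjacent_order[of "[]" a b "u @ q @ v"] d by simp
  have adj': "adjacent (set ?w) (order ?w) (mate a) (mate b)"
    using q
  proof
    assume q: "q = [mate a, mate b]"
    show ?thesis using adjacent_order[of "[a, b] @ u" "mate a" "mate b" v] d unfolding q by simp
  next
    assume q: "q = [mate b, mate a]"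
    show ?thesis using adjacent_order[of "[a, b] @ u" "mate b" "mate a" v] d unfolding q
      by (subst adjacent_commute) simp
  qed
  have set: "set ?w - {a, mate a} - {b, mate b} = set (u @ v)" using d q by auto
  have memb: "a \<in> set ?w" "b \<in> set ?w" "mate a \<in> set ?w" "mate b \<in> set ?w" using q by auto
  show W: "gauss_word (u @ v)"
    using d paired_Diff[OF paired_Diff[OF P, of a], of b] unfolding set by (intro gauss_wordI) auto
  have o: "order ?w y z = order (u @ v) y z" if y: "y \<in> set (u @ v)" and z: "z \<in> set (u @ v)" for y z
  proof -
    have "y \<notin> set [a, b]" "z \<notin> set [a, b]" "y \<notin> set q" "z \<notin> set q" using y z d by auto
    then show ?thesis
      using order_remove[of y "[a, b]" z "[]" "u @ q @ v"] order_remove[of y q z u v] by simp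
  qed
  note bigon = gap_sum_bigon[where f = f and k = 0 and k' = 0 and \<kappa> = "order ?w",
      OF P alternating_weight skew_order odd memb(1,2) ne(1,2) ab, unfolded set]
  have "word_sum f ?w = gap_sum f (set (u @ v)) (order ?w) weight"
    unfolding word_sum_def by (rule bigon(1)) (use adjacentD[OF adj] adjacentD[OF adj'] in auto)
  also have "\<dots> = word_sum f (u @ v)"
    unfolding word_sum_def by (rule gap_sum_cong[OF gauss_word_paired[OF W]]) (simp_all only: o)
  finally show "word_sum f ?w = word_sum f (u @ v)" .
  show "word_gap ?w x = word_gap (u @ v) x" if x: "x \<in> set (u @ v)"
  proof -
    have "word_gap ?w x = gap (set (u @ v)) (order ?w) weight x"
      unfolding word_gap_def by (rule bigon(2)) (use adjacentD[OF adj] adjacentD[OF adj'] x in auto)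
    also have "\<dots> = word_gap (u @ v) x"
      unfolding word_gap_def by (rule gap_cong[OF gauss_word_paired[OF W] x]) (simp_all only: o)
    finally show ?thesis .
  qed
  show "word_smooth_sum f ?w x = word_smooth_sum f (u @ v) x" if x: "x \<in> set (u @ v)"
  proof -
    have "word_smooth_sum f ?w x = smooth_sum f (set (u @ v)) (order ?w) weight x"
      unfolding word_smooth_sum_def set[symmetric]
      by (rule smooth_sum_bigon[where f = f, OF P alternating_weight k odd memb(1,2) ne(1,2) ab adj adj'])
        (use x set in auto)
    also have "\<dots> = word_smooth_sum f (u @ v) x"
      unfolding word_smooth_sum_def
      by (rule smooth_sum_cong[OF gauss_word_paired[OF W] x]) (simp_all only: o)
    finally show ?thesis .
  qed
  show "word_gap ?w a = word_gap ?w b"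
    unfolding word_gap_def by (rule bigon(3)) (use adjacentD[OF adj] adjacentD[OF adj'] in auto)
  show "word_smooth_sum f ?w a = word_smooth_sum f ?w b"
    unfolding word_smooth_sum_def
    by (rule smooth_sum_at_bigon[where f = f, OF P alternating_weight k odd memb(1,2) ne(3,5) _ adj adj']) (simp add: ab)
  show "word_smooth_sum f ?w (mate a) = word_smooth_sum f ?w (mate b)"
    unfolding word_smooth_sum_def
    by (rule smooth_sum_at_bigon[where f = f, OF P alternating_weight k odd memb(3,4) _ _ _ adj'])
      (use adj ab ne in auto)
qed

end

section \<open>Triangles of Gauss words\<close>

lemma order_ordered:
  assumes "distinct (u @ ordered d a b @ v)"
  shows "order (u @ ordered d a b @ v) a b = (if d then 1 else - 1)"
proof -
  have "a \<noteq> b" "a \<notin> set u" "b \<notin> set u" "a \<notin> set v" "b \<notin> set v"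
    using assms by (auto simp: ordered_def split: if_splits)
  then show ?thesis by (cases d) (simp_all add: ordered_def order_def before_append before_notin)
qed

lemma order_rev_ordered:
  assumes "distinct (u @ ordered d a b @ v)"
  shows "order (u @ rev (ordered d a b) @ v) z t =
    (if z = a \<and> t = b \<or> z = b \<and> t = a then - order (u @ ordered d a b @ v) z t
     else order (u @ ordered d a b @ v) z t)"
proof (cases d)
  case True
  then show ?thesis using order_swap[of u a b v z t] assms by (simp add: ordered_def)
next
  case False
  have "(z = a \<and> t = b \<or> z = b \<and> t = a) \<longleftrightarrow> (z = b \<and> t = a \<or> z = a \<and> t = b)" by blast
  then show ?thesis using False order_swap[of u b a v z t] assms by (simp only: ordered_def if_False rev.simps append.simps)
qed

lemma adjacent_ordered:
  assumes "distinct (u @ ordered d a b @ v)"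
  shows "adjacent (set (u @ ordered d a b @ v)) (order (u @ ordered d a b @ v)) a b"
proof (cases d)
  case True
  then show ?thesis using adjacent_order[of u a b v] assms by (simp add: ordered_def)
next
  case False
  then have "adjacent (set (u @ ordered d a b @ v)) (order (u @ ordered d a b @ v)) b a"
    using adjacent_order[of u b a v] assms by (simp add: ordered_def)
  then show ?thesis by (simp only: adjacent_commute)
qed


text \<open>The three strands carry \<open>a\<close>, \<open>b\<close>, then \<open>mate a\<close>,
  \<open>c\<close>, then \<open>mate b\<close>, \<open>mate c\<close>. The three equations in
  \<open>balance\<close> are the condition of \<open>triangle_flip\<close> at the corners of
  \<open>a\<close>, \<open>b\<close> and \<open>c\<close>.\<close>

lemma
  assumes w: "gauss_word w" and w': "set w' = set w"
    and six: "distinct [a, b, mate a, c, mate b, mate c]" "{a, b, c} \<subseteq> set w"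
    and \<kappa>': "\<And>y z. order w' y z =
      (if {y, z} = {a, b} \<or> {y, z} = {mate a, c} \<or> {y, z} = {mate b, mate c} then - order w y z else order w y z)"
    and adj: "adjacent (set w) (order w) a b" "adjacent (set w) (order w) (mate a) c"
      "adjacent (set w) (order w) (mate b) (mate c)"
    and balance: "order w a b * weight b = order w (mate a) c * weight c"
      "order w a b * weight a = order w (mate b) (mate c) * weight c"
      "order w (mate a) c * weight a = order w (mate b) (mate c) * weight b"
  shows word_sum_triangle: "word_sum f w' = word_sum f w"
    and word_gap_triangle: "x \<in> set w \<Longrightarrow> word_gap w' x = word_gap w x"
    and word_smooth_sum_triangle:
      "(\<And>m. f (- m) = - f m) \<Longrightarrow> x \<in> set w \<Longrightarrow> word_smooth_sum f w' x = word_smooth_sum f w x"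
proof -
  define \<mu> where "\<mu> = (\<lambda>x. if x = a then b else if x = b then a else if x = mate a then c
    else if x = c then mate a else if x = mate b then mate c else mate b)"
  define T where "T = {a, b, mate a, c, mate b, mate c}"
  have \<mu>: "\<mu> a = b" "\<mu> b = a" "\<mu> (mate a) = c" "\<mu> c = mate a" "\<mu> (mate b) = mate c" "\<mu> (mate c) = mate b"
    using six(1) by (auto simp: \<mu>_def)
  have ne: "a \<noteq> b" "a \<noteq> c" "b \<noteq> c" "mate a \<noteq> b" "mate a \<noteq> c" "mate b \<noteq> c" "b \<noteq> a" "c \<noteq> a" "c \<noteq> b"
     "a \<noteq> mate b" "a \<noteq> mate c" "b \<noteq> mate c" "b \<noteq> mate a" "c \<noteq> mate a" "c \<noteq> mate b" "mate c \<noteq> a" "mate c \<noteq> b" "mate b \<noteq> a"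
    using six(1) by (auto simp: mate_eq_commute)
  have all: "Q x" if "x \<in> T" "Q a" "Q b" "Q (mate a)" "Q c" "Q (mate b)" "Q (mate c)" for Q x
    using that unfolding T_def by auto
  note sk = skewD[OF skew_order, of w]
  interpret triangle_flip "set w" "order w" "order w'" weight T \<mu>
  proof
    show "paired (set w)" by (rule gauss_word_paired[OF w])
    show "order_kernel (set w) (order w)" by (rule order_kernel_order[OF gauss_word_distinct[OF w]])
    show "skew (order w')" by (rule skew_order)
    show "alternating weight" by (rule alternating_weight)
    fix x assume x: "x \<in> T"
    show "x \<in> set w"
      by (rule all[OF x]) (use six(2) gauss_word_paired[OF w] in \<open>simp_all add: paired_mate\<close>)
    show "mate x \<in> T" by (rule all[OF x]) (simp_all add: T_def)
    show "\<mu> x \<in> T" by (rule all[OF x]) (simp_all add: T_def \<mu>)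
    show "\<mu> (\<mu> x) = x" by (rule all[OF x]) (simp_all add: \<mu>)
    show "\<mu> x \<noteq> x" by (rule all[OF x]) (simp_all add: \<mu> ne)
    show "\<mu> x \<noteq> mate x" by (rule all[OF x]) (simp_all add: \<mu> ne)
    show "\<mu> (mate (\<mu> x)) = mate (\<mu> (mate x))" by (rule all[OF x]) (simp_all add: \<mu>)
    show "T = {x, mate x, \<mu> x, mate (\<mu> x), \<mu> (mate x), mate (\<mu> (mate x))}"
      by (rule all[OF x]; simp only: \<mu> T_def mate_mate; blast)
    show "adjacent (set w) (order w) (\<mu> x) x"
      by (rule all[OF x]) (use adj adj[THEN adjacent_commute[THEN iffD1]] in \<open>simp_all only: \<mu>\<close>)
    show "order w (\<mu> x) x * weight (\<mu> x) = order w (\<mu> (mate x)) (mate x) * weight (\<mu> (mate x))"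
      by (rule all[OF x])
        (use balance sk[of a b] sk[of "mate a" c] sk[of "mate b" "mate c"] in \<open>simp_all add: \<mu>\<close>)
  next
    fix x y
    have "x \<in> T \<and> y = \<mu> x \<longleftrightarrow> {y, x} = {a, b} \<or> {y, x} = {mate a, c} \<or> {y, x} = {mate b, mate c}"
      unfolding T_def doubleton_eq_iff using \<mu> by (auto simp del: mate_eq_iff)
    then show "order w' y x = (if x \<in> T \<and> y = \<mu> x then - order w y x else order w y x)"
      by (simp only: \<kappa>')
  qed
  show "word_sum f w' = word_sum f w"
    unfolding word_sum_def w' by (rule gap_sum_eq)
  show "word_gap w' x = word_gap w x" if "x \<in> set w"
    unfolding word_gap_def w' by (rule gap_eq[OF that])
  show "word_smooth_sum f w' x = word_smooth_sum f w x" if "\<And>m. f (- m) = - f m" "x \<in> set w"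
    unfolding word_smooth_sum_def w'
    using smooth_sum_inside[where f = f, OF that(1)] smooth_sum_outside[OF that(2)] by (cases "x \<in> T") auto
qed

text \<open>The three pieces are reversed one after the other, and each reversal only changes the
  sign of the kernel at the two letters of that piece.\<close>

lemma
  assumes w: "gauss_word w" and p: "p = ordered dp a b" and q: "q = ordered dq (mate a) c"
    and r: "r = ordered dr (mate b) (mate c)"
    and ww': "(w, w') = (p @ t @ q @ u @ r @ v, rev p @ t @ rev q @ u @ rev r @ v) \<or>
      (w, w') = (p @ t @ r @ u @ q @ v, rev p @ t @ rev r @ u @ rev q @ v)"
    and balance: "(if dp then weight b else - weight b) = (if dq then weight c else - weight c)"
      "(if dp then weight a else - weight a) = (if dr then weight c else - weight c)"
      "(if dq then weight a else - weight a) = (if dr then weight b else - weight b)"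
  shows set_third: "set w' = set w"
    and word_sum_third: "word_sum f w' = word_sum f w"
    and word_gap_third: "x \<in> set w \<Longrightarrow> word_gap w' x = word_gap w x"
    and word_smooth_sum_third:
      "(\<And>m. f (- m) = - f m) \<Longrightarrow> x \<in> set w \<Longrightarrow> word_smooth_sum f w' x = word_smooth_sum f w x"
proof -
  have pqr: "set p = {a, b}" "set q = {mate a, c}" "set r = {mate b, mate c}"
    unfolding p q r by (auto simp: ordered_def)
  note d = gauss_word_distinct[OF w]
  have dist: "distinct p" "distinct q" "distinct r" "set p \<inter> set q = {}" "set p \<inter> set r = {}" "set q \<inter> set r = {}"
    using ww' d by auto
  have "distinct [a, b]" "distinct [mate a, c]" using dist(1,2) unfolding p q ordered_def by (auto split: if_splits)
  then have six: "distinct [a, b, mate a, c, mate b, mate c]"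
    using dist(4-6) unfolding pqr by auto
  show set: "set w' = set w" using ww' by auto
  have sub: "{a, b, c} \<subseteq> set w" using ww' pqr by auto
  have pair: "(y = z' \<and> z = t' \<or> y = t' \<and> z = z') \<longleftrightarrow> {y, z} = {z', t'}" for y z z' t' :: strand_end
    by (auto simp: doubleton_eq_iff)
  have disj: "{mate a, c} \<noteq> {a, b}" "{mate b, mate c} \<noteq> {a, b}" "{mate b, mate c} \<noteq> {mate a, c}"
    using six by (auto simp: doubleton_eq_iff)
  let ?f = "\<lambda>P y z. if {y, z} = P then - 1 else 1 :: int"
  \<comment> \<open>The three pairs are different, so at most one of the three factors is
    \<open>- 1\<close>.\<close>
  have comb: "?f P1 y z * (?f P2 y z * (?f P3 y z * k)) = (if {y, z} = P1 \<or> {y, z} = P2 \<or> {y, z} = P3 then - k else k)"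
    if "P1 \<noteq> P2" "P1 \<noteq> P3" "P2 \<noteq> P3" for P1 P2 P3 y z k
    using that by auto
  have flip: "order (u @ rev (ordered d a' b') @ v) z t = ?f {a', b'} z t * order (u @ ordered d a' b' @ v) z t"
    if "distinct (u @ ordered d a' b' @ v)" for u d a' b' v z t
    using order_rev_ordered[OF that] unfolding pair by simp
  have facts: "(\<forall>y z. order w' y z =
      (if {y, z} = {a, b} \<or> {y, z} = {mate a, c} \<or> {y, z} = {mate b, mate c} then - order w y z else order w y z)) \<and>
    adjacent (set w) (order w) a b \<and> adjacent (set w) (order w) (mate a) c \<and>
    adjacent (set w) (order w) (mate b) (mate c) \<and> order w a b = (if dp then 1 else - 1) \<and>
    order w (mate a) c = (if dq then 1 else - 1) \<and> order w (mate b) (mate c) = (if dr then 1 else - 1)"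
    using ww'
  proof
    assume eq: "(w, w') = (p @ t @ q @ u @ r @ v, rev p @ t @ rev q @ u @ rev r @ v)"
    then have w_eq: "w = p @ t @ q @ u @ r @ v" by simp
    have "order w' y z = ?f {mate b, mate c} y z * (?f {mate a, c} y z * (?f {a, b} y z * order w y z))" for y z
      using flip[of "[]" dp a b "t @ q @ u @ r @ v" y z, folded p]
        flip[of "rev p @ t" dq "mate a" c "u @ r @ v" y z, folded q]
        flip[of "rev p @ t @ rev q @ u" dr "mate b" "mate c" v y z, folded r] d eq by auto
    then have "order w' y z = (if {y, z} = {a, b} \<or> {y, z} = {mate a, c} \<or> {y, z} = {mate b, mate c}
        then - order w y z else order w y z)" for y z
      using comb[of "{mate b, mate c}" "{mate a, c}" "{a, b}" y z] disj by auto
    then show ?thesis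
      using adjacent_ordered[of "[]" dp a b "t @ q @ u @ r @ v", folded p]
        adjacent_ordered[of "p @ t" dq "mate a" c "u @ r @ v", folded q]
        adjacent_ordered[of "p @ t @ q @ u" dr "mate b" "mate c" v, folded r]
        order_ordered[of "[]" dp a b "t @ q @ u @ r @ v", folded p]
        order_ordered[of "p @ t" dq "mate a" c "u @ r @ v", folded q]
        order_ordered[of "p @ t @ q @ u" dr "mate b" "mate c" v, folded r] d
      by (simp add: w_eq)
  next
    assume eq: "(w, w') = (p @ t @ r @ u @ q @ v, rev p @ t @ rev r @ u @ rev q @ v)"
    then have w_eq: "w = p @ t @ r @ u @ q @ v" by simp
    have "order w' y z = ?f {mate a, c} y z * (?f {mate b, mate c} y z * (?f {a, b} y z * order w y z))" for y z
      using flip[of "[]" dp a b "t @ r @ u @ q @ v" y z, folded p]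
        flip[of "rev p @ t" dr "mate b" "mate c" "u @ q @ v" y z, folded r]
        flip[of "rev p @ t @ rev r @ u" dq "mate a" c v y z, folded q] d eq by auto
    then have "order w' y z = (if {y, z} = {a, b} \<or> {y, z} = {mate a, c} \<or> {y, z} = {mate b, mate c}
        then - order w y z else order w y z)" for y z
      using comb[of "{mate a, c}" "{mate b, mate c}" "{a, b}" y z] disj by auto
    then show ?thesis
      using adjacent_ordered[of "[]" dp a b "t @ r @ u @ q @ v", folded p]
        adjacent_ordered[of "p @ t" dr "mate b" "mate c" "u @ q @ v", folded r]
        adjacent_ordered[of "p @ t @ r @ u" dq "mate a" c v, folded q]
        order_ordered[of "[]" dp a b "t @ r @ u @ q @ v", folded p]
        order_ordered[of "p @ t" dr "mate b" "mate c" "u @ q @ v", folded r]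
        order_ordered[of "p @ t @ r @ u" dq "mate a" c v, folded q] d
      by (simp add: w_eq)
  qed
  have \<kappa>': "order w' y z = (if {y, z} = {a, b} \<or> {y, z} = {mate a, c} \<or> {y, z} = {mate b, mate c}
      then - order w y z else order w y z)" for y z
    using facts by blast
  have adj: "adjacent (set w) (order w) a b" "adjacent (set w) (order w) (mate a) c"
      "adjacent (set w) (order w) (mate b) (mate c)" using facts by blast+
  have bal: "order w a b * weight b = order w (mate a) c * weight c"
      "order w a b * weight a = order w (mate b) (mate c) * weight c"
      "order w (mate a) c * weight a = order w (mate b) (mate c) * weight b"
    using facts balance by (auto split: if_splits)
  note tri = w set six sub \<kappa>' adj bal
  show "word_sum f w' = word_sum f w" by (rule word_sum_triangle[OF tri])
  show "word_gap w' x = word_gap w x" if "x \<in> set w" by (rule word_gap_triangle[OF tri that])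
  show "word_smooth_sum f w' x = word_smooth_sum f w x" if "\<And>m. f (- m) = - f m" "x \<in> set w"
    by (rule word_smooth_sum_triangle[where f = f, OF tri that])
qed


section \<open>Words of diagrams\<close>

definition passage_end :: "'k passage \<Rightarrow> strand_end" where
  "passage_end p = (crossing p, side p)"

text \<open>\<open>valid_code\<close> without positions: a property of the multiset of passages, and
  therefore stable under the reorderings made by moves and smoothings.\<close>

definition paired_code :: "('k \<times> 'k) set \<Rightarrow> 'k code \<Rightarrow> bool" where
  "paired_code X D \<longleftrightarrow> distinct (map passage_end D) \<and>
    (\<forall>p \<in> set D. \<exists>k'. Passage (crossing p) (opp (side p)) k' \<in> set D \<and> (kind p, k') \<in> X)"

lemma paired_code_partner:
  "paired_code X D \<Longrightarrow> p \<in> set D \<Longrightarrow>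
    \<exists>k'. Passage (crossing p) (opp (side p)) k' \<in> set D \<and> (kind p, k') \<in> X"
  by (simp add: paired_code_def)

lemma paired_code_unique:
  assumes "paired_code X D" "Passage c s k \<in> set D" "Passage c s k' \<in> set D"
  shows "k = k'"
proof -
  have "inj_on passage_end (set D)" using assms(1) by (simp add: paired_code_def distinct_map)
  from inj_onD[OF this _ assms(2,3)] show ?thesis by (simp add: passage_end_def)
qed

lemma paired_code_distinct: "paired_code X D \<Longrightarrow> distinct D"
  by (simp add: paired_code_def distinct_map)

lemma valid_code_paired:
  assumes valid: "valid_code X D" and sym: "sym X"
  shows "paired_code X D"
proof -
  have two: "\<exists>i j. i < length D \<and> j < length D \<and> {k. k < length D \<and> crossing (D ! k) = c} = {i, j} \<and>
      side (D ! i) = FromLeft \<and> side (D ! j) = FromRight \<and> (kind (D ! i), kind (D ! j)) \<in> X"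
    if c: "c \<in> crossing ` set D" for c
  proof -
    obtain i j where ij: "{k. k < length D \<and> crossing (D ! k) = c} = {i, j}"
       "side (D ! i) = FromLeft" "side (D ! j) = FromRight" "(kind (D ! i), kind (D ! j)) \<in> X"
      using bspec[OF valid[unfolded valid_code_def] c] by blast
    have "i \<in> {k. k < length D \<and> crossing (D ! k) = c}" "j \<in> {k. k < length D \<and> crossing (D ! k) = c}"
      unfolding ij(1) by simp_all
    then show ?thesis using ij by blast
  qed
  have "distinct (map passage_end D)"
    unfolding distinct_conv_nth
  proof (intro allI impI)
    fix k l assume kl: "k < length (map passage_end D)" "l < length (map passage_end D)" "k \<noteq> l"
    obtain i j where ij: "{m. m < length D \<and> crossing (D ! m) = crossing (D ! k)} = {i, j}"
       "side (D ! i) = FromLeft" "side (D ! j) = FromRight"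
      using two[of "crossing (D ! k)"] kl by auto
    have "k \<in> {i, j}" using ij(1) kl by auto
    moreover have "l \<in> {i, j}" if "crossing (D ! l) = crossing (D ! k)" using ij(1) kl that by auto
    ultimately show "map passage_end D ! k \<noteq> map passage_end D ! l"
      using kl ij(2,3) by (auto simp: passage_end_def)
  qed
  moreover have "\<exists>k'. Passage (crossing p) (opp (side p)) k' \<in> set D \<and> (kind p, k') \<in> X"
    if p: "p \<in> set D" for p
  proof -
    obtain k where k: "k < length D" "p = D ! k" using p by (metis in_set_conv_nth)
    obtain i j where ij: "i < length D" "j < length D"
       "{m. m < length D \<and> crossing (D ! m) = crossing p} = {i, j}"
       "side (D ! i) = FromLeft" "side (D ! j) = FromRight" "(kind (D ! i), kind (D ! j)) \<in> X"
      using two[of "crossing p"] p by auto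
    have c: "crossing (D ! i) = crossing p" "crossing (D ! j) = crossing p" using ij(3) by auto
    have "k = i \<or> k = j" using k ij(3) by auto
    then show ?thesis
    proof
      assume "k = i"
      moreover have "D ! j = Passage (crossing p) FromRight (kind (D ! j))"
        using c ij(5) by (cases "D ! j") simp
      ultimately show ?thesis using k ij nth_mem[OF ij(2)] by (intro exI[of _ "kind (D ! j)"]) simp
    next
      assume "k = j"
      moreover have "D ! i = Passage (crossing p) FromLeft (kind (D ! i))"
        using c ij(4) by (cases "D ! i") simp
      ultimately show ?thesis using k ij nth_mem[OF ij(1)] symD[OF sym ij(6)]
        by (intro exI[of _ "kind (D ! i)"]) simp
    qed
  qed
  ultimately show ?thesis by (simp add: paired_code_def)
qed

lemma paired_code_cong:
  "mset D = mset D' \<Longrightarrow> paired_code X D \<longleftrightarrow> paired_code X D'"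
proof -
  assume *: "mset D = mset D'"
  then have "mset (map passage_end D) = mset (map passage_end D')" by simp
  then have "distinct (map passage_end D) \<longleftrightarrow> distinct (map passage_end D')"
    by (rule mset_eq_imp_distinct_iff)
  then show ?thesis using mset_eq_setD[OF *] by (simp add: paired_code_def)
qed

text \<open>\<open>V\<close> is the decoration of virtual double points. As a parameter it lets one
  argument serve virtual and flat diagrams.\<close>

definition word :: "'k \<Rightarrow> 'k code \<Rightarrow> strand_end list" where
  "word V D = map passage_end (filter (\<lambda>p. kind p \<noteq> V) D)"

lemma word_append [simp]: "word V (u @ v) = word V u @ word V v"
  by (simp add: word_def)

lemma word_Nil [simp]: "word V [] = []"
  by (simp add: word_def)

lemma word_Cons [simp]: "word V (p # u) = (if kind p = V then word V u else passage_end p # word V u)"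
  by (simp add: word_def)

lemma word_rev [simp]: "word V (rev u) = rev (word V u)"
  by (simp add: word_def rev_map rev_filter)

lemma mem_word: "(c, s) \<in> set (word V D) \<longleftrightarrow> (\<exists>k. k \<noteq> V \<and> Passage c s k \<in> set D)"
proof
  assume "(c, s) \<in> set (word V D)"
  then obtain p where "p \<in> set D" "kind p \<noteq> V" "passage_end p = (c, s)"
    by (auto simp: word_def)
  then show "\<exists>k. k \<noteq> V \<and> Passage c s k \<in> set D"
    by (cases p) (auto simp: passage_end_def)
next
  assume "\<exists>k. k \<noteq> V \<and> Passage c s k \<in> set D"
  then show "(c, s) \<in> set (word V D)" by (force simp: word_def passage_end_def)
qed

text \<open>Guarantees that the two passages of a double point are both kept or both dropped in the
  word.\<close>

definition separates :: "'k \<Rightarrow> ('k \<times> 'k) set \<Rightarrow> bool" where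
  "separates V X \<longleftrightarrow> sym X \<and> (\<forall>(k, k') \<in> X. k = V \<longleftrightarrow> k' = V)"

lemma separatesD: "separates V X \<Longrightarrow> (k, k') \<in> X \<Longrightarrow> k = V \<longleftrightarrow> k' = V"
  by (auto simp: separates_def)

lemma gauss_word_word:
  assumes D: "paired_code X D" and V: "separates V X"
  shows "gauss_word (word V D)"
  unfolding gauss_word_def
proof
  show "distinct (word V D)"
    using D unfolding word_def paired_code_def by (simp add: distinct_map_filter)
  show "mate ` set (word V D) \<subseteq> set (word V D)"
  proof
    fix x assume "x \<in> mate ` set (word V D)"
    then obtain c s where x: "(c, s) \<in> set (word V D)" "x = (c, opp s)" by auto
    then obtain k where k: "k \<noteq> V" "Passage c s k \<in> set D" by (auto simp: mem_word)
    obtain k' where "Passage c (opp s) k' \<in> set D" "(k, k') \<in> X"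
      using paired_code_partner[OF D k(2)] by auto
    then show "x \<in> set (word V D)" using separatesD[OF V] k x by (auto simp: mem_word)
  qed
qed

section \<open>Labels, indices and writhes from the word\<close>

lemma height_append_Cons:
  assumes "gauss_word (u @ x # v)"
  shows "height (set (u @ x # v)) (order (u @ x # v)) weight x = 2 * sum_list (map weight u) + weight x"
proof -
  let ?w = "u @ x # v"
  have d: "distinct ?w" using assms by (rule gauss_word_distinct)
  have s: "(\<Sum>y\<in>set ?w. F y) = (\<Sum>y\<in>set u. F y) + F x + (\<Sum>y\<in>set v. F y)" for F :: "strand_end \<Rightarrow> int"
    using d by (simp add: sum.union_disjoint sum.insert_remove)
  have 1: "(\<Sum>y\<in>set u. order ?w y x * weight y) = (\<Sum>y\<in>set u. weight y)"
    by (rule sum.cong) (use d in \<open>auto simp: order_eq_1 before_append\<close>)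
  have "order ?w y x = - 1" if "y \<in> set v" for y
    using skewD[OF skew_order, of ?w y x] order_eq_1[OF d, of x y] that by (simp add: before_append)
  then have 2: "(\<Sum>y\<in>set v. order ?w y x * weight y) = - (\<Sum>y\<in>set v. weight y)"
    by (simp add: sum_negf)
  have "(\<Sum>y\<in>set ?w. weight y) = 0"
    by (rule sum_alternating[OF gauss_word_paired[OF assms] alternating_weight])
  then have "(\<Sum>y\<in>set u. weight y) + weight x + (\<Sum>y\<in>set v. weight y) = 0" unfolding s .
  moreover have "(\<Sum>y\<in>set u. weight y) = sum_list (map weight u)"
    using d by (simp add: sum_list_distinct_conv_sum_set)
  ultimately show ?thesis
    unfolding height_def s 1 2 using skew_diag[OF skew_order, of ?w x] by simp
qed

text \<open>\<open>FromRight\<close> is also the default for names without an overpassage; at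
  classical crossings the value is justified by \<open>over_under\<close>.\<close>

definition over_side :: "vkind code \<Rightarrow> nat \<Rightarrow> side" where
  "over_side D c = (if Passage c FromLeft Over \<in> set D then FromLeft else FromRight)"

definition over_end :: "vkind code \<Rightarrow> nat \<Rightarrow> strand_end" where
  "over_end D c = (c, over_side D c)"

lemma fst_over_end [simp]: "fst (over_end D c) = c"
  by (simp add: over_end_def)

lemma sgn_crossing_weight: "sgn_crossing D c = - weight (over_end D c)"
  by (simp add: sgn_crossing_def over_end_def over_side_def weight_def)

lemma classical_word: "classical D = fst ` set (word Virtual D)"
  by (force simp: classical_def word_def passage_end_def)

lemma finite_classical [simp]: "finite (classical D)"
  by (simp add: classical_word)

lemma separates_virtual: "separates Virtual virtual_pairs"
  by (auto simp: separates_def virtual_pairs_def sym_def)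

lemma separates_flat: "separates FlatVirtual flat_pairs"
  by (auto simp: separates_def flat_pairs_def sym_def)

abbreviation virtual_code :: "vkind code \<Rightarrow> bool" where
  "virtual_code \<equiv> paired_code virtual_pairs"

lemma over_under:
  assumes D: "virtual_code D" and c: "c \<in> classical D"
  shows "Passage c (over_side D c) Over \<in> set D" "Passage c (opp (over_side D c)) Under \<in> set D"
proof -
  obtain s k where k: "Passage c s k \<in> set D" "k \<noteq> Virtual"
    using c by (auto simp: classical_word mem_word)
  then obtain k' where k': "Passage c (opp s) k' \<in> set D" "(k, k') \<in> virtual_pairs"
    using paired_code_partner[OF D k(1)] by auto
  have "(Passage c FromLeft Over \<in> set D \<and> Passage c FromRight Under \<in> set D) \<or>
      (Passage c FromLeft Under \<in> set D \<and> Passage c FromRight Over \<in> set D)"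
    using k k' by (cases s) (auto simp: virtual_pairs_def)
  then show "Passage c (over_side D c) Over \<in> set D" "Passage c (opp (over_side D c)) Under \<in> set D"
    using paired_code_unique[OF D, of c FromLeft Over Under] by (auto simp: over_side_def)
qed

lemma over_end_mem:
  assumes "virtual_code D" "c \<in> classical D"
  shows "over_end D c \<in> set (word Virtual D)" "mate (over_end D c) \<in> set (word Virtual D)"
  using over_under[OF assms] by (auto simp: over_end_def mem_word)

lemma over_iff:
  assumes D: "virtual_code D" and p: "Passage c s k \<in> set D" and k: "k \<noteq> Virtual"
  shows "k = Over \<longleftrightarrow> s = over_side D c" "k = Under \<longleftrightarrow> s = opp (over_side D c)" "c \<in> classical D"
proof -
  show c: "c \<in> classical D" 
  proof -
    have "(c, s) \<in> set (word Virtual D)" using p k by (auto simp: mem_word)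
    then show ?thesis unfolding classical_word by force
  qed
  have "s = over_side D c \<or> s = opp (over_side D c)" by (cases s; cases "over_side D c") auto
  then show "k = Over \<longleftrightarrow> s = over_side D c" "k = Under \<longleftrightarrow> s = opp (over_side D c)"
    using over_under[OF D c] p paired_code_unique[OF D] by auto
qed

lemma first_over_Cons:
  "first_over (p # w) = (if kind p = Over then {crossing p} else {}) \<union> (first_over w - {crossing p})"
proof (rule set_eqI)
  fix c
  have "c \<in> first_over (p # w) \<longleftrightarrow> (\<exists>i < Suc (length w). crossing ((p # w) ! i) = c \<and> kind ((p # w) ! i) = Over \<and>
          (\<forall>j < i. crossing ((p # w) ! j) \<noteq> c))" by (simp add: first_over_def)
  also have "\<dots> \<longleftrightarrow> (crossing p = c \<and> kind p = Over) \<or> (\<exists>i < length w. crossing (w ! i) = c \<and> kind (w ! i) = Over \<and>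
          crossing p \<noteq> c \<and> (\<forall>j < i. crossing (w ! j) \<noteq> c))"
    by (auto simp: Ex_less_Suc2 All_less_Suc2)
  finally show "c \<in> first_over (p # w) \<longleftrightarrow>
      c \<in> (if kind p = Over then {crossing p} else {}) \<union> (first_over w - {crossing p})"
    by (auto simp: first_over_def)
qed

lemma first_over_Nil [simp]: "first_over [] = {}"
  by (simp add: first_over_def)

lemma first_over_subset: "first_over w \<subseteq> crossing ` set w"
  by (auto simp: first_over_def)

lemma first_over_append:
  "first_over (u @ v) = first_over u \<union> (first_over v - crossing ` set u)"
  by (induction u) (auto simp: first_over_Cons)

lemma first_over_iff:
  assumes "\<And>p. p \<in> set w \<Longrightarrow> crossing p = c \<Longrightarrow> p = q"
  shows "c \<in> first_over w \<longleftrightarrow> q \<in> set w \<and> crossing q = c \<and> kind q = Over"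
  using assms
proof (induction w)
  case (Cons p w)
  then have IH: "c \<in> first_over w \<longleftrightarrow> q \<in> set w \<and> crossing q = c \<and> kind q = Over" by simp
  show ?case
  proof (cases "crossing p = c")
    case True
    then have "p = q" using Cons.prems by simp
    then show ?thesis using True by (simp add: first_over_Cons)
  next
    case False
    then show ?thesis using IH by (auto simp: first_over_Cons)
  qed
qed simp

text \<open>Passing an overcrossing removes it from the crossings first met as overcrossings;
  passing an undercrossing adds it. By the sign convention both change the label by the weight of
  the passage: this is the Cheng rule.\<close>

lemma lam_rotate1:
  assumes D: "virtual_code (p # w)"
  shows "lam (w @ [p]) = lam (p # w) + sum_list (map weight (word Virtual [p]))"
proof -
  define c where "c = crossing p"
  have sgn: "sgn_crossing (w @ [p]) = sgn_crossing (p # w)" by (rule ext) (simp add: sgn_crossing_def)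
  have fin: "finite (first_over w)"
    by (rule finite_subset[OF first_over_subset]) simp
  obtain k' where k': "Passage c (opp (side p)) k' \<in> set (p # w)" "(kind p, k') \<in> virtual_pairs"
    using paired_code_partner[OF D, of p] by (auto simp: c_def)
  define q where "q = Passage c (opp (side p)) k'"
  have q: "q \<in> set w" "crossing q = c" "kind q = k'" "side q = opp (side p)"
  proof -
    have "side q \<noteq> side p" by (simp add: q_def)
    then have "q \<noteq> p" by blast
    then show "q \<in> set w" using k'(1) unfolding q_def[symmetric] by simp
  qed (simp_all add: q_def)
  have uniq: "r = q" if "r \<in> set w" "crossing r = c" for r
  proof -
    have "side r = side p \<or> side r = opp (side p)" by (cases "side r"; cases "side p") auto
    moreover have "side r \<noteq> side p"
    proof
      assume "side r = side p"
      then have "passage_end r = passage_end p" using that by (simp add: passage_end_def c_def)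
      moreover have "passage_end p \<notin> passage_end ` set w" using D by (simp add: paired_code_def)
      ultimately show False using that(1) by (metis imageI)
    qed
    ultimately have "side r = opp (side p)" by simp
    then have r: "Passage c (opp (side p)) (kind r) = r" using that by (cases r) simp
    then have "kind r = k'"
      using paired_code_unique[OF D _ k'(1), of "kind r"] that(1) by simp
    then show ?thesis using r by (simp add: q_def)
  qed
  \<comment> \<open>Once \<open>p\<close> has moved to the end, the crossing is first met at its
    other passage \<open>q\<close>.\<close>
  have c_iff: "c \<in> first_over w \<longleftrightarrow> k' = Over"
    using first_over_iff[of w c q, OF uniq] q by simp
  have snoc: "first_over (w @ [p]) = first_over w"
  proof -
    have "crossing p \<in> crossing ` set w" using q(1,2) by (metis c_def imageI)
    then show ?thesis by (auto simp: first_over_append first_over_Cons)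
  qed
  have p_mem: "Passage c (side p) (kind p) \<in> set (p # w)" by (simp add: c_def)
  note side = over_iff[OF D p_mem]
  have pe: "passage_end p = (c, side p)" by (simp add: passage_end_def c_def)
  show ?thesis
  proof (cases "kind p")
    case Over
    then have "k' = Under" using k'(2) by (auto simp: virtual_pairs_def)
    then have "c \<notin> first_over w" using c_iff by simp
    moreover have "sgn_crossing (p # w) c = - weight (c, side p)"
      using side(1) Over by (simp add: sgn_crossing_weight over_end_def)
    ultimately show ?thesis unfolding lam_def snoc sgn using fin Over
      by (simp add: first_over_Cons c_def[symmetric] pe)
  next
    case Under
    then have "k' = Over" using k'(2) by (auto simp: virtual_pairs_def)
    then have "c \<in> first_over w" using c_iff by simp
    moreover have "sgn_crossing (p # w) c = weight (c, side p)"
      using side(2) Under weight_opp[of c "over_side (p # w) c" c] by (simp add: sgn_crossing_weight over_end_def)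
    ultimately show ?thesis unfolding lam_def snoc sgn using fin Under
      by (simp add: first_over_Cons c_def[symmetric] pe sum_diff1)
  next
    case Virtual
    then have "c \<notin> first_over w" using c_iff k'(2) by (auto simp: virtual_pairs_def)
    then show ?thesis unfolding lam_def snoc sgn using Virtual
      by (simp add: first_over_Cons c_def[symmetric])
  qed
qed

lemma lam_rotate:
  "virtual_code (u @ v) \<Longrightarrow> lam (v @ u) = lam (u @ v) + sum_list (map weight (word Virtual u))"
proof (induction u arbitrary: v)
  case (Cons p u)
  have "virtual_code (u @ v @ [p])"
    using Cons.prems by (subst paired_code_cong[where D' = "p # u @ v"]) simp_all
  from Cons.IH[OF this] lam_rotate1[of p "u @ v"] Cons.prems show ?case by simp
qed simp

lemma split_code:
  assumes "virtual_code D" "Passage c s k \<in> set D"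
  obtains u v where "D = u @ Passage c s k # v" "passage_pos D c s = length u"
proof -
  obtain u v where D: "D = u @ Passage c s k # v" using assms(2) by (metis split_list)
  have d: "distinct (map passage_end D)" using assms(1) by (simp add: paired_code_def)
  have "passage_pos D c s = length u" unfolding passage_pos_def
  proof (rule the_equality)
    show u: "length u < length D \<and> crossing (D ! length u) = c \<and> side (D ! length u) = s"
      by (simp add: D)
    fix i assume i: "i < length D \<and> crossing (D ! i) = c \<and> side (D ! i) = s"
    then have "map passage_end D ! i = map passage_end D ! length u"
      using u by (simp add: passage_end_def)
    then show "i = length u" using nth_eq_iff_index_eq[OF d, of i "length u"] i u by simp
  qed
  then show thesis using that D by blast
qed

text \<open>The label on arrival is the label at the base point plus the weights passed on the way.
  The constant \<open>lam D\<close> will cancel in the gap.\<close>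

lemma height_incoming_label:
  assumes D: "virtual_code D" and p: "Passage c s k \<in> set D" and k: "k \<noteq> Virtual"
  shows "height (set (word Virtual D)) (order (word Virtual D)) weight (c, s) =
    2 * (incoming_label D c s - lam D) + weight (c, s)"
proof -
  obtain u v where uv: "D = u @ Passage c s k # v" "passage_pos D c s = length u"
    using split_code[OF D p] by metis
  have w: "word Virtual D = word Virtual u @ (c, s) # word Virtual v"
    using k by (simp add: uv(1) passage_end_def)
  have "incoming_label D c s = lam (Passage c s k # v @ u)"
    unfolding incoming_label_def uv(2) unfolding uv(1) by (simp add: rotate_append)
  also have "\<dots> = lam D + sum_list (map weight (word Virtual u))"
    using lam_rotate[of u "Passage c s k # v"] D uv(1) by simp
  finally show ?thesis
    using height_append_Cons[of "word Virtual u" "(c, s)" "word Virtual v"]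
      gauss_word_word[OF D separates_virtual] w by simp
qed

text \<open>The weights at the two ends of a crossing differ by 2, which supplies the
  \<open>- 1\<close> in the index; measuring from the over end supplies the sign of the
  crossing.\<close>

lemma Ind_word_gap:
  assumes D: "virtual_code D" and c: "c \<in> classical D"
  shows "word_gap (word Virtual D) (over_end D c) = - (2 * Ind D c)"
proof -
  have "\<exists>k. Passage c s k \<in> set D \<and> k \<noteq> Virtual" for s
    using over_under[OF D c] side_neq_iff[of s "over_side D c"] by (cases "s = over_side D c") auto
  then have h: "height (set (word Virtual D)) (order (word Virtual D)) weight (c, s) =
      2 * (incoming_label D c s - lam D) + weight (c, s)" for s
    using height_incoming_label[OF D] by blast
  show ?thesis
    by (cases "over_side D c")
      (simp_all add: word_gap_def gap_def h over_end_def Ind_def sgn_crossing_weight weight_def)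
qed


text \<open>The argument is \<open>2 * Ind c\<close>, hence the factors 2.\<close>

definition count_diff :: "int \<Rightarrow> int \<Rightarrow> int" where
  "count_diff n m = of_bool (m = 2 * n) - of_bool (m = - (2 * n))"

lemma count_diff_odd: "count_diff n (- m) = - count_diff n m"
  by (auto simp: count_diff_def)

lemma word_sum_over:
  assumes D: "virtual_code D" and odd: "\<And>m. f (- m) = - f m"
  shows "word_sum f (word Virtual D) =
    2 * (\<Sum>c\<in>classical D. weight (over_end D c) * f (word_gap (word Virtual D) (over_end D c)))"
proof -
  let ?w = "word Virtual D" and ?O = "over_end D ` classical D"
  define F where "F = (\<lambda>x. weight x * f (word_gap ?w x))"
  have inj: "inj_on (over_end D) (classical D)" by (rule inj_onI) (metis fst_over_end)
  have F_mate: "F (mate x) = F x" for x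
    by (simp add: F_def word_gap_def gap_mate odd)
  have "set ?w = ?O \<union> mate ` ?O"
  proof
    show "?O \<union> mate ` ?O \<subseteq> set ?w" using over_end_mem[OF D] by blast
    show "set ?w \<subseteq> ?O \<union> mate ` ?O"
    proof
      fix x assume x: "x \<in> set ?w"
      then have c: "fst x \<in> classical D" by (simp add: classical_word)
      have "x = over_end D (fst x) \<or> x = mate (over_end D (fst x))"
        using fst_eq_iff_mate[of x "over_end D (fst x)"] by simp
      then show "x \<in> ?O \<union> mate ` ?O" using c by blast
    qed
  qed
  moreover have "?O \<inter> mate ` ?O = {}"
  proof -
    have False if "over_end D c = mate (over_end D c')" for c c'
      using that by (metis fst_over_end fst_mate mate_neq(1))
    then show ?thesis by blast
  qed
  ultimately have "sum F (set ?w) = sum F ?O + sum F (mate ` ?O)"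
    by (simp add: sum.union_disjoint)
  also have "sum F (mate ` ?O) = sum F ?O"
    by (subst sum.reindex) (auto simp: F_mate inj_on_def simp del: mate_Pair)
  also have "sum F ?O = (\<Sum>c\<in>classical D. F (over_end D c))"
    using inj by (simp add: sum.reindex)
  finally show ?thesis by (simp add: word_sum_def gap_sum_def word_gap_def F_def)
qed

lemma writhe_sum: "writhe m D = (\<Sum>c\<in>classical D. sgn_crossing D c * of_bool (Ind D c = m))"
proof -
  have card: "int (card {c \<in> classical D. P c}) = (\<Sum>c\<in>classical D. of_bool (P c))" for P
  proof -
    have "{c \<in> classical D. P c} = classical D \<inter> {c. P c}" by blast
    then show ?thesis by (simp add: sum_of_bool_eq)
  qed
  have "of_bool (sgn_crossing D c = 1 \<and> Ind D c = m) - of_bool (sgn_crossing D c = - 1 \<and> Ind D c = m) =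
      sgn_crossing D c * of_bool (Ind D c = m)" for c
    by (simp add: sgn_crossing_def)
  then have "(\<Sum>c\<in>classical D. sgn_crossing D c * of_bool (Ind D c = m)) =
      (\<Sum>c\<in>classical D. of_bool (sgn_crossing D c = 1 \<and> Ind D c = m)) -
      (\<Sum>c\<in>classical D. of_bool (sgn_crossing D c = - 1 \<and> Ind D c = m))"
    by (simp only: sum_subtractf[symmetric])
  then show ?thesis unfolding writhe_def card by (rule sym)
qed

lemma dwrithe_sum:
  "dwrithe n D = (\<Sum>c\<in>classical D. sgn_crossing D c * count_diff n (2 * Ind D c))"
proof -
  have "sgn_crossing D c * count_diff n (2 * Ind D c) =
      sgn_crossing D c * of_bool (Ind D c = n) - sgn_crossing D c * of_bool (Ind D c = - n)" for c
  proof -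
    have "2 * Ind D c = - (2 * n) \<longleftrightarrow> Ind D c = - n" by linarith
    then show ?thesis unfolding count_diff_def by (simp add: right_diff_distrib)
  qed
  then show ?thesis unfolding dwrithe_def writhe_sum by (simp only: sum_subtractf)
qed

text \<open>The word records sides but not which strand is over. Hence the n-dwrithe depends on the
  flat diagram only, and flat moves can be applied to it.\<close>

lemma dwrithe_word: 
  assumes "virtual_code D"
  shows "word_sum (count_diff n) (word Virtual D) = 2 * dwrithe n D"
proof -
  have "weight (over_end D c) * count_diff n (word_gap (word Virtual D) (over_end D c)) =
      sgn_crossing D c * count_diff n (2 * Ind D c)" if "c \<in> classical D" for c
    using Ind_word_gap[OF assms that] by (simp add: count_diff_odd sgn_crossing_weight)
  then show ?thesis
    using word_sum_over[OF assms, of "count_diff n"] by (simp add: count_diff_odd dwrithe_sum)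
qed

section \<open>The word of a smoothed diagram\<close>

lemma order_rotate:
  assumes d: "distinct (u @ v)" and "x \<in> set (u @ v)" "y \<in> set (u @ v)"
  shows "order (v @ u) y x = order (u @ v) y x * (if y \<in> set u then - 1 else 1) * (if x \<in> set u then - 1 else 1)"
proof -
  have disj: "set u \<inter> set v = {}" using d by simp
  consider "x \<in> set u" "y \<in> set u" "x \<notin> set v" "y \<notin> set v" | "x \<in> set v" "y \<in> set v" "x \<notin> set u" "y \<notin> set u"
    | "x \<in> set u" "y \<in> set v" "x \<notin> set v" "y \<notin> set u" | "x \<in> set v" "y \<in> set u" "x \<notin> set u" "y \<notin> set v"
    using assms disj by auto
  then show ?thesis
    by cases (simp_all add: order_def before_append before_notin)
qed

lemma
  assumes w: "gauss_word (u @ b # v)" and AB: "v @ u = A @ mate b # B"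
  shows arc_sign_word: "x \<in> set (A @ B) \<Longrightarrow>
      arc_sign (order (u @ b # v)) b x = (if x \<in> set A then 1 else - 1)"
    and smooth_kernel_word: "x \<in> set (A @ B) \<Longrightarrow> y \<in> set (A @ B) \<Longrightarrow>
      smooth_kernel (order (u @ b # v)) b y x = order (A @ rev B) y x"
proof -
  let ?w = "u @ b # v" and ?w' = "b # A @ mate b # B"
  have d: "distinct ?w" using w by (rule gauss_word_distinct)
  have w': "(b # v) @ u = ?w'" using AB by simp
  have "distinct ((b # v) @ u)" using d by auto
  then have d': "distinct ?w'" unfolding w' .
  have set: "set ?w = set ?w'" using arg_cong[OF AB, of set] by auto
  \<comment> \<open>\<open>from_base\<close> is \<open>- 1\<close> exactly on \<open>u\<close>, the
    part that passes to the end when the base point moves to \<open>b\<close>.\<close>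
  have fb: "from_base (order ?w) b z = (if z \<in> set u then - 1 else 1)" if "z \<in> set ?w" for z
  proof -
    have "z \<in> set u \<and> z \<noteq> b \<or> z = b \<and> z \<notin> set u \<or> z \<in> set v \<and> z \<notin> set u \<and> z \<noteq> b" using that d by auto
    then show ?thesis
      using order_eq_1[OF d, of z b] order_eq_1[OF d, of b z] skewD[OF skew_order, of ?w b z]
      by (auto simp: from_base_def before_append)
  qed
  have rot: "order ?w y x * from_base (order ?w) b y * from_base (order ?w) b x = order ?w' y x"
    if "x \<in> set ?w" "y \<in> set ?w" for x y
    using order_rotate[of u "b # v" x y] d that unfolding w' by (simp add: fb)
  have arc: "arc_sign (order ?w) b x = (if x \<in> set A then 1 else - 1)" if x: "x \<in> set (A @ B)" for x
  proof -
    have "arc_sign (order ?w) b x = order ?w' x (mate b)"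
      unfolding arc_sign_def by (rule rot) (use x in \<open>simp_all add: set del: set_append\<close>, auto)
    moreover have "x \<in> set A \<Longrightarrow> order ?w' x (mate b) = 1"
      by (rule order_eq_1[OF d']) (simp add: before_append)
    moreover have "x \<notin> set A \<Longrightarrow> order ?w' (mate b) x = 1"
      by (rule order_eq_1[OF d']) (use x in \<open>simp add: before_append\<close>)
    ultimately show ?thesis using skewD[OF skew_order, of ?w' x "mate b"] by simp
  qed
  then show "x \<in> set (A @ B) \<Longrightarrow> arc_sign (order ?w) b x = (if x \<in> set A then 1 else - 1)" .
  assume x: "x \<in> set (A @ B)" and y: "y \<in> set (A @ B)"
  have mem: "x \<in> set ?w" "y \<in> set ?w" using x y unfolding set by auto
  \<comment> \<open>Reversing \<open>B\<close> changes a comparison only if both letters lie in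
    \<open>B\<close>, that is, outside \<open>A\<close>.\<close>
  have "smooth_kernel (order ?w) b y x = order ?w' y x * (if y \<notin> set A \<and> x \<notin> set A then - 1 else 1)"
    unfolding smooth_kernel_def using rot[OF mem] arc[OF x] arc[OF y] by simp
  also have "\<dots> = order (A @ rev B) y x"
  proof -
    have ne: "x \<noteq> b" "y \<noteq> b" "x \<noteq> mate b" "y \<noteq> mate b" "set A \<inter> set B = {}" using x y d' by auto
    have o: "order ?w' y x = order (A @ B) y x"
      using ne order_remove[of y "[b]" x "[]" "A @ mate b # B"] order_remove[of y "[mate b]" x A B] by simp
    consider "x \<in> set A" "y \<in> set A" "x \<notin> set B" "y \<notin> set B" | "x \<in> set B" "y \<in> set B" "x \<notin> set A" "y \<notin> set A"
      | "x \<in> set A" "y \<in> set B" "x \<notin> set B" "y \<notin> set A" | "x \<in> set B" "y \<in> set A" "x \<notin> set A" "y \<notin> set B"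
      using x y ne by auto
    then show ?thesis
      unfolding o by cases (simp_all add: order_def before_append before_rev before_notin)
  qed
  finally show "smooth_kernel (order ?w) b y x = order (A @ rev B) y x" .
qed

lemma tl_rotate_over_pos:
  assumes D: "virtual_code D" and D_eq: "D = u @ Passage c s Over # v"
  shows "tl (rotate (over_pos D c) D) = v @ u"
proof -
  have over: "Passage c s Over \<in> set D" using arg_cong[OF D_eq, of set] by simp
  have u: "length u < length D" "D ! length u = Passage c s Over" unfolding D_eq by simp_all
  have "over_pos D c = length u" unfolding over_pos_def
  proof (rule the_equality)
    show "length u < length D \<and> crossing (D ! length u) = c \<and> kind (D ! length u) = Over"
      using u by simp
    fix i assume i: "i < length D \<and> crossing (D ! i) = c \<and> kind (D ! i) = Over"
    then have "Passage c (side (D ! i)) Over = D ! i" using passage.collapse[of "D ! i"] by simp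
    moreover from this have "Passage c (side (D ! i)) Over \<in> set D" using i nth_mem by metis
    then have "side (D ! i) = s" using over_iff(1)[OF D] over by (metis vkind.distinct(3))
    ultimately have "D ! i = D ! length u" using u by simp
    then show "i = length u"
      using nth_eq_iff_index_eq[OF paired_code_distinct[OF D], of i "length u"] i u by simp
  qed
  then show ?thesis by (simp add: D_eq rotate_append)
qed

lemma smooth_split:
  assumes D: "virtual_code D" and c: "c \<in> classical D"
  obtains u v A B where "D = u @ Passage c (over_side D c) Over # v"
    "v @ u = A @ Passage c (opp (over_side D c)) Under # B"
    "c \<notin> crossing ` set (A @ B)"
    "smooth D c = map (\<lambda>p. if crossing p \<in> crossing ` set A \<inter> crossing ` set B
        then Passage (crossing p) (opp (side p)) (kind p) else p) (A @ rev B)"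
proof -
  define sd where "sd = over_side D c"
  let ?o = "Passage c (sd) Over" and ?m = "Passage c (opp (sd)) Under"
  have ou: "?o \<in> set D" "?m \<in> set D" using over_under[OF D c] by (simp_all add: sd_def)
  obtain u v where uv: "D = u @ ?o # v" "passage_pos D c (sd) = length u"
    using split_code[OF D ou(1)] by metis
  have d: "distinct (map passage_end D)" using D by (simp add: paired_code_def)
  have "?m \<in> set (v @ u)" using ou(2) arg_cong[OF uv(1), of set] by auto
  then obtain A B where AB: "v @ u = A @ ?m # B" by (metis split_list)
  have only: "p = ?o \<or> p = ?m" if "p \<in> set D" "crossing p = c" for p
  proof -
    have p: "Passage c (side p) (kind p) = p" using that(2) passage.collapse[of p] by simp
    have "side p = sd \<or> side p = opp (sd)"
      by (cases "side p"; cases "sd") auto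
    then show ?thesis
      using paired_code_unique[OF D, of c "side p" "kind p"] ou that(1) p by metis
  qed
  have "distinct (?o # v @ u)" using paired_code_distinct[OF D] unfolding uv(1) by auto
  then have dAB: "distinct (?o # A @ ?m # B)" unfolding AB .
  have set: "set D = set (?o # A @ ?m # B)" using arg_cong[OF AB, of set] uv(1) by auto
  have nc: "crossing p \<noteq> c" if "p \<in> set (A @ B)" for p
    using only[of p] that dAB unfolding set by auto
  have "tl (rotate (over_pos D c) D) = A @ ?m # B"
    using tl_rotate_over_pos[OF D uv(1)] AB by simp
  moreover have "takeWhile (\<lambda>p. crossing p \<noteq> c) (A @ ?m # B) = A"
    using nc by (subst takeWhile_append2) auto
  moreover have "dropWhile (\<lambda>p. crossing p \<noteq> c) (A @ ?m # B) = ?m # B"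
    using nc by (subst dropWhile_append2) auto
  ultimately have "smooth D c = map (\<lambda>p. if crossing p \<in> crossing ` set A \<inter> crossing ` set B
        then Passage (crossing p) (opp (side p)) (kind p) else p) (A @ rev B)"
    unfolding smooth_def by (simp only: Let_def list.sel)
  moreover have "c \<notin> crossing ` set (A @ B)" using nc by blast
  ultimately show thesis using that[of u v A B] uv(1) AB unfolding sd_def by blast
qed

text \<open>\<open>smooth\<close> exchanges sides at the mixed crossings, whereas
  \<open>smooth_weight\<close> keeps the names of the ends and changes the sign of their weight. The
  involution \<open>\<phi>\<close>, which is \<open>mate\<close> at mixed crossings, translates
  between the two.\<close>

lemma
  assumes D: "virtual_code D" and c: "c \<in> classical D"
  shows virtual_code_smooth: "virtual_code (smooth D c)"
    and dwrithe_smooth: "word_smooth_sum (count_diff n) (word Virtual D) (over_end D c) = 2 * dwrithe n (smooth D c)"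
proof -
  obtain u v A B where uv: "D = u @ Passage c (over_side D c) Over # v"
    and AB: "v @ u = A @ Passage c (opp (over_side D c)) Under # B"
    and nc: "c \<notin> crossing ` set (A @ B)"
    and smooth: "smooth D c = map (\<lambda>p. if crossing p \<in> crossing ` set A \<inter> crossing ` set B
        then Passage (crossing p) (opp (side p)) (kind p) else p) (A @ rev B)"
    by (rule smooth_split[OF D c])
  define sd where "sd = over_side D c"
  note uv = uv[folded sd_def] and AB = AB[folded sd_def]
  define M where "M = crossing ` set A \<inter> crossing ` set B"
  define \<phi> where "\<phi> = (\<lambda>x :: strand_end. if fst x \<in> M then mate x else x)"
  define h where "h = (\<lambda>p :: vkind passage. if crossing p \<in> M then Passage (crossing p) (opp (side p)) (kind p) else p)"
  have smooth: "smooth D c = map h (A @ rev B)" using smooth by (simp only: M_def h_def)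
  have h: "passage_end (h p) = \<phi> (passage_end p)" "kind (h p) = kind p" "crossing (h p) = crossing p" for p
    by (simp_all add: h_def \<phi>_def passage_end_def)
  have \<phi>\<phi>: "\<phi> (\<phi> x) = x" for x by (simp add: \<phi>_def)
  have \<phi>_mate: "\<phi> (mate x) = mate (\<phi> x)" for x by (simp add: \<phi>_def)
  have inj: "inj \<phi>" by (rule inj_on_inverseI[where g = \<phi>]) (rule \<phi>\<phi>)
  let ?o = "Passage c (sd) Over" and ?m = "Passage c (opp (sd)) Under"
  have set: "set D = insert ?o (insert ?m (set (A @ B)))" using arg_cong[OF AB, of set] uv by auto
  have "distinct (map passage_end (?o # v @ u))" using D unfolding paired_code_def uv by auto
  then have dAB: "distinct (map passage_end (A @ B))" unfolding AB by auto
  have "distinct (map passage_end (smooth D c))"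
  proof -
    have "map passage_end (smooth D c) = map \<phi> (map passage_end (A @ rev B))"
      unfolding smooth by (simp add: h rev_map)
    moreover have "distinct (map passage_end (A @ rev B))" using dAB by (simp add: distinct_map)
    ultimately show ?thesis
      using inj_on_subset[OF inj subset_UNIV] by (simp only: distinct_map simp_thms)
  qed
  moreover have "\<exists>k'. Passage (crossing p) (opp (side p)) k' \<in> set (smooth D c) \<and> (kind p, k') \<in> virtual_pairs"
    if p: "p \<in> set (smooth D c)" for p
  proof -
    obtain q where q: "q \<in> set (A @ B)" "p = h q" using p unfolding smooth by auto
    obtain k' where k': "Passage (crossing q) (opp (side q)) k' \<in> set D" "(kind q, k') \<in> virtual_pairs"
      using paired_code_partner[OF D, of q] q set by auto
    have "crossing q \<noteq> c" using q(1) nc by blast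
    then have "Passage (crossing q) (opp (side q)) k' \<in> set (A @ B)" using k'(1) unfolding set by simp
    then have "h (Passage (crossing q) (opp (side q)) k') \<in> set (smooth D c)" unfolding smooth by auto
    moreover have "h (Passage (crossing q) (opp (side q)) k') = Passage (crossing p) (opp (side p)) k'"
      unfolding q(2) by (simp add: h_def)
    ultimately show ?thesis using k'(2) q(2) h(2) by auto
  qed
  ultimately show V: "virtual_code (smooth D c)" by (simp add: paired_code_def)
  let ?W = "word Virtual" and ?b = "over_end D c"
  have w: "?W D = ?W u @ ?b # ?W v"
    using arg_cong[OF uv, of ?W] by (simp add: passage_end_def over_end_def sd_def)
  have wAB: "?W v @ ?W u = ?W A @ mate ?b # ?W B"
    using arg_cong[OF AB, of ?W] by (simp add: passage_end_def over_end_def sd_def)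
  note G = gauss_word_word[OF D separates_virtual]
  have G': "gauss_word (?W u @ ?b # ?W v)" using G unfolding w .
  have W_smooth: "?W (smooth D c) = map \<phi> (?W A @ rev (?W B))"
  proof -
    have "?W (map h l) = map \<phi> (?W l)" for l by (induction l) (simp_all add: h)
    then show ?thesis unfolding smooth by simp
  qed
  let ?P = "set (?W A @ rev (?W B))"
  have dist: "distinct (?b # ?W A @ mate ?b # ?W B)"
    using gauss_word_distinct[OF G'] unfolding wAB[symmetric] by auto
  have P: "set (?W D) - {?b, mate ?b} = ?P"
    using arg_cong[OF wAB, of set] dist unfolding w by auto
  have P_pair: "paired ?P" using paired_Diff[OF gauss_word_paired[OF G], of ?b] unfolding P .
  have P': "?P = set (?W A @ ?W B)" by simp
  \<comment> \<open>\<open>M\<close> is defined by all passages on the two arcs, the arc signs only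
    by ends in the word. They agree because both passages of a classical crossing appear in the
    word.\<close>
  have M_iff: "fst x \<in> M \<longleftrightarrow> (x \<in> set (?W A) \<longleftrightarrow> mate x \<notin> set (?W A))" if x: "x \<in> ?P" for x
  proof -
    have mx: "mate x \<in> ?P" using x paired_mate[OF P_pair, of x] by blast
    have disj: "set (?W A) \<inter> set (?W B) = {}" using dist by auto
    have W_mem: "y \<in> set (?W l) \<Longrightarrow> fst y \<in> crossing ` set l" for y l
      by (auto simp: word_def passage_end_def)
    have cross: "x \<in> set (?W l) \<or> mate x \<in> set (?W l)" if h: "fst x \<in> crossing ` set l" "set l \<subseteq> set D" for l
    proof -
      obtain p where p: "p \<in> set l" "crossing p = fst x" using h(1) by auto
      obtain k where k: "k \<noteq> Virtual" "Passage (fst x) (snd x) k \<in> set D"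
        using x mem_word[of "fst x" "snd x" Virtual D] unfolding P[symmetric] by auto
      obtain k' where k': "k' \<noteq> Virtual" "Passage (fst x) (opp (snd x)) k' \<in> set D"
        using mx mem_word[of "fst x" "opp (snd x)" Virtual D] unfolding P[symmetric]
        by (auto simp: mate_def)
      have pp: "Passage (fst x) (side p) (kind p) = p" using p(2) passage.collapse[of p] by simp
      have "side p = snd x \<or> side p = opp (snd x)" by (cases "side p"; cases "snd x") auto
      then have "kind p \<noteq> Virtual"
        using paired_code_unique[OF D, of "fst x" "side p" "kind p"] k k' pp p(1) h(2) by (metis subsetD)
      then have "passage_end p \<in> set (?W l)" using p by (auto simp: word_def)
      moreover have "passage_end p = x \<or> passage_end p = mate x"
        using fst_eq_iff_mate[of "passage_end p" x] p by (simp add: passage_end_def)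
      ultimately show ?thesis by metis
    qed
    have sub: "set A \<subseteq> set D" "set B \<subseteq> set D" unfolding set by auto
    have A: "fst x \<in> crossing ` set A \<longleftrightarrow> x \<in> set (?W A) \<or> mate x \<in> set (?W A)"
      using cross[OF _ sub(1)] W_mem[of x A] W_mem[of "mate x" A] fst_mate[of x] by metis
    have B: "fst x \<in> crossing ` set B \<longleftrightarrow> x \<in> set (?W B) \<or> mate x \<in> set (?W B)"
      using cross[OF _ sub(2)] W_mem[of x B] W_mem[of "mate x" B] fst_mate[of x] by metis
    have "x \<in> set (?W B) \<longleftrightarrow> x \<notin> set (?W A)" "mate x \<in> set (?W B) \<longleftrightarrow> mate x \<notin> set (?W A)"
      using x mx disj by auto
    then show ?thesis unfolding M_def using A B by blast
  qed
  have "gap_sum (count_diff n) (set (?W (smooth D c))) (order (?W (smooth D c))) weight =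
      gap_sum (count_diff n) ?P (smooth_kernel (order (?W D)) ?b) (smooth_weight (order (?W D)) ?b weight)"
  proof (rule gap_sum_rename[OF P_pair alternating_smooth_weight[OF alternating_weight], where \<pi> = \<phi> and \<alpha> = "\<lambda>_. 0"])
    show "inj_on \<phi> ?P" using inj by (rule inj_on_subset) simp
    show "set (?W (smooth D c)) = \<phi> ` ?P" unfolding W_smooth by (rule set_map)
    show "\<phi> (mate x) = mate (\<phi> x)" for x by (rule \<phi>_mate)
    show "weight (\<phi> x) = smooth_weight (order (?W D)) ?b weight x" if x: "x \<in> ?P" for x
    proof -
      have mx: "mate x \<in> ?P" using x paired_mate[OF P_pair, of x] by blast
      show ?thesis
        using M_iff[OF x] arc_sign_word[OF G' wAB, of x] arc_sign_word[OF G' wAB, of "mate x"] x mx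
        unfolding P' w[symmetric] by (simp add: smooth_weight_def \<phi>_def)
    qed
    show "order (?W (smooth D c)) (\<phi> y) (\<phi> x) =
        smooth_kernel (order (?W D)) ?b y x + 0 - 0" if x: "x \<in> ?P" and y: "y \<in> ?P" for x y
      using smooth_kernel_word[OF G' wAB x[unfolded P'] y[unfolded P']]
        order_map[OF inj_on_subset[OF inj subset_UNIV] x y]
      unfolding W_smooth w[symmetric] by simp
  qed
  then show "word_smooth_sum (count_diff n) (?W D) ?b = 2 * dwrithe n (smooth D c)"
    using dwrithe_word[OF V, of n] by (simp add: word_smooth_sum_def smooth_sum_def P word_sum_def)
qed


section \<open>Invariance under moves\<close>

text \<open>Either no corner is virtual, or the strand \<open>p\<close> is virtual at both of its
  corners. In the latter case each piece keeps at most one letter, so reversing the pieces does not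
  change the word.\<close>

definition uniform_triples :: "'k \<Rightarrow> (('k \<times> 'k) \<times> ('k \<times> 'k) \<times> ('k \<times> 'k)) set \<Rightarrow> bool" where
  "uniform_triples V T \<longleftrightarrow> (\<forall>((kxp, kxq), (kyp, kyr), (kzq, kzr)) \<in> T.
    (kxp = V \<longleftrightarrow> kxq = V) \<and> (kyp = V \<longleftrightarrow> kyr = V) \<and> (kzq = V \<longleftrightarrow> kzr = V) \<and>
    (kxp = V \<longleftrightarrow> kyp = V) \<and> (kzq = V \<longrightarrow> kxp = V))"

lemma uniform_virtual: "uniform_triples Virtual virtual_triples"
  by (simp add: uniform_triples_def virtual_triples_def)

lemma uniform_flat: "uniform_triples FlatVirtual flat_triples"
  by (simp add: uniform_triples_def flat_triples_def)

lemma
  assumes tri: "triangle T p q r" and T: "uniform_triples V T" and w: "gauss_word (word V D)"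
    and DD': "(D, D') = (p @ t @ q @ u @ r @ v, rev p @ t @ rev q @ u @ rev r @ v) \<or>
      (D, D') = (p @ t @ r @ u @ q @ v, rev p @ t @ rev r @ u @ rev q @ v)"
  shows set_word_third: "set (word V D') = set (word V D)"
    and word_sum_code_third: "word_sum f (word V D') = word_sum f (word V D)"
    and word_gap_code_third: "e \<in> set (word V D) \<Longrightarrow> word_gap (word V D') e = word_gap (word V D) e"
    and word_smooth_sum_code_third: "(\<And>m. f (- m) = - f m) \<Longrightarrow> e \<in> set (word V D) \<Longrightarrow>
      word_smooth_sum f (word V D') e = word_smooth_sum f (word V D) e"
proof -
  let ?claim = "set (word V D') = set (word V D) \<and> word_sum f (word V D') = word_sum f (word V D) \<and>
    (\<forall>e \<in> set (word V D). word_gap (word V D') e = word_gap (word V D) e) \<and>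
    ((\<forall>m. f (- m) = - f m) \<longrightarrow> (\<forall>e \<in> set (word V D).
      word_smooth_sum f (word V D') e = word_smooth_sum f (word V D) e))"
  have ?claim
    using tri
  proof cases
    case (1 kxp kxq kyp kyr kzq kzr sx dq sy dr dp sz x y z)
    have k: "kxp = V \<longleftrightarrow> kxq = V" "kyp = V \<longleftrightarrow> kyr = V" "kzq = V \<longleftrightarrow> kzr = V"
      "kxp = V \<longleftrightarrow> kyp = V" "kzq = V \<longrightarrow> kxp = V"
      using bspec[OF T[unfolded uniform_triples_def] 1(4)] by auto
    show ?thesis
    proof (cases "kxp = V")
      case True
      then have "rev (word V p) = word V p" "rev (word V q) = word V q" "rev (word V r) = word V r"
        using k unfolding 1 by (simp_all add: ordered_def)
      then have "word V D' = word V D" using DD' by auto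
      then show ?thesis by simp
    next
      case False
      define a b c where "a = (x, sx)" and "b = (y, sy)" and "c = (z, sz)"
      have p: "word V p = ordered dp a b" and q: "word V q = ordered dq (mate a) c"
        and r: "word V r = ordered dr (mate b) (mate c)"
        using False k unfolding 1 by (simp_all add: ordered_def passage_end_def a_def b_def c_def)
      have ww': "(word V D, word V D') = (word V p @ word V t @ word V q @ word V u @ word V r @ word V v,
            rev (word V p) @ word V t @ rev (word V q) @ word V u @ rev (word V r) @ word V v) \<or>
          (word V D, word V D') = (word V p @ word V t @ word V r @ word V u @ word V q @ word V v,
            rev (word V p) @ word V t @ rev (word V r) @ word V u @ rev (word V q) @ word V v)"
        using DD' by auto
      \<comment> \<open>Each equation is one of the three \<open>corner_left\<close> conditions,
        with sides and orders written as signs.\<close>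
      have balance: "(if dp then weight b else - weight b) = (if dq then weight c else - weight c)"
        "(if dp then weight a else - weight a) = (if dr then weight c else - weight c)"
        "(if dq then weight a else - weight a) = (if dr then weight b else - weight b)"
        using 1(5-7) unfolding corner_left_def a_def b_def c_def weight_def
        by (cases sx; cases sy; cases sz; cases dp; cases dq; cases dr; simp)+
      note third = w p q r ww' balance
      show ?thesis
        using set_third[OF third] word_sum_third[OF third] word_gap_third[OF third]
          word_smooth_sum_third[where f = f, OF third] by blast
    qed
  qed
  then show "set (word V D') = set (word V D)" "word_sum f (word V D') = word_sum f (word V D)"
    "e \<in> set (word V D) \<Longrightarrow> word_gap (word V D') e = word_gap (word V D) e"
    "(\<And>m. f (- m) = - f m) \<Longrightarrow> e \<in> set (word V D) \<Longrightarrow>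
      word_smooth_sum f (word V D') e = word_smooth_sum f (word V D) e"
    by blast+
qed

lemma word_relabel: "word V (relabel f D) = map (map_prod f id) (word V D)"
  by (induction D) (auto simp: relabel_def passage_end_def)

lemma fst_set_word: "fst ` set (word V D) \<subseteq> crossing ` set D"
  by (auto simp: word_def passage_end_def)

text \<open>Virtual kinks and bigons leave the word itself unchanged; the classical or flat ones are
  the kinks and bigons treated above.\<close>

lemma move_word_sum:
  assumes move: "move X T D D'" and D: "paired_code X D" and D': "paired_code X D'"
    and X: "separates V X" and T: "uniform_triples V T" and odd: "\<And>m. f (- m) = - f m"
  shows "word_sum f (word V D') = word_sum f (word V D)"
  using move
proof cases
  case basepoint
  show ?thesis
  proof (cases D)
    case (Cons p w)
    then show ?thesis
      using word_sum_rotate[of "passage_end p" "word V w" f] gauss_word_word[OF D X] basepoint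
      by (cases "kind p = V") simp_all
  qed (simp add: basepoint)
next
  case (names g)
  have "inj_on g (fst ` set (word V D))" using names(2) fst_set_word by (rule inj_on_subset)
  then show ?thesis
    using word_sum_rename[OF gauss_word_word[OF D X], of g f] names(1) by (simp add: word_relabel)
next
  case (first k k' a s)
  have "k = V \<longleftrightarrow> k' = V" using separatesD[OF X first(2)] .
  then show ?thesis
    using word_sum_kink[where f = f, OF odd, of "(a, s)" "word V D"] gauss_word_word[OF D' X] first(1)
    by (cases "k = V") (simp_all add: passage_end_def)
next
  case (second_parallel k k' u v a s b)
  have "k = V \<longleftrightarrow> k' = V" using separatesD[OF X second_parallel(3)] .
  then show ?thesis
    using word_sum_bigon[where f = f, OF odd, of "(a, s)" "(b, opp s)" "word V u" "[mate (a, s), mate (b, opp s)]" "word V v"]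
      gauss_word_word[OF D' X] second_parallel(1,2) weight_opp[of b s a]
    by (cases "k = V") (simp_all add: passage_end_def)
next
  case (second_antiparallel k k' u v a s b)
  have "k = V \<longleftrightarrow> k' = V" using separatesD[OF X second_antiparallel(3)] .
  then show ?thesis
    using word_sum_bigon[where f = f, OF odd, of "(a, s)" "(b, opp s)" "word V u" "[mate (b, opp s), mate (a, s)]" "word V v"]
      gauss_word_word[OF D' X] second_antiparallel(1,2) weight_opp[of b s a]
    by (cases "k = V") (simp_all add: passage_end_def)
next
  case (third p q r u v w)
  have "(D, D') = (p @ u @ q @ v @ r @ w, rev p @ u @ rev q @ v @ rev r @ w) \<or>
      (D, D') = (p @ u @ r @ v @ q @ w, rev p @ u @ rev r @ v @ rev q @ w)"
    using third by simp
  then show ?thesis by (rule word_sum_code_third[OF third(3) T gauss_word_word[OF D X]])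
next
  case (third' p q r u v w)
  have "(D, D') = (p @ u @ q @ v @ r @ w, rev p @ u @ rev q @ v @ rev r @ w) \<or>
      (D, D') = (p @ u @ r @ v @ q @ w, rev p @ u @ rev r @ v @ rev q @ w)"
    using third' by simp
  then show ?thesis by (rule word_sum_code_third[OF third'(3) T gauss_word_word[OF D X]])
qed

lemma equivclp_invariant:
  assumes "equivclp R x y" and "\<And>x y. R x y \<Longrightarrow> F x = F y"
  shows "F x = F y"
  using assms(1) by (induction rule: equivclp_induct) (auto dest: assms(2))

lemma diagram_paired: "diagram X D \<Longrightarrow> sym X \<Longrightarrow> paired_code X D"
  unfolding diagram_def using valid_code_paired by blast

lemma diagram_equiv_word_sum:
  assumes equiv: "diagram_equiv X T D D'"
    and X: "separates V X" and T: "uniform_triples V T" and odd: "\<And>m. f (- m) = - f m"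
  shows "word_sum f (word V D) = word_sum f (word V D')"
  using equiv unfolding diagram_equiv_def
proof (rule equivclp_invariant)
  fix D D' assume step: "diagram X D \<and> diagram X D' \<and> move X T D D'"
  have "sym X" using X by (simp add: separates_def)
  then show "word_sum f (word V D) = word_sum f (word V D')"
    using move_word_sum[where f = f, OF _ _ _ X T odd, of D D'] step diagram_paired[of X] by simp
qed

lemma word_flat: "word FlatVirtual (flat D) = word Virtual D"
proof (induction D)
  case (Cons p D)
  have "flat_kind (kind p) = FlatVirtual \<longleftrightarrow> kind p = Virtual" by (cases "kind p") simp_all
  moreover have "passage_end (map_passage flat_kind p) = passage_end p"
    by (cases p) (simp add: passage_end_def)
  moreover have "kind (map_passage flat_kind p) = flat_kind (kind p)" by (cases p) simp
  ultimately show ?case using Cons by (simp add: flat_def)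
qed (simp add: flat_def)

text \<open>Flattening keeps the word, flat moves keep its sum, and the circle has the empty
  word.\<close>

lemma flat_trivial_dwrithe:
  assumes "virtual_code D" and "flat_equiv (flat D) []"
  shows "dwrithe n D = 0"
  using diagram_equiv_word_sum[OF assms(2) separates_flat uniform_flat, of "count_diff n"]
    dwrithe_word[OF assms(1), of n]
  by (simp add: count_diff_odd word_flat word_sum_def gap_sum_def)

lemma virtual_equiv_dwrithe:
  assumes "virtual_code D" "virtual_code D'" "virtual_equiv D D'"
  shows "dwrithe n D = dwrithe n D'"
  using diagram_equiv_word_sum[OF assms(3) separates_virtual uniform_virtual, of "count_diff n"]
    dwrithe_word[OF assms(1), of n] dwrithe_word[OF assms(2), of n]
  by (simp add: count_diff_odd)


section \<open>Sums over smoothings and their invariance\<close>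

definition smooth_poly :: "(int \<Rightarrow> int \<Rightarrow> int) \<Rightarrow> int \<Rightarrow> vkind code \<Rightarrow> int" where
  "smooth_poly g n D = (\<Sum>c\<in>classical D. sgn_crossing D c * g (Ind D c) (dwrithe n (smooth D c)))"

text \<open>The summand of a crossing, read off at its over end; there both quantities are even and
  the divisions are exact.\<close>

definition end_term :: "(int \<Rightarrow> int \<Rightarrow> int) \<Rightarrow> int \<Rightarrow> strand_end list \<Rightarrow> strand_end \<Rightarrow> int" where
  "end_term g n w x = - weight x *
    g (- word_gap w x div 2) (word_smooth_sum (count_diff n) w x div 2)"

lemma smooth_poly_word:
  assumes "virtual_code D"
  shows "smooth_poly g n D = (\<Sum>c\<in>classical D. end_term g n (word Virtual D) (over_end D c))"
  unfolding smooth_poly_def using assms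
  by (intro sum.cong) (simp_all add: end_term_def Ind_word_gap dwrithe_smooth sgn_crossing_weight)

text \<open>\<open>smooth\<close> starts reading at the overpassage of \<open>c\<close>, wherever
  the base point is.\<close>

lemma smooth_rotate1:
  assumes D: "virtual_code D" and c: "c \<in> classical D"
  shows "smooth (rotate1 D) c = smooth D c"
proof -
  define s where "s = over_side D c"
  have "Passage c s Over \<in> set D" using over_under[OF D c] by (simp add: s_def)
  then obtain u v where uv: "D = u @ Passage c s Over # v" by (metis split_list)
  have "mset (rotate1 D) = mset D" by (cases D) simp_all
  then have D': "virtual_code (rotate1 D)" using D paired_code_cong by blast
  have "tl (rotate (over_pos (rotate1 D) c) (rotate1 D)) = v @ u"
  proof (cases u)
    case Nil
    then show ?thesis using tl_rotate_over_pos[OF D', of v c s "[]"] uv by simp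
  next
    case (Cons p u')
    then show ?thesis using tl_rotate_over_pos[OF D', of u' c s "v @ [p]"] uv by simp
  qed
  then show ?thesis using tl_rotate_over_pos[OF D uv] by (simp only: smooth_def)
qed

lemma smooth_poly_cong:
  assumes D: "virtual_code D" and D': "virtual_code D'" and set: "set (word Virtual D') = set (word Virtual D)"
    and over: "\<And>c. c \<in> classical D \<Longrightarrow> over_end D' c = over_end D c"
    and gap: "\<And>x. x \<in> set (word Virtual D) \<Longrightarrow> word_gap (word Virtual D') x = word_gap (word Virtual D) x"
    and smooth: "\<And>x. x \<in> set (word Virtual D) \<Longrightarrow>
      word_smooth_sum (count_diff n) (word Virtual D') x = word_smooth_sum (count_diff n) (word Virtual D) x"
  shows "smooth_poly g n D' = smooth_poly g n D"
  unfolding smooth_poly_word[OF D] smooth_poly_word[OF D'] classical_word set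
  by (intro sum.cong) (simp_all add: end_term_def over gap smooth over_end_mem[OF D] classical_word[symmetric])

lemma over_end_cong:
  "(Passage c FromLeft Over \<in> set D' \<longleftrightarrow> Passage c FromLeft Over \<in> set D) \<Longrightarrow> over_end D' c = over_end D c"
  by (simp add: over_end_def over_side_def)

text \<open>The n-dwrithe of the smoothing at the new crossing is zero, since that of
  \<open>D\<close> is. Then \<open>g\<close> vanishes there, and the new crossing contributes
  nothing.\<close>

lemma smooth_poly_first:
  assumes D: "virtual_code D" and D': "virtual_code D'"
    and D'_eq: "D' = Passage a s k # Passage a (opp s) k' # D" and k: "(k, k') \<in> virtual_pairs"
    and g: "\<And>i. g i 0 = 0" and zero: "dwrithe n D = 0"
  shows "smooth_poly g n D' = smooth_poly g n D"
proof (cases "k = Virtual")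
  case True
  then have k': "k' = Virtual" using k by (auto simp: virtual_pairs_def)
  show ?thesis
    by (rule smooth_poly_cong[OF D D']) (auto simp: D'_eq True k' intro!: over_end_cong)
next
  case False
  let ?w = "word Virtual D" and ?w' = "word Virtual D'"
  have w': "?w' = (a, s) # mate (a, s) # ?w"
    using False k by (auto simp: D'_eq virtual_pairs_def passage_end_def)
  note G = gauss_word_word[OF D' separates_virtual, unfolded w']
  note kink = word_gap_kink[where f = "count_diff n", OF count_diff_odd G]
    word_smooth_sum_kink[where f = "count_diff n", OF count_diff_odd G]
  have a: "a \<notin> classical D"
  proof
    assume "a \<in> classical D"
    then obtain t where "(a, t) \<in> set ?w" by (auto simp: classical_word)
    then show False using gauss_word_distinct[OF G] by (cases s; cases t) auto
  qed
  have cl: "classical D' = insert a (classical D)" unfolding classical_word w' by simp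
  have over: "over_end D' c = over_end D c" if "c \<in> classical D" for c
    by (rule over_end_cong) (use that a in \<open>auto simp: D'_eq\<close>)
  have "over_end D' a = (a, s) \<or> over_end D' a = mate (a, s)"
    using fst_eq_iff_mate[of "over_end D' a" "(a, s)"] by simp
  moreover have "word_sum (count_diff n) ?w = 0" using dwrithe_word[OF D, of n] zero by simp
  ultimately have "word_smooth_sum (count_diff n) ?w' (over_end D' a) = 0"
    using word_smooth_sum_at_kink[where f = "count_diff n", OF count_diff_odd G] unfolding w' by blast
  then have "end_term g n ?w' (over_end D' a) = 0" by (simp add: end_term_def g)
  moreover have "end_term g n ?w' (over_end D' c) = end_term g n ?w (over_end D c)"
    if c: "c \<in> classical D" for c
    using kink[OF over_end_mem(1)[OF D c]] by (simp add: end_term_def over[OF c] w')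
  ultimately show ?thesis
    unfolding smooth_poly_word[OF D] smooth_poly_word[OF D'] cl using a by simp
qed

text \<open>The two new crossings have opposite signs, equal indices and equal n-dwrithes after
  smoothing, so their terms cancel.\<close>

lemma smooth_poly_second:
  assumes D: "virtual_code (u @ v)" and D': "virtual_code D'"
    and D'_eq: "D' = [Passage a s k, Passage b (opp s) k] @ u @ q @ v"
    and q: "q = [Passage a (opp s) k', Passage b s k'] \<or> q = [Passage b s k', Passage a (opp s) k']"
    and k: "(k, k') \<in> virtual_pairs"
  shows "smooth_poly g n D' = smooth_poly g n (u @ v)"
proof (cases "k = Virtual")
  case True
  then have k': "k' = Virtual" using k by (auto simp: virtual_pairs_def)
  have w: "word Virtual D' = word Virtual (u @ v)" using q by (auto simp: D'_eq True k')
  have set: "set D' = {Passage a s k, Passage b (opp s) k, Passage a (opp s) k', Passage b s k'} \<union> set (u @ v)"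
    using q by (auto simp: D'_eq)
  show ?thesis
    by (rule smooth_poly_cong[OF D D']; (rule over_end_cong)?; simp add: w set True k')
next
  case False
  let ?w = "word Virtual u @ word Virtual v" and ?w' = "word Virtual D'"
  define x y where "x = (a, s)" and "y = (b, opp s)"
  have k': "k' \<noteq> Virtual" using False k by (auto simp: virtual_pairs_def)
  have w': "?w' = [x, y] @ word Virtual u @ word Virtual q @ word Virtual v"
    using False by (simp add: D'_eq x_def y_def passage_end_def)
  have wq: "word Virtual q = [mate x, mate y] \<or> word Virtual q = [mate y, mate x]"
    using q k' by (auto simp: x_def y_def passage_end_def)
  have xy: "weight y = - weight x" unfolding x_def y_def by (rule weight_opp)
  have w: "word Virtual (u @ v) = ?w" by simp
  note G = gauss_word_word[OF D' separates_virtual, unfolded w']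
  note bigon = word_gap_bigon[where f = "count_diff n", OF count_diff_odd G wq xy]
    word_smooth_sum_bigon[where f = "count_diff n", OF count_diff_odd G wq xy]
  note at_bigon = word_gap_at_bigon[where f = "count_diff n", OF count_diff_odd G wq xy]
    word_smooth_sum_at_bigon[where f = "count_diff n", OF count_diff_odd G wq xy]
  have set: "set ?w' = {x, y, mate x, mate y} \<union> set ?w"
    using wq unfolding w' by auto
  have notin: "c \<noteq> a \<and> c \<noteq> b" if c: "c \<in> classical (u @ v)" for c
  proof -
    obtain t where t: "(c, t) \<in> set ?w" using c unfolding classical_word w by force
    then have "(c, t) \<notin> {x, y, mate x, mate y}"
      using gauss_word_distinct[OF G] wq by auto
    then show ?thesis unfolding x_def y_def by (cases s; cases t) auto
  qed
  have "x \<noteq> y" "y \<noteq> mate x" using gauss_word_distinct[OF G] wq by auto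
  then have ab: "a \<noteq> b" unfolding x_def y_def by auto
  have cl: "classical D' = insert a (insert b (classical (u @ v)))"
    unfolding classical_word set w by (auto simp: x_def y_def)
  have setD': "set D' = {Passage a s k, Passage b (opp s) k, Passage a (opp s) k', Passage b s k'} \<union> set (u @ v)"
    using q by (auto simp: D'_eq)
  have over: "over_end D' c = over_end (u @ v) c" if "c \<in> classical (u @ v)" for c
    by (rule over_end_cong) (use notin[OF that] in \<open>simp add: setD'\<close>)
  have side: "k = Over \<longleftrightarrow> s = over_side D' a" "k = Over \<longleftrightarrow> opp s = over_side D' b"
    using over_iff(1)[OF D', of a s k] over_iff(1)[OF D', of b "opp s" k] False by (simp_all add: setD')
  \<comment> \<open>Both passages of the first strand carry the decoration \<open>k\<close>, so the
    over ends of the two crossings lie on the same strand.\<close>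
  have pair: "over_end D' a = x \<and> over_end D' b = y \<or> over_end D' a = mate x \<and> over_end D' b = mate y"
    using side unfolding over_end_def x_def y_def
    by (cases "k = Over"; cases "over_side D' a"; cases "over_side D' b"; cases s) auto
  have gap_mate: "word_gap ?w' (mate z) = - word_gap ?w' z" for z by (simp add: word_gap_def gap_mate)
  have "end_term g n ?w' (over_end D' a) + end_term g n ?w' (over_end D' b) = 0"
    using pair
  proof
    assume *: "over_end D' a = x \<and> over_end D' b = y"
    show ?thesis using at_bigon(1,2) * xy unfolding w'[symmetric] by (simp add: end_term_def)
  next
    assume *: "over_end D' a = mate x \<and> over_end D' b = mate y"
    show ?thesis using at_bigon(1,3) * xy unfolding w'[symmetric]
      by (simp add: end_term_def gap_mate del: mate_Pair)
  qed
  moreover have "end_term g n ?w' (over_end D' c) = end_term g n ?w (over_end (u @ v) c)"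
    if c: "c \<in> classical (u @ v)" for c
    using bigon[OF over_end_mem(1)[OF D c, unfolded w]] by (simp add: end_term_def over[OF c] w')
  ultimately show ?thesis
    unfolding smooth_poly_word[OF D] smooth_poly_word[OF D'] cl w using notin ab
    by (subst sum.insert; (subst sum.insert)?; auto)
qed

lemma smooth_poly_move:
  assumes move: "move virtual_pairs virtual_triples D D'" and D: "virtual_code D" and D': "virtual_code D'"
    and g: "\<And>i. g i 0 = 0" and zero: "dwrithe n D = 0"
  shows "smooth_poly g n D' = smooth_poly g n D"
  using move
proof cases
  case basepoint
  have cl: "classical D' = classical D" "sgn_crossing D' = sgn_crossing D"
    unfolding basepoint by (simp_all add: classical_def sgn_crossing_def fun_eq_iff)
  have gap: "word_gap (word Virtual D') x = word_gap (word Virtual D) x" if "x \<in> set (word Virtual D)" for x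
  proof (cases D)
    case (Cons p w)
    then show ?thesis
      using word_gap_rotate[of "passage_end p" "word Virtual w" x] gauss_word_word[OF D separates_virtual] that basepoint
      by (cases "kind p = Virtual") simp_all
  qed (simp add: basepoint)
  have "Ind D' c = Ind D c" if c: "c \<in> classical D" for c
  proof -
    have "over_end D' c = over_end D c" by (rule over_end_cong) (simp add: basepoint)
    then show ?thesis
      using Ind_word_gap[OF D c] Ind_word_gap[OF D', of c] c cl gap[OF over_end_mem(1)[OF D c]] by simp
  qed
  then show ?thesis
    unfolding smooth_poly_def using cl smooth_rotate1[OF D] by (auto simp: basepoint intro!: sum.cong)
next
  case (names f)
  let ?\<pi> = "map_prod f id :: strand_end \<Rightarrow> strand_end"
  have sub: "classical D \<subseteq> crossing ` set D" unfolding classical_word by (rule fst_set_word)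
  have inj: "inj_on f (fst ` set (word Virtual D))" using names(2) fst_set_word by (rule inj_on_subset)
  have w': "word Virtual D' = map ?\<pi> (word Virtual D)" by (simp add: names word_relabel)
  have cl: "classical D' = f ` classical D" unfolding classical_word w' by force
  have over: "over_end D' (f c) = ?\<pi> (over_end D c)" if c: "c \<in> classical D" for c
  proof -
    have "Passage (f c) FromLeft Over \<in> set D' \<longleftrightarrow> Passage c FromLeft Over \<in> set D"
    proof
      assume "Passage (f c) FromLeft Over \<in> set D'"
      then obtain p where p: "p \<in> set D" "f (crossing p) = f c" "side p = FromLeft" "kind p = Over"
        by (auto simp: names relabel_def)
      then have "crossing p = c" using inj_onD[OF names(2), of "crossing p" c] c sub by blast
      then show "Passage c FromLeft Over \<in> set D" using p passage.collapse[of p] by simp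
    qed (force simp: names relabel_def)
    then show ?thesis by (simp add: over_end_def over_side_def)
  qed
  note G = gauss_word_word[OF D separates_virtual]
  have weight: "weight (?\<pi> x) = weight x" for x by (cases x) (simp add: weight_def)
  have "end_term g n (word Virtual D') (over_end D' (f c)) = end_term g n (word Virtual D) (over_end D c)"
    if c: "c \<in> classical D" for c
    using word_gap_rename[OF G inj over_end_mem(1)[OF D c]]
      word_smooth_sum_rename[OF G inj over_end_mem(1)[OF D c], of "count_diff n"]
    by (simp add: end_term_def over[OF c] w' weight)
  then show ?thesis
    unfolding smooth_poly_word[OF D] smooth_poly_word[OF D'] cl
    using inj by (simp add: sum.reindex classical_word[symmetric])
next
  case (first k k' a s)
  show ?thesis by (rule smooth_poly_first[where g = g and k = k and k' = k', OF D D' _ _ g zero]) (use first in simp_all)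
next
  case (second_parallel k k' u v a s b)
  show ?thesis unfolding second_parallel(1)
    by (rule smooth_poly_second[OF _ D' second_parallel(2) _ second_parallel(3)])
      (use D second_parallel(1) in simp_all)
next
  case (second_antiparallel k k' u v a s b)
  show ?thesis unfolding second_antiparallel(1)
    by (rule smooth_poly_second[OF _ D' second_antiparallel(2) _ second_antiparallel(3)])
      (use D second_antiparallel(1) in simp_all)
next
  case (third p q r u v w)
  have DD': "(D, D') = (p @ u @ q @ v @ r @ w, rev p @ u @ rev q @ v @ rev r @ w) \<or>
      (D, D') = (p @ u @ r @ v @ q @ w, rev p @ u @ rev r @ v @ rev q @ w)"
    using third by simp
  note * = third(3) uniform_virtual gauss_word_word[OF D separates_virtual] DD'
  have "set D' = set D" by (auto simp: third)
  then show ?thesis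
    using set_word_third[OF *] word_gap_code_third[OF *]
      word_smooth_sum_code_third[where f = "count_diff n", OF * count_diff_odd]
    by (intro smooth_poly_cong[OF D D'] over_end_cong) simp_all
next
  case (third' p q r u v w)
  have DD': "(D, D') = (p @ u @ q @ v @ r @ w, rev p @ u @ rev q @ v @ rev r @ w) \<or>
      (D, D') = (p @ u @ r @ v @ q @ w, rev p @ u @ rev r @ v @ rev q @ w)"
    using third' by simp
  note * = third'(3) uniform_virtual gauss_word_word[OF D separates_virtual] DD'
  have "set D' = set D" by (auto simp: third')
  then show ?thesis
    using set_word_third[OF *] word_gap_code_third[OF *]
      word_smooth_sum_code_third[where f = "count_diff n", OF * count_diff_odd]
    by (intro smooth_poly_cong[OF D D'] over_end_cong) simp_all
qed

lemma virtual_equiv_smooth_poly: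
  assumes equiv: "virtual_equiv D D'" and zero: "dwrithe n D = 0" and g: "\<And>i. g i 0 = 0"
  shows "smooth_poly g n D' = smooth_poly g n D"
proof -
  have sym: "sym virtual_pairs" using separates_virtual by (simp add: separates_def)
  define R where "R = (\<lambda>D D'. virtual_diagram D \<and> virtual_diagram D' \<and> move virtual_pairs virtual_triples D D')"
  \<comment> \<open>The sum is preserved only where the n-dwrithe vanishes. Recording
    \<open>None\<close> elsewhere gives a quantity preserved by every step, so that chains of steps
    in both directions can be followed.\<close>
  define F where "F = (\<lambda>D. if dwrithe n D = 0 then Some (smooth_poly g n D) else None)"
  have "F D = F D'"
  proof (rule equivclp_invariant[where R = R])
    show "equivclp R D D'" using equiv by (simp add: diagram_equiv_def R_def)
    fix D D' assume R: "R D D'"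
    then have vc: "virtual_code D" "virtual_code D'" using diagram_paired[OF _ sym] by (auto simp: R_def)
    have "virtual_equiv D D'" unfolding diagram_equiv_def using R by (auto simp: R_def)
    then have "dwrithe n D = dwrithe n D'" by (rule virtual_equiv_dwrithe[OF vc])
    then show "F D = F D'" using smooth_poly_move[where g = g, OF _ vc g] R by (auto simp: F_def R_def)
  qed
  then show ?thesis using zero by (auto simp: F_def split: if_splits)
qed

section \<open>Polynomials\<close>

lemma lookup_embed:
  "Poly_Mapping.lookup (embed p) (i, j) = (if j = 0 then Poly_Mapping.lookup p i else 0)"
proof -
  have "Poly_Mapping.lookup (embed p) (i, j) =
      (\<Sum>k\<in>Poly_Mapping.keys p. if k = i then (if j = 0 then Poly_Mapping.lookup p i else 0) else 0)"
    unfolding embed_def lookup_sum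
    by (intro sum.cong) (auto simp: lookup_single when_def)
  also have "\<dots> = (if j = 0 then Poly_Mapping.lookup p i else 0)"
    by (simp add: in_keys_iff)
  finally show ?thesis .
qed

lemma lookup_affine_index_poly:
  "Poly_Mapping.lookup (affine_index_poly D) i =
    (\<Sum>c\<in>classical D. sgn_crossing D c * (of_bool (Ind D c = i) - of_bool (i = 0)))"
  unfolding affine_index_poly_def lookup_sum
  by (intro sum.cong) (auto simp: lookup_minus lookup_single when_def)

lemma lookup_embed_affine_index_poly:
  "Poly_Mapping.lookup (embed (affine_index_poly D)) (i, j) =
    (\<Sum>c\<in>classical D. sgn_crossing D c * (of_bool (Ind D c = i \<and> j = 0) - of_bool (i = 0 \<and> j = 0)))"
  by (simp add: lookup_embed lookup_affine_index_poly)

lemma L_poly_eq_embed: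
  assumes zero: "dwrithe n D = 0" and smooth: "\<And>g. (\<And>i. g i 0 = 0) \<Longrightarrow> smooth_poly g n D = 0"
  shows "L_poly n D = embed (affine_index_poly D)"
proof (rule poly_mapping_eqI)
  fix k :: "int \<times> int"
  obtain i j where k: "k = (i, j)" by (cases k)
  \<comment> \<open>The first indicator reads off the coefficient in \<open>L\<close>, the second
    the one in \<open>P\<close>; the constant terms agree and cancel. At \<open>b = 0\<close> the
    two indicators coincide.\<close>
  let ?g = "\<lambda>a b :: int. of_bool (a = i \<and> \<bar>b\<bar> = j) - of_bool (a = i \<and> j = 0) :: int"
  have "Poly_Mapping.lookup (L_poly n D) (i, j) = (\<Sum>c\<in>classical D. sgn_crossing D c *
      (of_bool (Ind D c = i \<and> \<bar>dwrithe n (smooth D c)\<bar> = j) - of_bool (i = 0 \<and> j = 0)))"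
    unfolding L_poly_def lookup_sum zero
    by (intro sum.cong) (auto simp: lookup_minus lookup_single when_def)
  then have "Poly_Mapping.lookup (L_poly n D) (i, j) - Poly_Mapping.lookup (embed (affine_index_poly D)) (i, j)
      = smooth_poly ?g n D"
    by (simp add: lookup_embed_affine_index_poly smooth_poly_def sum_subtractf[symmetric] algebra_simps)
  moreover have "smooth_poly ?g n D = 0" by (rule smooth) auto
  ultimately show "Poly_Mapping.lookup (L_poly n D) k = Poly_Mapping.lookup (embed (affine_index_poly D)) k"
    by (simp add: k)
qed

lemma F_poly_eq_embed:
  assumes zero: "dwrithe n D = 0" and smooth: "\<And>g. (\<And>i. g i 0 = 0) \<Longrightarrow> smooth_poly g n D = 0"
  shows "F_poly n D = embed (affine_index_poly D)"
proof (rule poly_mapping_eqI)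
  fix k :: "int \<times> int"
  obtain i j where k: "k = (i, j)" by (cases k)
  let ?g = "\<lambda>a b :: int. of_bool (a = i \<and> b = j) - of_bool (a = i \<and> j = 0) :: int"
  let ?s = "\<lambda>c. Poly_Mapping.single (0 :: int, 0 :: int) (sgn_crossing D c)"
  have T: "T_set n D \<subseteq> classical D" by (auto simp: T_set_def)
  \<comment> \<open>On \<open>T_set\<close> the smoothing has n-dwrithe of absolute value zero. Thus
    the two subtracted sums both sit at exponent \<open>(0, 0)\<close> and combine to a sum over all
    crossings.\<close>
  have "(\<Sum>c \<in> T_set n D. Poly_Mapping.single (0, dwrithe n (smooth D c)) (sgn_crossing D c)) = sum ?s (T_set n D)"
    by (intro sum.cong) (auto simp: T_set_def zero)
  moreover have "sum ?s (classical D) = sum ?s (classical D - T_set n D) + sum ?s (T_set n D)"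
    by (rule sum.subset_diff[OF T]) simp
  ultimately have "F_poly n D = (\<Sum>c\<in>classical D.
      Poly_Mapping.single (Ind D c, dwrithe n (smooth D c)) (sgn_crossing D c)) - sum ?s (classical D)"
    unfolding F_poly_def zero by simp
  also have "\<dots> = (\<Sum>c\<in>classical D.
      Poly_Mapping.single (Ind D c, dwrithe n (smooth D c)) (sgn_crossing D c) - ?s c)"
    by (simp only: sum_subtractf)
  finally have "Poly_Mapping.lookup (F_poly n D) (i, j) = (\<Sum>c\<in>classical D. sgn_crossing D c *
      (of_bool (Ind D c = i \<and> dwrithe n (smooth D c) = j) - of_bool (i = 0 \<and> j = 0)))"
    by (simp only: lookup_sum) (intro sum.cong, auto simp: lookup_minus lookup_single when_def)
  then have "Poly_Mapping.lookup (F_poly n D) (i, j) - Poly_Mapping.lookup (embed (affine_index_poly D)) (i, j)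
      = smooth_poly ?g n D"
    by (simp add: lookup_embed_affine_index_poly smooth_poly_def sum_subtractf[symmetric] algebra_simps)
  moreover have "smooth_poly ?g n D = 0" by (rule smooth) auto
  ultimately show "Poly_Mapping.lookup (F_poly n D) k = Poly_Mapping.lookup (embed (affine_index_poly D)) k"
    by (simp add: k)
qed

text \<open>Away from exponent zero the coefficients are the n-writhes, so a vanishing n-dwrithe is
  equality of opposite coefficients.\<close>

lemma palindromic_affine_index_poly:
  assumes "\<And>n. dwrithe n D = 0"
  shows "palindromic (affine_index_poly D)"
  unfolding palindromic_def
proof
  fix m
  have "Poly_Mapping.lookup (affine_index_poly D) k = writhe k D" if "k \<noteq> 0" for k
    using that by (simp add: lookup_affine_index_poly writhe_sum)
  then show "Poly_Mapping.lookup (affine_index_poly D) m = Poly_Mapping.lookup (affine_index_poly D) (- m)"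
    using assms[of m] by (cases "m = 0") (simp_all add: dwrithe_def)
qed

theorem lemma2p2:
  fixes K :: "vkind code set"
  assumes "K \<in> virtual_knots" and "totally_flat_trivial K"
  shows "(\<forall>D \<in> K. \<forall>n::int. n \<ge> 1 \<longrightarrow>
            L_poly n D = embed (affine_index_poly D) \<and>
            F_poly n D = embed (affine_index_poly D)) \<and>
         (\<forall>D \<in> K. palindromic (affine_index_poly D))"
proof -
  obtain E where E: "virtual_diagram E" "K = {D. virtual_equiv E D}"
    using assms(1) unfolding virtual_knots_def by (auto elim!: quotientE)
  obtain D0 where D0: "D0 \<in> K" "totally_flat_trivial_diagram D0"
    using assms(2) by (auto simp: totally_flat_trivial_def)
  have sym: "sym virtual_pairs" using separates_virtual by (simp add: separates_def)
  have code: "virtual_code D" if "D \<in> K" for D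
  proof -
    have "virtual_diagram E = virtual_diagram D"
      using that unfolding E(2) diagram_equiv_def mem_Collect_eq by (rule equivclp_invariant) simp
    then show ?thesis using E(1) diagram_paired[OF _ sym] by blast
  qed
  have equiv: "virtual_equiv D0 D" if "D \<in> K" for D
    using that D0(1) unfolding E(2) diagram_equiv_def
    by (metis (no_types, lifting) equivclp_sym equivclp_trans mem_Collect_eq)
  have zero0: "dwrithe n D0 = 0" for n
    using flat_trivial_dwrithe[OF code[OF D0(1)]] D0(2) by (simp add: totally_flat_trivial_diagram_def)
  have smooth0: "dwrithe n (smooth D0 c) = 0" if "c \<in> classical D0" for n c
    using flat_trivial_dwrithe[OF virtual_code_smooth[OF code[OF D0(1)] that]] D0(2) that
    by (simp add: totally_flat_trivial_diagram_def)
  have zero: "dwrithe n D = 0" if "D \<in> K" for n D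
    using virtual_equiv_dwrithe[OF code[OF D0(1)] code[OF that] equiv[OF that], of n] zero0 by simp
  \<comment> \<open>At \<open>D0\<close> every smoothing has n-dwrithe zero, so each summand
    contains a factor \<open>g i 0\<close>; invariance carries the value to
    \<open>D\<close>.\<close>
  have smooth: "smooth_poly g n D = 0" if "D \<in> K" "\<And>i. g i 0 = 0" for g n D
    using virtual_equiv_smooth_poly[OF equiv[OF that(1)] zero0, of g n] that(2) smooth0
    by (simp add: smooth_poly_def)
  show ?thesis
    using L_poly_eq_embed[OF zero smooth] F_poly_eq_embed[OF zero smooth]
      palindromic_affine_index_poly[OF zero] by blast
qed

end
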